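(* Consider the $N$-player stochastic dynamic game described in the context ($N\in\mathbb{N}$, horizon $T\in\mathbb{N}\cup\{\infty\}$) and assume: (1) each of the sets $\mathbb{X}^0,\dots,\mathbb{X}^N,\mathbb{U}^1,\dots,\mathbb{U}^N,\mathbb{W}^0,\dots,\mathbb{W}^N,\mathbb{Y},\Xi$ is a (nonempty) compact metric space; (2) all the functions $c_t^i$ ($i\in[1,N]$, $t\in[0,T]$), $f_t^i$ ($i\in[0,N]$, $t\in[0,T)$) and $g_t$ ($t\in[0,T)$) are continuous; (3) for all $i\in[1,N]$, $\mathbb{S}^i=\times_{t\in[0,T)}\mathbb{S}_t^i$ where, for each $t\in[0,T)$, $\mathbb{S}_t^i$ is a nonempty compact subset of the space of continuous functions from $\mathbb{I}_t^i\times\mathbb{Y}^{[0,t)}$ to $\mathbb{U}^i$ equipped with the supremum (uniform) metric; (4) for some $\bar c<\infty$ and $\bar\beta<1$, $\sup_{(i,t,x^i,u^i,y)\in[1,N]\times[0,T]\times\mathbb{X}^i\times\mathbb{U}^i\times\mathbb{Y}}|c_t^i(x^i,u^i,y)|<\bar c$ (where for $t=T$ the expression means $c_T^i(x^i)$) and $\sup_{i\in[1,N]}\beta^i<\bar\beta$. Then: (i) There exists an SEBEU in mixed strategies. (ii) If there are sets of identical DMs, where DM$^i$ and DM$^j$ are called identical if $BR^i(\zeta)=BR^j(\zeta)$ for all $\zeta\in\mathcal{P}(\mathbb{Y}^{[0,T)})$, then there exists a symmetric SEBEU in mixed strategies $\gamma=(\gamma^1,\dots,\gamma^N)\in\Gamma$,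 i.e. one such that $\gamma^i=\gamma^j$ whenever DM$^i$ and DM$^j$ are identical.
   Context: Notation: $\mathbb{N}_0$ and $\mathbb{N}$ are the nonnegative and positive integers; $[1,N]=\{1,\dots,N\}$, $[0,T)=\{0,\dots,T-1\}$ if $T\in\mathbb{N}$ and $[0,T)=\mathbb{N}_0$ if $T=\infty$. $\mathcal{P}(\mathbb{T})$ is the set of Borel probability measures on a topological space $\mathbb{T}$. Countable products of metric spaces carry the product metric $m(a,b)=\sum_t 2^{-t}\frac{m_t(a_t,b_t)}{1+m_t(a_t,b_t)}$ (product topology). Game: there are $N$ decision makers DM$^1,\dots,$DM$^N$. At time $t$, DM$^i$ has state $x_t^i\in\mathbb{X}^i$, control $u_t^i\in\mathbb{U}^i$, random disturbance $w_t^i\in\mathbb{W}^i$; there is an environment variable $y_t\in\mathbb{Y}$, an environment state $x_t^0\in\mathbb{X}^0$, and random disturbances $w_t^0\in\mathbb{W}^0$, $\xi_t\in\Xi$. With $x_t=(x_t^1,\dots,x_t^N)$, $u_t=(u_t^1,\dots,u_t^N)$, the dynamics for $t\in[0,T)$ are $x_{t+1}^i=f_t^i(x_t^i,u_t^i,y_t,w_t^i)$ for $i\in[1,N]$, $y_t=g_t(x_t^0,x_t,u_t,\xi_t)$, $x_{t+1}^0=f_t^0(x_t^0,x_t,u_t,w_t^0)$. The primitive random variables (initial states $x_0^0,\dots,x_0^N$ and all disturbances $w_t^0,\dots,w_t^N,\xi_t$) have a given joint distribution. Information and pure strategies: $I_0^i=x_0^i$, $I_t^i=((x_k^i)_{k\in[0,t]},(u_k^i)_{k\in[0,t)})\in\mathbb{I}_t^i:=(\mathbb{X}^i)^{[0,t]}\times(\mathbb{U}^i)^{[0,t)}$,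 $Y_{-1}=\emptyset$, $Y_{t-1}=(y_k)_{k\in[0,t)}$. A pure strategy for DM$^i$ is $s^i=(s_t^i)_{t\in[0,T)}$ with $s_t^i:\mathbb{I}_t^i\times\mathbb{Y}^{[0,t)}\to\mathbb{U}^i$; using it means $u_t^i=s_t^i(I_t^i,Y_{t-1})$. $\mathbb{S}^i$ is the set of admissible pure strategies of DM$^i$, $\mathbb{S}=\mathbb{S}^1\times\cdots\times\mathbb{S}^N$. For $s\in\mathbb{S}$, $\zeta_s\in\mathcal{P}(\mathbb{Y}^{[0,T)})$ is the distribution of $Y_{T-1}=(y_t)_{t\in[0,T)}$ generated by the dynamics when each DM$^i$ uses $s^i$. Costs: DM$^i$ has discount factor $\beta^i\in(0,1]$ ($\beta^i\in(0,1)$ if $T=\infty$), stage costs $c_t^i:\mathbb{X}^i\times\mathbb{U}^i\times\mathbb{Y}\to\mathbb{R}$, $t\in[0,T)$, and terminal cost $c_T^i:\mathbb{X}^i\to\mathbb{R}$ ($c_T^i\equiv0$ if $T=\infty$). For $s^i\in\mathbb{S}^i$ and a deterministic sequence $\bar Z_{T-1}=(\bar z_t)_{t\in[0,T)}\in\mathbb{Y}^{[0,T)}$, put $J^i(s^i,\bar Z_{T-1})=E\big[\sum_{t\in[0,T)}(\beta^i)^tc_t^i(x_t^i,u_t^i,\bar z_t)+(\beta^i)^Tc_T^i(x_T^i)\big]$, where $x_{t+1}^i=f_t^i(x_t^i,u_t^i,\bar z_t,w_t^i)$ and $u_t^i=s_t^i(I_t^i,(\bar z_0,\dots,\bar z_{t-1}))$;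 the expectation is over $(x_0^i,(w_t^i)_t)$. Mixed strategies: $\Gamma^i=\mathcal{P}(\mathbb{S}^i)$, $\Gamma=\Gamma^1\times\cdots\times\Gamma^N$. Under $\gamma=(\gamma^1,\dots,\gamma^N)\in\Gamma$ each DM$^i$ draws $s^i\sim\gamma^i$ independently (of the other DMs and of the primitive random variables) and uses $s^i$. Set $\zeta_\gamma(B)=E^\gamma[\zeta_s(B)]=\int\zeta_s(B)\,\gamma^1(ds^1)\cdots\gamma^N(ds^N)$ for Borel $B\subset\mathbb{Y}^{[0,T)}$. For $\gamma^i\in\Gamma^i$, $\zeta\in\mathcal{P}(\mathbb{Y}^{[0,T)})$, $E^{(\gamma^i,\zeta)}[J^i]=\int\int J^i(s^i,z)\,\gamma^i(ds^i)\,\zeta(dz)$, and $BR^i(\zeta)=\{\gamma^i\in\Gamma^i: E^{(\gamma^i,\zeta)}[J^i]\le E^{(\tilde\gamma^i,\zeta)}[J^i]\ \forall\tilde\gamma^i\in\Gamma^i\}$. SEBEU (subjective equilibrium under beliefs of exogenous uncertainty) in mixed strategies: a profile $\gamma\in\Gamma$ such that $\gamma^i\in BR^i(\zeta_\gamma)$ for every $i\in[1,N]$ (each DM's strategy is optimal when the environment sequence is believed to be an independent exogenous random sequence with distribution $\zeta_\gamma$, which is the true distribution generated by $\gamma$). *)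

theory Defs
  imports "HOL-Probability.Probability"
begin

text \<open>
  The decision makers (DMs) are the elements of a finite type \<open>'i\<close>. The spaces belonging to the
  individual DMs are subsets of common metric types \<open>'x\<close>, \<open>'u\<close>, \<open>'w\<close>; up to isometry this covers
  every finite family of compact metric spaces. Having one metric per type matters for comparing
  different DMs: if two DMs have the same set of pure strategies, then the two strategy spaces
  carry the same metric.

  A private history of length \<open>t\<close> is a triple consisting of the own states \<open>x\<^sub>0,\<dots>,x\<^sub>t\<close>, the own
  controls \<open>u\<^sub>0,\<dots>,u\<^sub>t\<^sub>-\<^sub>1\<close> and the environment variables \<open>y\<^sub>0,\<dots>,y\<^sub>t\<^sub>-\<^sub>1\<close>, each of them a function on
  \<open>nat\<close> that is \<open>undefined\<close> outside its index set.
\<close>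

type_synonym ('x, 'u, 'y) history = "(nat \<Rightarrow> 'x) \<times> (nat \<Rightarrow> 'u) \<times> (nat \<Rightarrow> 'y)"

type_synonym ('x, 'u, 'y) pure_strategy = "nat \<Rightarrow> ('x, 'u, 'y) history \<Rightarrow> 'u"

record ('i, 'x0, 'x, 'u, 'y, 'w0, 'w, 'n, 'om) dynamic_game =
  horizon :: enat
  env_states :: "'x0 set"
  states :: "'i \<Rightarrow> 'x set"
  controls :: "'i \<Rightarrow> 'u set"
  env_vars :: "'y set"
  env_noises :: "'w0 set"
  noises :: "'i \<Rightarrow> 'w set"
  obs_noises :: "'n set"                                        \<comment> \<open>the space \<open>\<Xi>\<close>\<close>
  state_map :: "'i \<Rightarrow> nat \<Rightarrow> 'x \<times> 'u \<times> 'y \<times> 'w \<Rightarrow> 'x"          \<comment> \<open>\<open>f\<^sub>t\<^sup>i\<close>\<close>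
  env_var_map :: "nat \<Rightarrow> 'x0 \<times> ('i \<Rightarrow> 'x) \<times> ('i \<Rightarrow> 'u) \<times> 'n \<Rightarrow> 'y"     \<comment> \<open>\<open>g\<^sub>t\<close>\<close>
  env_state_map :: "nat \<Rightarrow> 'x0 \<times> ('i \<Rightarrow> 'x) \<times> ('i \<Rightarrow> 'u) \<times> 'w0 \<Rightarrow> 'x0"  \<comment> \<open>\<open>f\<^sub>t\<^sup>0\<close>\<close>
  stage_cost :: "'i \<Rightarrow> nat \<Rightarrow> 'x \<times> 'u \<times> 'y \<Rightarrow> real"
  terminal_cost :: "'i \<Rightarrow> 'x \<Rightarrow> real"     \<comment> \<open>ignored if the horizon is infinite\<close>
  discount :: "'i \<Rightarrow> real"
  strategies_at :: "'i \<Rightarrow> nat \<Rightarrow> (('x, 'u, 'y) history \<Rightarrow> 'u) set"   \<comment> \<open>\<open>S\<^sub>t\<^sup>i\<close>\<close>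
  prim :: "'om measure"           \<comment> \<open>probability space carrying the primitive random variables\<close>
  env_init :: "'om \<Rightarrow> 'x0"
  init :: "'i \<Rightarrow> 'om \<Rightarrow> 'x"
  env_noise :: "nat \<Rightarrow> 'om \<Rightarrow> 'w0"
  noise :: "'i \<Rightarrow> nat \<Rightarrow> 'om \<Rightarrow> 'w"
  obs_noise :: "nat \<Rightarrow> 'om \<Rightarrow> 'n"

definition periods :: "('i, 'x0, 'x, 'u, 'y, 'w0, 'w, 'n, 'om) dynamic_game \<Rightarrow> nat set" where
  "periods G = {t. enat t < horizon G}"

definition histories ::
  "('i, 'x0, 'x, 'u, 'y, 'w0, 'w, 'n, 'om) dynamic_game \<Rightarrow> 'i \<Rightarrow> nat \<Rightarrow> ('x, 'u, 'y) history set"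
  where
  "histories G i t =
     (\<Pi>\<^sub>E k\<in>{..t}. states G i) \<times> (\<Pi>\<^sub>E k\<in>{..<t}. controls G i) \<times> (\<Pi>\<^sub>E k\<in>{..<t}. env_vars G)"

text \<open>
  The standing structure of the game. No independence between the primitive random variables is
  assumed: their joint distribution is arbitrary.
\<close>

definition dynamic_game ::
  "('i::finite, 'x0::metric_space, 'x::metric_space, 'u::metric_space, 'y::metric_space,
    'w0::metric_space, 'w::metric_space, 'n::metric_space, 'om) dynamic_game \<Rightarrow> bool" where
  "dynamic_game G \<longleftrightarrow>
     0 < horizon G \<and>
     (\<forall>t\<in>periods G.
        (\<forall>i. state_map G i t \<in> states G i \<times> controls G i \<times> env_vars G \<times> noises G i \<rightarrow> states G i) \<and>
        env_var_map G t
          \<in> env_states G \<times> Pi UNIV (states G) \<times> Pi UNIV (controls G) \<times> obs_noises G \<rightarrow> env_vars G \<and>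
        env_state_map G t
          \<in> env_states G \<times> Pi UNIV (states G) \<times> Pi UNIV (controls G) \<times> env_noises G \<rightarrow> env_states G) \<and>
     prob_space (prim G) \<and>
     env_init G \<in> prim G \<rightarrow>\<^sub>M restrict_space borel (env_states G) \<and>
     (\<forall>i. init G i \<in> prim G \<rightarrow>\<^sub>M restrict_space borel (states G i)) \<and>
     (\<forall>t\<in>periods G.
        env_noise G t \<in> prim G \<rightarrow>\<^sub>M restrict_space borel (env_noises G) \<and>
        (\<forall>i. noise G i t \<in> prim G \<rightarrow>\<^sub>M restrict_space borel (noises G i)) \<and>
        obs_noise G t \<in> prim G \<rightarrow>\<^sub>M restrict_space borel (obs_noises G)) \<and>
     (\<forall>i. 0 < discount G i \<and> discount G i \<le> 1 \<and> (horizon G = \<infinity> \<longrightarrow> discount G i < 1))"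


subsection \<open>Borel probability measures\<close>

definition borel_of :: "'a topology \<Rightarrow> 'a measure" where
  "borel_of X = sigma (topspace X) {U. openin X U}"

definition borel_probs :: "'a topology \<Rightarrow> 'a measure set" where
  "borel_probs X = {\<mu>. prob_space \<mu> \<and> sets \<mu> = sets (borel_of X)}"


subsection \<open>Strategy spaces\<close>

text \<open>Continuous functions from histories to controls, with the supremum metric.\<close>

definition cont_rules ::
  "('i, 'x0, 'x::metric_space, 'u::metric_space, 'y::metric_space, 'w0, 'w, 'n, 'om) dynamic_game
     \<Rightarrow> 'i \<Rightarrow> nat \<Rightarrow> (('x, 'u, 'y) history \<Rightarrow> 'u) metric" where
  "cont_rules G i t =
     cfunspace (top_of_set (histories G i t)) (submetric euclidean_metric (controls G i))"

definition strategy_top ::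
  "('i, 'x0, 'x::metric_space, 'u::metric_space, 'y::metric_space, 'w0, 'w, 'n, 'om) dynamic_game
     \<Rightarrow> 'i \<Rightarrow> ('x, 'u, 'y) pure_strategy topology" where
  "strategy_top G i =
     product_topology (\<lambda>t. subtopology (mtopology_of (cont_rules G i t)) (strategies_at G i t))
       (periods G)"

definition mixed_strategies ::
  "('i, 'x0, 'x::metric_space, 'u::metric_space, 'y::metric_space, 'w0, 'w, 'n, 'om) dynamic_game
     \<Rightarrow> 'i \<Rightarrow> ('x, 'u, 'y) pure_strategy measure set" where
  "mixed_strategies G i = borel_probs (strategy_top G i)"

definition env_path_top ::
  "('i, 'x0, 'x, 'u, 'y::metric_space, 'w0, 'w, 'n, 'om) dynamic_game \<Rightarrow> (nat \<Rightarrow> 'y) topology" where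
  "env_path_top G = product_topology (\<lambda>t. top_of_set (env_vars G)) (periods G)"


subsection \<open>The true dynamics\<close>

text \<open>
  \<open>play G s \<omega> t = (x\<^sub>t\<^sup>0, X, U, Y)\<close> where, for each DM \<open>i\<close>, \<open>(X i, U i, Y)\<close> is the private history
  of length \<open>t\<close> when all DMs use the profile \<open>s\<close> and \<open>\<omega>\<close> is the outcome of the primitive
  randomness.
\<close>

primrec play ::
  "('i, 'x0, 'x, 'u, 'y, 'w0, 'w, 'n, 'om) dynamic_game \<Rightarrow> ('i \<Rightarrow> ('x, 'u, 'y) pure_strategy)
     \<Rightarrow> 'om \<Rightarrow> nat \<Rightarrow> 'x0 \<times> ('i \<Rightarrow> nat \<Rightarrow> 'x) \<times> ('i \<Rightarrow> nat \<Rightarrow> 'u) \<times> (nat \<Rightarrow> 'y)" where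
  "play G s \<omega> 0 =
     (env_init G \<omega>, \<lambda>i. (\<lambda>_. undefined)(0 := init G i \<omega>), \<lambda>i _. undefined, \<lambda>_. undefined)"
| "play G s \<omega> (Suc t) =
     (let (e, X, U, Y) = play G s \<omega> t;
          x = (\<lambda>i. X i t);
          u = (\<lambda>i. s i t (X i, U i, Y));
          y = env_var_map G t (e, x, u, obs_noise G t \<omega>)
      in (env_state_map G t (e, x, u, env_noise G t \<omega>),
          \<lambda>i. (X i)(Suc t := state_map G i t (x i, u i, y, noise G i t \<omega>)),
          \<lambda>i. (U i)(t := u i),
          Y(t := y)))"

definition env_path ::
  "('i, 'x0, 'x, 'u, 'y, 'w0, 'w, 'n, 'om) dynamic_game \<Rightarrow> ('i \<Rightarrow> ('x, 'u, 'y) pure_strategy)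
     \<Rightarrow> 'om \<Rightarrow> nat \<Rightarrow> 'y" where
  "env_path G s \<omega> = (\<lambda>t\<in>periods G. case play G s \<omega> (Suc t) of (e, X, U, Y) \<Rightarrow> Y t)"

text \<open>The law \<open>\<zeta>\<^sub>s\<close> of the environment variables under a pure profile, and its mixture \<open>\<zeta>\<^sub>\<gamma>\<close>.\<close>

definition env_law_pure ::
  "('i, 'x0, 'x, 'u, 'y::metric_space, 'w0, 'w, 'n, 'om) dynamic_game
     \<Rightarrow> ('i \<Rightarrow> ('x, 'u, 'y) pure_strategy) \<Rightarrow> (nat \<Rightarrow> 'y) measure" where
  "env_law_pure G s = distr (prim G) (borel_of (env_path_top G)) (env_path G s)"

definition env_law ::
  "('i, 'x0, 'x, 'u, 'y::metric_space, 'w0, 'w, 'n, 'om) dynamic_game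
     \<Rightarrow> ('i \<Rightarrow> ('x, 'u, 'y) pure_strategy measure) \<Rightarrow> (nat \<Rightarrow> 'y) measure" where
  "env_law G \<gamma> =
     measure_of (space (borel_of (env_path_top G))) (sets (borel_of (env_path_top G)))
       (\<lambda>B. \<integral>\<^sup>+ s. emeasure (env_law_pure G s) B \<partial>(\<Pi>\<^sub>M i\<in>UNIV. \<gamma> i))"


subsection \<open>Costs against an exogenous environment path\<close>

text \<open>
  \<open>own_play G i s z \<omega> t = (X, U)\<close> are the states \<open>x\<^sub>0,\<dots>,x\<^sub>t\<close> and controls \<open>u\<^sub>0,\<dots>,u\<^sub>t\<^sub>-\<^sub>1\<close> of DM \<open>i\<close>
  using \<open>s\<close> when the environment variables are the deterministic sequence \<open>z\<close>.
\<close>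

primrec own_play ::
  "('i, 'x0, 'x, 'u, 'y, 'w0, 'w, 'n, 'om) dynamic_game \<Rightarrow> 'i \<Rightarrow> ('x, 'u, 'y) pure_strategy
     \<Rightarrow> (nat \<Rightarrow> 'y) \<Rightarrow> 'om \<Rightarrow> nat \<Rightarrow> (nat \<Rightarrow> 'x) \<times> (nat \<Rightarrow> 'u)" where
  "own_play G i s z \<omega> 0 = ((\<lambda>_. undefined)(0 := init G i \<omega>), \<lambda>_. undefined)"
| "own_play G i s z \<omega> (Suc t) =
     (let (X, U) = own_play G i s z \<omega> t;
          u = s t (X, U, restrict z {..<t})
      in (X(Suc t := state_map G i t (X t, u, z t, noise G i t \<omega>)), U(t := u)))"

definition own_state ::
  "('i, 'x0, 'x, 'u, 'y, 'w0, 'w, 'n, 'om) dynamic_game \<Rightarrow> 'i \<Rightarrow> ('x, 'u, 'y) pure_strategy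
     \<Rightarrow> (nat \<Rightarrow> 'y) \<Rightarrow> 'om \<Rightarrow> nat \<Rightarrow> 'x" where
  "own_state G i s z \<omega> t = fst (own_play G i s z \<omega> t) t"

definition own_control ::
  "('i, 'x0, 'x, 'u, 'y, 'w0, 'w, 'n, 'om) dynamic_game \<Rightarrow> 'i \<Rightarrow> ('x, 'u, 'y) pure_strategy
     \<Rightarrow> (nat \<Rightarrow> 'y) \<Rightarrow> 'om \<Rightarrow> nat \<Rightarrow> 'u" where
  "own_control G i s z \<omega> t = snd (own_play G i s z \<omega> (Suc t)) t"

definition cost ::
  "('i, 'x0, 'x, 'u, 'y, 'w0, 'w, 'n, 'om) dynamic_game \<Rightarrow> 'i \<Rightarrow> ('x, 'u, 'y) pure_strategy
     \<Rightarrow> (nat \<Rightarrow> 'y) \<Rightarrow> real" where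
  "cost G i s z =
     (\<integral>\<omega>. (\<Sum>\<^sub>\<infinity>t\<in>periods G. discount G i ^ t *
                stage_cost G i t (own_state G i s z \<omega> t, own_control G i s z \<omega> t, z t))
           + (case horizon G of
                enat n \<Rightarrow> discount G i ^ n * terminal_cost G i (own_state G i s z \<omega> n)
              | \<infinity> \<Rightarrow> 0) \<partial>prim G)"

definition expected_cost ::
  "('i, 'x0, 'x, 'u, 'y, 'w0, 'w, 'n, 'om) dynamic_game \<Rightarrow> 'i \<Rightarrow> ('x, 'u, 'y) pure_strategy measure
     \<Rightarrow> (nat \<Rightarrow> 'y) measure \<Rightarrow> real" where
  "expected_cost G i \<mu> \<zeta> = (\<integral>z. (\<integral>s. cost G i s z \<partial>\<mu>) \<partial>\<zeta>)"


subsection \<open>Equilibrium\<close>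

definition best_replies ::
  "('i, 'x0, 'x::metric_space, 'u::metric_space, 'y::metric_space, 'w0, 'w, 'n, 'om) dynamic_game
     \<Rightarrow> 'i \<Rightarrow> (nat \<Rightarrow> 'y) measure \<Rightarrow> ('x, 'u, 'y) pure_strategy measure set" where
  "best_replies G i \<zeta> =
     {\<mu> \<in> mixed_strategies G i.
        \<forall>\<nu> \<in> mixed_strategies G i. expected_cost G i \<mu> \<zeta> \<le> expected_cost G i \<nu> \<zeta>}"

text \<open>
  Subjective equilibrium under beliefs of exogenous uncertainty (SEBEU), in mixed strategies.
\<close>

definition SEBEU ::
  "('i, 'x0, 'x::metric_space, 'u::metric_space, 'y::metric_space, 'w0, 'w, 'n, 'om) dynamic_game
     \<Rightarrow> ('i \<Rightarrow> ('x, 'u, 'y) pure_strategy measure) \<Rightarrow> bool" where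
  "SEBEU G \<gamma> \<longleftrightarrow>
     (\<forall>i. \<gamma> i \<in> mixed_strategies G i) \<and> (\<forall>i. \<gamma> i \<in> best_replies G i (env_law G \<gamma>))"

definition identical ::
  "('i, 'x0, 'x::metric_space, 'u::metric_space, 'y::metric_space, 'w0, 'w, 'n, 'om) dynamic_game
     \<Rightarrow> 'i \<Rightarrow> 'i \<Rightarrow> bool" where
  "identical G i j \<longleftrightarrow>
     (\<forall>\<zeta> \<in> borel_probs (env_path_top G). best_replies G i \<zeta> = best_replies G j \<zeta>)"

end

theory Submission
  imports Defs
begin

text \<open>
  A profile \<open>\<gamma>\<close> is a SEBEU iff each \<open>\<gamma>\<^sup>i\<close> is concentrated on the minimisers over \<open>a\<close> of
  \<open>\<integral> F\<^sub>i(a, s) \<gamma>(ds)\<close>, where \<open>F\<^sub>i(a, s) = E[J\<^sup>i(a, Y)]\<close> and \<open>Y\<close> is the environment path generated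
  by the pure profile \<open>s\<close>. By dominated convergence \<open>F\<^sub>i\<close> is continuous on a product of compact
  metrizable strategy spaces.

  Instead of a fixed-point theorem in a space of measures, finite approximations are used. Each
  strategy space is a continuous image of a compact subset of \<open>\<real>\<close> (a closed subset of the Cantor
  set), so the game can be pulled back to the real line. With finitely many actions, taken from a
  dense sequence, Brouwer's theorem applied to Nash's map gives an equilibrium; Helly's selection
  theorem gives a weak limit along a subsequence, and Skorohod's representation shows that the
  equilibrium inequalities survive in the limit.

  For symmetry, identical DMs are made to copy a representative of their class. This is legitimate
  because having the same best replies forces them to have the same strategy space, topology included.
\<close>


section \<open>Brouwer on cubes in function spaces\<close>

text \<open>A deviating DM believes that the environment path keeps its law. So the two arguments of
  F_i(a, s) are independent, and the profile s still contains a separate draw of DM i's own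
  strategy. The finite games are therefore not multilinear matrix games. Nash's map copes with this:
  it uses only that the cost of each action is continuous in the whole profile of weights and that
  the own action is averaged. Helly's and Skorohod's theorems concern measures on the real line,
  whereas a pure strategy is a sequence of functions. A continuous surjection from a compact set of
  reals bridges this gap: costs are pulled back along it, measures are pushed forward. Tietze's
  theorem then extends the pulled-back costs to bounded continuous functions on the whole space, on
  which weak limits can be tested. Continuity is handled through sequences throughout, because
  dominated convergence speaks of sequences. Measurability in several variables comes from countably
  valued approximations, so the Borel sets of a product of spaces of the game never have to be
  compared with a product sigma-algebra.\<close>

lemma tendsto_fun_iff:
  fixes x :: "'a \<Rightarrow> 'b::topological_space"
  shows "(X \<longlongrightarrow> x) F \<longleftrightarrow> (\<forall>i. ((\<lambda>n. X n i) \<longlongrightarrow> x i) F)"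
  using limitin_componentwise[of "\<lambda>_. euclidean :: 'b topology" UNIV X x F]
  by (simp add: euclidean_product_topology)

lemma compact_Pi:
  fixes S :: "'a \<Rightarrow> 'b::topological_space set"
  assumes "\<And>i. compact (S i)"
  shows "compact (Pi UNIV S)"
  using compactin_PiE[of "\<lambda>_. euclidean :: 'b topology" UNIV S] assms
  by (simp add: euclidean_product_topology PiE_UNIV_domain)

text \<open>Kuhn's combinatorial lemma on the grid of mesh \<open>1 / p\<close>: a label records
  whether \<open>f\<close> pushes a coordinate up or down, and some grid cell shows both labels in
  every coordinate. Its lowest corner is \<open>w\<close>; differently labelled vertices give
  \<open>u\<close> and \<open>v\<close>. Coordinates outside \<open>I\<close> are held at 0.\<close>

lemma brouwer_cube_approx:
  fixes f :: "('b \<Rightarrow> real) \<Rightarrow> 'b \<Rightarrow> real"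
  assumes "finite I" "p > 0"
    and f01: "\<And>x i. (\<forall>j. 0 \<le> x j \<and> x j \<le> 1) \<Longrightarrow> i \<in> I \<Longrightarrow> 0 \<le> f x i \<and> f x i \<le> 1"
  obtains w where "w \<in> Pi UNIV (\<lambda>i. if i \<in> I then {0..1::real} else {0})"
    "\<And>i. i \<in> I \<Longrightarrow> \<exists>u v. (\<forall>j. 0 \<le> u j \<and> u j \<le> 1 \<and> \<bar>u j - w j\<bar> \<le> 1 / real p) \<and>
       (\<forall>j. 0 \<le> v j \<and> v j \<le> 1 \<and> \<bar>v j - w j\<bar> \<le> 1 / real p) \<and> u i \<le> f u i \<and> f v i \<le> v i"
proof -
  define n where "n = card I"
  obtain h where h: "bij_betw h {..<n} I"
    using ex_bij_betw_nat_finite[OF assms(1)] by (auto simp: n_def lessThan_atLeast0)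
  define g where "g = inv_into {..<n} h"
  have gh: "g (h i) = i" "h i \<in> I" if "i < n" for i
    using h that by (auto simp: g_def bij_betw_def inv_into_f_f)
  have hg: "h (g b) = b" "g b < n" if "b \<in> I" for b
    using h that inv_into_into[of b h "{..<n}"] by (auto simp: g_def bij_betw_def f_inv_into_f)
  define X where "X y b = (if b \<in> I then real (y (g b)) / real p else 0)" for y :: "nat \<Rightarrow> nat" and b
  have X01: "0 \<le> X y j \<and> X y j \<le> 1" if "\<forall>i<n. y i \<le> p" for y j
    using that hg(2)[of j] \<open>p > 0\<close> by (auto simp: X_def divide_le_eq_1)
  \<comment> \<open>\<open>kuhn_lemma\<close> prescribes the labels on the faces
    \<open>y i = 0\<close> and \<open>y i = p\<close>. There they still point the right way
    (\<open>l0\<close>, \<open>l1\<close>) because \<open>f\<close> takes values in the unit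
    interval.\<close>
  define label where "label y i = (if y i = 0 then 0 else if y i = p then 1
     else if X y (h i) \<le> f (X y) (h i) then 0 else (1::nat))" for y i
  obtain q where q: "\<forall>i<n. q i < p"
    and q2: "\<forall>i<n. \<exists>r s. (\<forall>j<n. q j \<le> r j \<and> r j \<le> q j + 1) \<and> (\<forall>j<n. q j \<le> s j \<and> s j \<le> q j + 1)
      \<and> label r i \<noteq> label s i"
    by (rule kuhn_lemma[of p n label]) (use \<open>p > 0\<close> in \<open>auto simp: label_def\<close>)
  have close: "\<bar>X r j - X q j\<bar> \<le> 1 / real p" if "\<forall>j<n. q j \<le> r j \<and> r j \<le> q j + 1" for r j
  proof -
    have "q (g j) \<le> r (g j) \<and> r (g j) \<le> q (g j) + 1" if "j \<in> I"
      using that hg(2) \<open>\<forall>j<n. q j \<le> r j \<and> r j \<le> q j + 1\<close> by blast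
    then have "real (q (g j)) \<le> real (r (g j)) \<and> real (r (g j)) \<le> real (q (g j)) + 1" if "j \<in> I"
      using that by linarith
    then have "\<bar>real (r (g j)) - real (q (g j))\<bar> \<le> 1" if "j \<in> I"
      using that by force
    then have "\<bar>real (r (g j)) - real (q (g j))\<bar> / real p \<le> 1 / real p" if "j \<in> I"
      using that by (intro divide_right_mono) auto
    then show ?thesis
      using \<open>p > 0\<close> by (auto simp: X_def diff_divide_distrib[symmetric])
  qed
  have le_p: "\<forall>j<n. r j \<le> p" if "\<forall>j<n. q j \<le> r j \<and> r j \<le> q j + 1" for r
  proof (intro allI impI)
    fix j assume "j < n"
    then have "r j \<le> q j + 1" "q j < p" using that q by blast+
    then show "r j \<le> p" by linarith
  qed
  have l0: "X y (h i) \<le> f (X y) (h i)" if "\<forall>j<n. y j \<le> p" "label y i = 0" "i < n" for y i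
    using that f01[of "X y" "h i"] X01[OF that(1)] gh[OF that(3)]
    by (auto simp: label_def split: if_splits) (auto simp: X_def)
  have l1: "X y (h i) \<ge> f (X y) (h i)" if "\<forall>j<n. y j \<le> p" "label y i \<noteq> 0" "i < n" for y i
    using that f01[of "X y" "h i"] X01[OF that(1)] gh[OF that(3)] \<open>p > 0\<close>
    by (auto simp: label_def split: if_splits) (auto simp: X_def)
  show ?thesis
  proof (rule that[of "X q"])
    show "X q \<in> Pi UNIV (\<lambda>i. if i \<in> I then {0..1::real} else {0})"
      using X01[of q] q by (auto simp: less_imp_le) (auto simp: X_def)
    fix b assume "b \<in> I"
    then have gb: "g b < n" "h (g b) = b" using hg by auto
    obtain r s where r: "\<forall>j<n. q j \<le> r j \<and> r j \<le> q j + 1" and s: "\<forall>j<n. q j \<le> s j \<and> s j \<le> q j + 1"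
      and ne: "label r (g b) \<noteq> label s (g b)"
      using spec[OF q2, of "g b"] gb(1) by (elim impE exE conjE) auto
    have L: "label y i = 0 \<or> label y i = 1" for y i by (auto simp: label_def)
    have good: "(\<forall>j. 0 \<le> X y j \<and> X y j \<le> 1 \<and> \<bar>X y j - X q j\<bar> \<le> 1 / real p)"
      if "\<forall>j<n. q j \<le> y j \<and> y j \<le> q j + 1" for y
      using X01[OF le_p[OF that]] close[OF that] by blast
    have low: "X y b \<le> f (X y) b" if "\<forall>j<n. q j \<le> y j \<and> y j \<le> q j + 1" "label y (g b) = 0" for y
      using l0[OF le_p[OF that(1)] that(2) gb(1)] unfolding gb(2) .
    have high: "f (X y) b \<le> X y b" if "\<forall>j<n. q j \<le> y j \<and> y j \<le> q j + 1" "label y (g b) \<noteq> 0" for y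
      using l1[OF le_p[OF that(1)] that(2) gb(1)] unfolding gb(2) .
    from L[of r "g b"] L[of s "g b"] ne consider "label r (g b) = 0" "label s (g b) \<noteq> 0"
      | "label s (g b) = 0" "label r (g b) \<noteq> 0" by auto
    then show "\<exists>u v. (\<forall>j. 0 \<le> u j \<and> u j \<le> 1 \<and> \<bar>u j - X q j\<bar> \<le> 1 / real p) \<and>
       (\<forall>j. 0 \<le> v j \<and> v j \<le> 1 \<and> \<bar>v j - X q j\<bar> \<le> 1 / real p) \<and> u b \<le> f u b \<and> f v b \<le> v b"
    proof cases
      case 1
      show ?thesis
        using good[OF r] good[OF s] low[OF r 1(1)] high[OF s 1(2)]
        by - (rule exI[of _ "X r"], rule exI[of _ "X s"], blast)
    next
      case 2
      show ?thesis
        using good[OF r] good[OF s] low[OF s 2(1)] high[OF r 2(2)]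
        by - (rule exI[of _ "X s"], rule exI[of _ "X r"], blast)
    qed
  qed
qed

text \<open>A countable index type makes the function space first countable, so the approximate
  fixed points have a convergent subsequence. The two witnesses of a coordinate are squeezed to the
  same limit \<open>x\<close>, and continuity turns their inequalities into
  \<open>x i \<le> f x i\<close> and \<open>f x i \<le> x i\<close>. Fixing only the coordinates in
  \<open>I\<close> allows the infinite index type \<open>'i \<times> nat\<close> for weights of
  finitely many actions.\<close>

lemma brouwer_cube_fun:
  fixes f :: "('b::countable \<Rightarrow> real) \<Rightarrow> 'b \<Rightarrow> real"
  assumes "finite I"
    and cont: "\<And>i. i \<in> I \<Longrightarrow> continuous_on {x. \<forall>j. 0 \<le> x j \<and> x j \<le> 1} (\<lambda>x. f x i)"
    and f01: "\<And>x i. (\<forall>j. 0 \<le> x j \<and> x j \<le> 1) \<Longrightarrow> i \<in> I \<Longrightarrow> 0 \<le> f x i \<and> f x i \<le> 1"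
  shows "\<exists>x. (\<forall>j. 0 \<le> x j \<and> x j \<le> 1) \<and> (\<forall>i\<in>I. f x i = x i)"
proof -
  let ?Q = "{x :: 'b \<Rightarrow> real. \<forall>j. 0 \<le> x j \<and> x j \<le> 1}"
  let ?K = "Pi UNIV (\<lambda>i. if i \<in> I then {0..1::real} else {0}) :: ('b \<Rightarrow> real) set"
  have "\<forall>m. \<exists>w. w \<in> ?K \<and> (\<forall>i\<in>I. \<exists>u v. (\<forall>j. 0 \<le> u j \<and> u j \<le> 1 \<and> \<bar>u j - w j\<bar> \<le> 1 / real (Suc m)) \<and>
       (\<forall>j. 0 \<le> v j \<and> v j \<le> 1 \<and> \<bar>v j - w j\<bar> \<le> 1 / real (Suc m)) \<and> u i \<le> f u i \<and> f v i \<le> v i)"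
  proof
    fix m
    show "\<exists>w. w \<in> ?K \<and> (\<forall>i\<in>I. \<exists>u v. (\<forall>j. 0 \<le> u j \<and> u j \<le> 1 \<and> \<bar>u j - w j\<bar> \<le> 1 / real (Suc m)) \<and>
       (\<forall>j. 0 \<le> v j \<and> v j \<le> 1 \<and> \<bar>v j - w j\<bar> \<le> 1 / real (Suc m)) \<and> u i \<le> f u i \<and> f v i \<le> v i)"
      by (rule brouwer_cube_approx[of I "Suc m" f]) (use assms in auto)
  qed
  then obtain w where wK: "\<And>m. w m \<in> ?K" and w: "\<And>m. \<forall>i\<in>I. \<exists>u v.
     (\<forall>j. 0 \<le> u j \<and> u j \<le> 1 \<and> \<bar>u j - w m j\<bar> \<le> 1 / real (Suc m)) \<and>
     (\<forall>j. 0 \<le> v j \<and> v j \<le> 1 \<and> \<bar>v j - w m j\<bar> \<le> 1 / real (Suc m)) \<and> u i \<le> f u i \<and> f v i \<le> v i"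
    by metis
  have "compact ?K" by (rule compact_Pi) auto
  then have "seq_compact ?K" by (rule compact_imp_seq_compact)
  then obtain x r where x: "x \<in> ?K" "strict_mono r" "(w \<circ> r) \<longlonglongrightarrow> x"
    using wK unfolding seq_compact_def by metis
  have xQ: "x \<in> ?Q"
  proof -
    have "x j \<in> (if j \<in> I then {0..1} else {0})" for j using x(1) by blast
    then show ?thesis by (auto split: if_splits) (metis atLeastAtMost_iff empty_iff insert_iff order.refl zero_le_one)+
  qed
  have lim: "u \<longlonglongrightarrow> x" if "\<And>m j. \<bar>u m j - w (r m) j\<bar> \<le> 1 / real (Suc (r m))" for u
    unfolding tendsto_fun_iff
  proof
    fix j
    have "(\<lambda>m. w (r m) j) \<longlonglongrightarrow> x j" using x(3) by (simp add: tendsto_fun_iff o_def)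
    moreover have "(\<lambda>m. u m j - w (r m) j) \<longlonglongrightarrow> 0"
    proof (rule Lim_null_comparison)
      show "\<forall>\<^sub>F m in sequentially. norm (u m j - w (r m) j) \<le> 1 / real (Suc (r m))"
        using that by auto
      show "(\<lambda>m. 1 / real (Suc (r m))) \<longlonglongrightarrow> 0"
        using LIMSEQ_subseq_LIMSEQ[OF LIMSEQ_inverse_real_of_nat x(2)] by (simp add: o_def inverse_eq_divide)
    qed
    ultimately show "(\<lambda>m. u m j) \<longlonglongrightarrow> x j" using tendsto_add by fastforce
  qed
  have "f x i = x i" if "i \<in> I" for i
  proof -
    have "\<forall>m. \<exists>u v. (\<forall>j. 0 \<le> u j \<and> u j \<le> 1 \<and> \<bar>u j - w (r m) j\<bar> \<le> 1 / real (Suc (r m))) \<and>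
     (\<forall>j. 0 \<le> v j \<and> v j \<le> 1 \<and> \<bar>v j - w (r m) j\<bar> \<le> 1 / real (Suc (r m))) \<and> u i \<le> f u i \<and> f v i \<le> v i"
      using w that by blast
    then obtain u v where u: "\<And>m. u m \<in> ?Q" "\<And>m j. \<bar>u m j - w (r m) j\<bar> \<le> 1 / real (Suc (r m))"
      and v: "\<And>m. v m \<in> ?Q" "\<And>m j. \<bar>v m j - w (r m) j\<bar> \<le> 1 / real (Suc (r m))"
      and uv: "\<And>m. u m i \<le> f (u m) i" "\<And>m. f (v m) i \<le> v m i"
      by (simp only: mem_Collect_eq) metis
    note lims = lim[of u, OF u(2)] lim[of v, OF v(2)]
    have "(\<lambda>m. f (u m) i) \<longlonglongrightarrow> f x i" "(\<lambda>m. f (v m) i) \<longlonglongrightarrow> f x i"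
      by (rule continuous_on_tendsto_compose[OF cont[OF that]]; use lims u(1) v(1) xQ in simp)+
    moreover have "(\<lambda>m. u m i) \<longlonglongrightarrow> x i" "(\<lambda>m. v m i) \<longlonglongrightarrow> x i"
      using lims by (simp_all add: tendsto_fun_iff)
    ultimately show ?thesis
      using uv by (intro antisym) (meson LIMSEQ_le)+
  qed
  then show ?thesis using xQ by blast
qed

section \<open>Games with finitely many actions\<close>

text \<open>Nash's argument for costs \<open>\<Phi> i k\<close> that may depend on all weights,
  those of \<open>i\<close> included. At a fixed point, weight times total gain equals the gain of
  the action. An action of positive weight that costs at least the average has gain 0, so the total
  gain vanishes and no action beats the average.\<close>

lemma nash_map_fixed_point:
  fixes \<Phi> :: "'i::finite \<Rightarrow> nat \<Rightarrow> ('i \<times> nat \<Rightarrow> real) \<Rightarrow> real"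
  assumes n: "n > 0" and cont: "\<And>i k. continuous_on UNIV (\<Phi> i k)"
  shows "\<exists>p. (\<forall>i k. 0 \<le> p (i, k)) \<and> (\<forall>i. (\<Sum>k<n. p (i, k)) = 1) \<and>
    (\<forall>i. \<forall>k<n. (\<Sum>l<n. p (i, l) * \<Phi> i l p) \<le> \<Phi> i k p)"
proof -
  define S where "S v i = (\<Sum>k<n. v (i, k))" for v :: "'i \<times> nat \<Rightarrow> real" and i
  \<comment> \<open>\<open>P\<close> retracts the cube onto the product of the simplices; \<open>g\<close> is the gain over the average cost.\<close>
  define P where "P v = (\<lambda>(i, k). (v (i, k) + max 0 (1 - S v i) / real n) / max 1 (S v i))"
    for v :: "'i \<times> nat \<Rightarrow> real"
  define avg where "avg p i = (\<Sum>l<n. p (i, l) * \<Phi> i l p)" for p i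
  define g where "g p i k = max 0 (avg p i - \<Phi> i k p)" for p i k
  \<comment> \<open>Composing with \<open>P\<close> defines Nash's map on the whole cube, as
    Brouwer's theorem requires. A fixed point has block sums 1 and is therefore left unchanged by
    \<open>P\<close>.\<close>
  define f where "f v = (\<lambda>(i, k). (P v (i, k) + g (P v) i k) / (1 + (\<Sum>l<n. g (P v) i l)))" for v
  let ?Q = "{x :: 'i \<times> nat \<Rightarrow> real. \<forall>j. 0 \<le> x j \<and> x j \<le> 1}"
  have P_nonneg: "0 \<le> P v (i, k)" if "v \<in> ?Q" for v i k
    using that by (auto simp: P_def intro!: divide_nonneg_nonneg add_nonneg_nonneg)
  have P_sum: "(\<Sum>k<n. P v (i, k)) = 1" if "v \<in> ?Q" for v i
  proof -
    have "(\<Sum>k<n. P v (i, k)) = (\<Sum>k<n. v (i, k) + max 0 (1 - S v i) / real n) / max 1 (S v i)"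
      by (simp add: P_def sum_divide_distrib)
    also have "(\<Sum>k<n. v (i, k) + max 0 (1 - S v i) / real n) = S v i + max 0 (1 - S v i)"
      using n by (simp add: sum.distrib S_def)
    also have "\<dots> / max 1 (S v i) = 1" by (auto simp: max_def)
    finally show ?thesis .
  qed
  have P_le: "P v (i, k) \<le> 1" if "v \<in> ?Q" "k < n" for v i k
    using member_le_sum[of k "{..<n}" "\<lambda>k. P v (i, k)"] that P_nonneg[OF that(1)] P_sum[OF that(1)] by simp
  have g_nonneg: "0 \<le> g p i k" for p i k by (simp add: g_def)
  have g_le: "g p i k \<le> (\<Sum>l<n. g p i l)" if "k < n" for p i k
    using member_le_sum[of k "{..<n}" "g p i"] that g_nonneg by simp
  have contP: "continuous_on UNIV P"
    unfolding continuous_on_coordinatewise_iff P_def S_def case_prod_unfold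
    by (use n in \<open>auto intro!: continuous_intros simp: max_def[symmetric]\<close>)
  have contP1: "continuous_on UNIV (\<lambda>v. P v x)" for x
    by (rule continuous_on_product_then_coordinatewise[OF contP])
  have contPhi: "continuous_on UNIV (\<lambda>v. \<Phi> i k (P v))" for i k
    by (rule continuous_on_compose2[OF cont contP]) auto
  have contg: "continuous_on UNIV (\<lambda>v. g (P v) i k)" for i k
    unfolding g_def avg_def by (intro continuous_intros contP1 contPhi)
  have pos: "0 < 1 + (\<Sum>l<n. g p i l)" for p i
    using sum_nonneg[of "{..<n}" "g p i"] g_nonneg by fastforce
  have contf: "continuous_on UNIV (\<lambda>v. f v x)" for x
  proof -
    have ne: "1 + (\<Sum>l<n. g (P v) i l) \<noteq> 0" for v i using pos[of "P v" i] by linarith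
    show ?thesis
      unfolding f_def case_prod_unfold
      by (intro continuous_intros contP1 contg ballI ne)
  qed
  have "\<exists>x. (\<forall>j. 0 \<le> x j \<and> x j \<le> 1) \<and> (\<forall>i\<in>UNIV \<times> {..<n}. f x i = x i)"
  proof (rule brouwer_cube_fun)
    fix x :: "'i \<times> nat \<Rightarrow> real" and ik
    assume x: "\<forall>j. 0 \<le> x j \<and> x j \<le> 1" and ik: "ik \<in> (UNIV :: 'i set) \<times> {..<n}"
    obtain i k where [simp]: "ik = (i, k)" "k < n" using ik by auto
    have xQ: "x \<in> ?Q" using x by simp
    have "P x (i, k) + g (P x) i k \<le> 1 + (\<Sum>l<n. g (P x) i l)"
      using P_le[OF xQ, of k i] g_le[of k "P x" i] by simp
    then show "0 \<le> f x ik \<and> f x ik \<le> 1"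
      using pos[of "P x" i] P_nonneg[OF xQ, of i k] g_nonneg[of "P x" i k]
      by (simp add: f_def divide_le_eq_1)
  qed (auto intro: continuous_on_subset[OF contf])
  then obtain v where v: "v \<in> ?Q" and fix': "\<And>i k. k < n \<Longrightarrow> f v (i, k) = v (i, k)" by auto
  have S1: "S v i = 1" for i
  proof -
    have "S v i = (\<Sum>k<n. f v (i, k))" using fix' by (simp add: S_def)
    also have "\<dots> = (\<Sum>k<n. P v (i, k) + g (P v) i k) / (1 + (\<Sum>l<n. g (P v) i l))"
      by (simp add: f_def sum_divide_distrib)
    also have "\<dots> = 1" using pos[of "P v" i] P_sum[OF v] by (simp add: sum.distrib)
    finally show ?thesis .
  qed
  define p where "p = P v"
  have pv: "p (i, k) = v (i, k)" for i k using S1 by (simp add: P_def p_def)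
  have fixp: "p (i, k) * (1 + (\<Sum>l<n. g p i l)) = p (i, k) + g p i k" if "k < n" for i k
    using fix'[OF that, of i] pos[of p i] by (simp add: f_def p_def[symmetric] pv[symmetric] field_simps)
  have G0: "(\<Sum>l<n. g p i l) = 0" for i
  proof (rule ccontr)
    assume ne: "(\<Sum>l<n. g p i l) \<noteq> 0"
    \<comment> \<open>Otherwise every action in the support would cost strictly less than the
      average of these very costs.\<close>
    have "\<exists>l<n. 0 < p (i, l) \<and> avg p i \<le> \<Phi> i l p"
    proof (rule ccontr)
      assume "\<not> ?thesis"
      then have *: "\<And>l. l < n \<Longrightarrow> p (i, l) = 0 \<or> \<Phi> i l p < avg p i"
        using P_nonneg[OF v, of i] unfolding p_def by (metis less_eq_real_def not_le)
      have "\<exists>l<n. 0 < p (i, l)"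
      proof (rule ccontr)
        assume "\<not> ?thesis"
        then have "(\<Sum>l<n. p (i, l)) \<le> 0" by (intro sum_nonpos) (metis lessThan_iff not_less)
        then show False using P_sum[OF v, of i] by (simp add: p_def)
      qed
      then obtain m where m: "m < n" "0 < p (i, m)" by blast
      have "(\<Sum>l<n. p (i, l) * \<Phi> i l p) < (\<Sum>l<n. p (i, l) * avg p i)"
      proof (rule sum_strict_mono_ex1)
        show "\<forall>l\<in>{..<n}. p (i, l) * \<Phi> i l p \<le> p (i, l) * avg p i"
        proof
          fix l assume "l \<in> {..<n}"
          then consider "p (i, l) = 0" | "\<Phi> i l p \<le> avg p i" using *[of l] by force
          then show "p (i, l) * \<Phi> i l p \<le> p (i, l) * avg p i"
            by cases (use P_nonneg[OF v, of i l] in \<open>auto simp: p_def intro: mult_left_mono\<close>)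
        qed
        show "\<exists>l\<in>{..<n}. p (i, l) * \<Phi> i l p < p (i, l) * avg p i"
          using m *[of m] by (intro bexI[of _ m]) auto
      qed auto
      also have "\<dots> = avg p i"
        using P_sum[OF v, of i] by (simp add: p_def[symmetric] sum_distrib_right[symmetric])
      finally show False by (simp add: avg_def)
    qed
    then obtain l where l: "l < n" "0 < p (i, l)" "avg p i \<le> \<Phi> i l p" by blast
    then have "g p i l = 0" by (simp add: g_def)
    with fixp[OF l(1), of i] have "p (i, l) * (\<Sum>l<n. g p i l) = 0" by (simp add: algebra_simps)
    with l(2) ne show False by simp
  qed
  have "avg p i \<le> \<Phi> i k p" if "k < n" for i k
    using g_le[OF that, of p i] G0[of i] by (simp add: g_def)
  moreover have "\<forall>i k. 0 \<le> p (i, k)" "\<forall>i. (\<Sum>k<n. p (i, k)) = 1"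
    using P_nonneg[OF v] P_sum[OF v] by (auto simp: p_def)
  ultimately show ?thesis unfolding avg_def by blast
qed

text \<open>Measures on a finite product agree once they agree on boxes. This carries product
  measures over from the Skorohod spaces and from the real parameters of the strategies.\<close>

lemma PiM_distr_UNIV:
  fixes M :: "'i::finite \<Rightarrow> 'a measure" and N :: "'i \<Rightarrow> 'b measure"
  assumes M: "\<And>i. prob_space (M i)" and f[measurable]: "\<And>i. f i \<in> M i \<rightarrow>\<^sub>M N i"
  shows "PiM UNIV (\<lambda>i. distr (M i) (N i) (f i)) = distr (PiM UNIV M) (PiM UNIV N) (\<lambda>\<omega> i. f i (\<omega> i))"
proof (rule sym, rule product_sigma_finite.PiM_eqI)
  interpret D: product_prob_space "\<lambda>i. distr (M i) (N i) (f i)"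
    by (intro product_prob_spaceI prob_space.prob_space_distr M f)
  show "product_sigma_finite (\<lambda>i. distr (M i) (N i) (f i))" ..
  interpret M: product_prob_space M by (intro product_prob_spaceI M)
  have [measurable]: "(\<lambda>\<omega> i. f i (\<omega> i)) \<in> PiM UNIV M \<rightarrow>\<^sub>M PiM UNIV N"
    by (rule measurable_PiM_single') (auto simp: space_PiM PiE_iff intro: measurable_space[OF f])
  fix A assume "\<And>i. i \<in> UNIV \<Longrightarrow> A i \<in> sets (distr (M i) (N i) (f i))"
  then have A[measurable]: "\<And>i. A i \<in> sets (N i)" by simp
  have PA: "Pi\<^sub>E UNIV A \<in> sets (PiM UNIV N)" by (intro sets_PiM_I_finite) auto
  have "emeasure (distr (PiM UNIV M) (PiM UNIV N) (\<lambda>\<omega> i. f i (\<omega> i))) (Pi\<^sub>E UNIV A) =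
    emeasure (PiM UNIV M) ((\<lambda>\<omega> i. f i (\<omega> i)) -` Pi\<^sub>E UNIV A \<inter> space (PiM UNIV M))"
    using PA by (simp add: emeasure_distr)
  also have "(\<lambda>\<omega> i. f i (\<omega> i)) -` Pi\<^sub>E UNIV A \<inter> space (PiM UNIV M) =
    Pi\<^sub>E UNIV (\<lambda>i. f i -` A i \<inter> space (M i))"
    by (auto simp: space_PiM PiE_iff)
  also have "emeasure (PiM UNIV M) \<dots> = (\<Prod>i\<in>UNIV. emeasure (M i) (f i -` A i \<inter> space (M i)))"
    by (rule M.emeasure_PiM) auto
  also have "\<dots> = (\<Prod>i\<in>UNIV. emeasure (distr (M i) (N i) (f i)) (A i))"
    by (simp add: emeasure_distr)
  finally show "emeasure (distr (PiM UNIV M) (PiM UNIV N) (\<lambda>\<omega> i. f i (\<omega> i))) (Pi\<^sub>E UNIV A) =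
    (\<Prod>i\<in>UNIV. emeasure (distr (M i) (N i) (f i)) (A i))" .
qed (auto intro!: sets_PiM_cong)

text \<open>With discrete factors the product comes from a \<open>Pi_pmf\<close>, which turns
  integrals over profiles with finite support into finite sums.\<close>

lemma PiM_distr_pmf_UNIV:
  fixes Q :: "'i::finite \<Rightarrow> 'a pmf" and N :: "'i \<Rightarrow> 'b measure"
  assumes f: "\<And>i k. f i k \<in> space (N i)"
  shows "PiM UNIV (\<lambda>i. distr (measure_pmf (Q i)) (N i) (f i)) =
    distr (measure_pmf (Pi_pmf UNIV undefined Q)) (PiM UNIV N) (\<lambda>\<kappa> i. f i (\<kappa> i))"
proof (rule sym, rule product_sigma_finite.PiM_eqI)
  interpret D: product_prob_space "\<lambda>i. distr (measure_pmf (Q i)) (N i) (f i)"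
    by (intro product_prob_spaceI prob_space.prob_space_distr measure_pmf.prob_space_axioms) (simp add: f)
  show "product_sigma_finite (\<lambda>i. distr (measure_pmf (Q i)) (N i) (f i))" ..
  fix A assume "\<And>i. i \<in> UNIV \<Longrightarrow> A i \<in> sets (distr (measure_pmf (Q i)) (N i) (f i))"
  then have A: "\<And>i. A i \<in> sets (N i)" by simp
  have PA: "Pi\<^sub>E UNIV A \<in> sets (PiM UNIV N)" using A by (intro sets_PiM_I_finite) auto
  have "emeasure (distr (measure_pmf (Pi_pmf UNIV undefined Q)) (PiM UNIV N) (\<lambda>\<kappa> i. f i (\<kappa> i))) (Pi\<^sub>E UNIV A) =
    emeasure (measure_pmf (Pi_pmf UNIV undefined Q)) ((\<lambda>\<kappa> i. f i (\<kappa> i)) -` Pi\<^sub>E UNIV A)"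
    using PA f by (subst emeasure_distr) (auto simp: space_PiM)
  also have "(\<lambda>\<kappa> i. f i (\<kappa> i)) -` Pi\<^sub>E UNIV A = PiE_dflt UNIV undefined (\<lambda>i. f i -` A i)"
    by (auto simp: PiE_dflt_def)
  also have "emeasure (measure_pmf (Pi_pmf UNIV undefined Q)) \<dots> =
      (\<Prod>i\<in>UNIV. emeasure (measure_pmf (Q i)) (f i -` A i))"
    by (simp add: measure_pmf.emeasure_eq_measure measure_Pi_pmf_PiE_dflt prod_ennreal)
  also have "\<dots> = (\<Prod>i\<in>UNIV. emeasure (distr (measure_pmf (Q i)) (N i) (f i)) (A i))"
    using A f by (intro prod.cong refl) (subst emeasure_distr, auto)
  finally show "emeasure (distr (measure_pmf (Pi_pmf UNIV undefined Q)) (PiM UNIV N) (\<lambda>\<kappa> i. f i (\<kappa> i)))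
      (Pi\<^sub>E UNIV A) = (\<Prod>i\<in>UNIV. emeasure (distr (measure_pmf (Q i)) (N i) (f i)) (A i))" .
qed (auto intro!: sets_PiM_cong)

lemma continuous_imp_PiM_borel_measurable:
  fixes f :: "('i::countable \<Rightarrow> 'a::second_countable_topology) \<Rightarrow> 'b::topological_space"
  assumes "continuous_on UNIV f"
  shows "f \<in> borel_measurable (PiM UNIV (\<lambda>_. borel))"
  using borel_measurable_continuous_onI[OF assms]
  by (simp add: measurable_cong_sets[OF sets_PiM_equal_borel refl])

text \<open>Symmetry is built in before Nash's map is applied: DM \<open>j\<close> plays the weights
  of its representative \<open>r j\<close>. Only representatives optimise, and for them the weights
  in question are their own.\<close>

lemma finite_support_equilibrium:
  fixes H :: "'i::finite \<Rightarrow> real \<times> ('i \<Rightarrow> real) \<Rightarrow> real" and d :: "'i \<Rightarrow> nat \<Rightarrow> real"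
  assumes n: "n > 0" and r: "\<And>i. r (r i) = r i" "\<And>i. d (r i) = d i"
    and cont: "\<And>i. continuous_on UNIV (H i)"
  shows "\<exists>\<mu>. (\<forall>i. real_distribution (\<mu> i)) \<and> (\<forall>i. AE x in \<mu> i. x \<in> d i ` {..<n}) \<and>
    (\<forall>i. \<mu> (r i) = \<mu> i) \<and>
    (\<forall>i. r i = i \<longrightarrow> (\<forall>k<n. (\<integral>a. (\<integral>v. H i (a, v) \<partial>PiM UNIV \<mu>) \<partial>\<mu> i) \<le> (\<integral>v. H i (d i k, v) \<partial>PiM UNIV \<mu>)))"
proof -
  \<comment> \<open>A polynomial in \<open>p\<close>, hence continuous. All DMs, the one choosing
    \<open>a\<close> included, draw their entry of the profile independently of
    \<open>a\<close>.\<close>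
  define \<Phi> where "\<Phi> i a p = (\<Sum>\<kappa>\<in>Pi\<^sub>E UNIV (\<lambda>_. {..<n}). (\<Prod>j\<in>UNIV. p (r j, \<kappa> j)) * H i (a, \<lambda>j. d j (\<kappa> j)))"
    for i a and p :: "'i \<times> nat \<Rightarrow> real"
  have "continuous_on UNIV (\<Phi> i (d i k))" for i k
    unfolding \<Phi>_def by (intro continuous_intros continuous_on_product_coordinates)
  from nash_map_fixed_point[of n "\<lambda>i k. \<Phi> i (d i k)", OF n this] obtain p where p: "\<And>i k. 0 \<le> p (i, k)"
    "\<And>i. (\<Sum>k<n. p (i, k)) = 1"
    "\<And>i k. k < n \<Longrightarrow> (\<Sum>l<n. p (i, l) * \<Phi> i (d i l) p) \<le> \<Phi> i (d i k) p"
    by blast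
  \<comment> \<open>The fixed point says nothing about the sum of the weights beyond the first
    \<open>n\<close> actions, hence the cut-off.\<close>
  define q where "q i = embed_pmf (\<lambda>k. if k < n then p (r i, k) else 0)" for i
  have total: "(\<integral>\<^sup>+k. ennreal (if k < n then p (r i, k) else 0) \<partial>count_space UNIV) = 1" for i
  proof -
    have "(\<integral>\<^sup>+k. ennreal (if k < n then p (r i, k) else 0) \<partial>count_space UNIV) =
      (\<Sum>k<n. ennreal (if k < n then p (r i, k) else 0))"
      by (intro nn_integral_count_space') (auto simp: p)
    also have "\<dots> = ennreal (\<Sum>k<n. p (r i, k))" using p by (simp add: sum_ennreal)
    finally show ?thesis using p(2)[of "r i"] by simp
  qed
  have q: "pmf (q i) k = (if k < n then p (r i, k) else 0)" for i k
    unfolding q_def by (rule pmf_embed_pmf) (auto simp: p total)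
  have setq: "k \<in> set_pmf (q i) \<Longrightarrow> k < n" for k i
    by (auto simp: set_pmf_eq q split: if_splits)
  define \<mu> where "\<mu> i = distr (measure_pmf (q i)) borel (d i)" for i
  have rd: "real_distribution (\<mu> i)" for i
    unfolding \<mu>_def by (intro prob_space.real_distribution_distr prob_space_measure_pmf) auto
  have muq: "PiM UNIV \<mu> = distr (measure_pmf (Pi_pmf UNIV undefined q)) (PiM UNIV (\<lambda>_. borel)) (\<lambda>\<kappa> j. d j (\<kappa> j))"
    unfolding \<mu>_def by (rule PiM_distr_pmf_UNIV) simp
  have contv: "continuous_on UNIV (\<lambda>v. H i (a, v))" for i a
    by (rule continuous_on_compose2[OF cont]) (auto intro!: continuous_intros)
  have inner: "(\<integral>v. H i (a, v) \<partial>PiM UNIV \<mu>) = \<Phi> i a p" for i a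
  proof -
    have "(\<integral>v. H i (a, v) \<partial>PiM UNIV \<mu>) = (\<integral>\<kappa>. H i (a, \<lambda>j. d j (\<kappa> j)) \<partial>measure_pmf (Pi_pmf UNIV undefined q))"
      unfolding muq by (rule integral_distr)
        (auto simp: space_PiM intro!: continuous_imp_PiM_borel_measurable contv)
    also have "\<dots> = (\<Sum>\<kappa>\<in>Pi\<^sub>E UNIV (\<lambda>_. {..<n}). H i (a, \<lambda>j. d j (\<kappa> j)) * pmf (Pi_pmf UNIV undefined q) \<kappa>)"
      by (rule integral_measure_pmf_real)
        (auto simp: set_Pi_pmf PiE_dflt_def intro!: finite_PiE intro: setq)
    also have "\<dots> = \<Phi> i a p"
      unfolding \<Phi>_def by (intro sum.cong refl) (auto simp: pmf_Pi q PiE_iff)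
    finally show ?thesis .
  qed
  have outer: "(\<integral>a. \<Phi> i a p \<partial>\<mu> i) = (\<Sum>l<n. p (r i, l) * \<Phi> i (d i l) p)" for i
  proof -
    have "continuous_on UNIV (\<lambda>a. H i (a, v))" for v
      by (rule continuous_on_compose2[OF cont]) (auto intro!: continuous_intros)
    then have "continuous_on UNIV (\<lambda>a. \<Phi> i a p)"
      unfolding \<Phi>_def by (intro continuous_intros)
    then have "(\<integral>a. \<Phi> i a p \<partial>\<mu> i) = (\<integral>k. \<Phi> i (d i k) p \<partial>measure_pmf (q i))"
      unfolding \<mu>_def by (intro integral_distr) (auto intro: borel_measurable_continuous_onI)
    also have "\<dots> = (\<Sum>l<n. \<Phi> i (d i l) p * pmf (q i) l)"
      by (rule integral_measure_pmf_real) (auto simp: setq)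
    finally show ?thesis by (simp add: q mult.commute)
  qed
  show ?thesis
  proof (intro exI[of _ \<mu>] conjI allI impI)
    fix i
    show "real_distribution (\<mu> i)" by (rule rd)
    have "q (r i) = q i" unfolding q_def r(1) ..
    then show "\<mu> (r i) = \<mu> i" unfolding \<mu>_def r(2) by simp
    have "{x \<in> space borel. x \<in> d i ` {..<n}} \<in> sets borel"
      by (auto intro!: borel_closed finite_imp_closed)
    then show "AE x in \<mu> i. x \<in> d i ` {..<n}"
      unfolding \<mu>_def by (subst AE_distr_iff) (auto simp: AE_measure_pmf_iff dest: setq)
    fix k assume "r i = i" "k < n"
    then show "(\<integral>a. (\<integral>v. H i (a, v) \<partial>PiM UNIV \<mu>) \<partial>\<mu> i) \<le> (\<integral>v. H i (d i k, v) \<partial>PiM UNIV \<mu>)"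
      using p(3)[of k i] by (simp add: inner outer)
  qed
qed

section \<open>Games on compact sets of reals\<close>

lemma abs_integral_le_prob:
  fixes f :: "'a \<Rightarrow> real"
  assumes "prob_space M" "0 \<le> B" "\<And>x. x \<in> space M \<Longrightarrow> \<bar>f x\<bar> \<le> B"
  shows "\<bar>\<integral>x. f x \<partial>M\<bar> \<le> B"
proof (cases "integrable M f")
  case True
  interpret prob_space M by (rule assms)
  have "\<bar>\<integral>x. f x \<partial>M\<bar> \<le> (\<integral>x. \<bar>f x\<bar> \<partial>M)" by (rule integral_abs_bound)
  also have "\<dots> \<le> (\<integral>x. B \<partial>M)" using True assms(3) by (intro integral_mono) auto
  finally show ?thesis by (simp add: prob_space)
qed (use assms(2) in \<open>simp add: not_integrable_integral_eq\<close>)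

lemma integrable_bounded_prob:
  fixes f :: "'a \<Rightarrow> real"
  assumes "prob_space M" "f \<in> borel_measurable M" "\<And>x. x \<in> space M \<Longrightarrow> \<bar>f x\<bar> \<le> B"
  shows "integrable M f"
proof -
  interpret prob_space M by (rule assms)
  show ?thesis by (rule integrable_const_bound[of _ B]) (use assms in auto)
qed

lemma dominated_convergence_prob:
  fixes f :: "'a \<Rightarrow> real"
  assumes "prob_space M" "f \<in> borel_measurable M" "\<And>n. F n \<in> borel_measurable M"
    "\<And>n x. x \<in> space M \<Longrightarrow> \<bar>F n x\<bar> \<le> B" "\<And>x. x \<in> space M \<Longrightarrow> (\<lambda>n. F n x) \<longlonglongrightarrow> f x"
  shows "(\<lambda>n. \<integral>x. F n x \<partial>M) \<longlonglongrightarrow> (\<integral>x. f x \<partial>M)"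
proof (rule integral_dominated_convergence[where w = "\<lambda>_. B"])
  interpret prob_space M by (rule assms)
  show "integrable M (\<lambda>_. B)" by simp
qed (use assms in auto)

lemma sets_PiM_real_distribution:
  fixes \<mu> :: "'i::countable \<Rightarrow> real measure"
  assumes "\<And>i. real_distribution (\<mu> i)"
  shows "sets (PiM UNIV \<mu>) = sets borel"
  using sets_PiM_cong[OF refl, of UNIV \<mu> "\<lambda>_. borel"] assms
  by (simp add: sets_PiM_equal_borel real_distribution.events_eq_borel)

lemma prob_space_PiM_real_distribution:
  assumes "\<And>i. real_distribution (\<mu> i)"
  shows "prob_space (PiM UNIV \<mu>)"
  using assms by (intro prob_space_PiM) (simp add: real_distribution_def)

text \<open>The data of Skorohod's theorem in one predicate, so that a representation can be chosen
  for every DM simultaneously. Convergence holds at every point of the space, not just almost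
  everywhere.\<close>

definition skorohod_rep where
  "skorohod_rep \<mu> M \<Omega> Ys Y \<longleftrightarrow> prob_space (\<Omega> :: real measure) \<and> (\<forall>n. Ys n \<in> borel_measurable \<Omega>) \<and>
     (\<forall>n::nat. distr \<Omega> borel (Ys n) = \<mu> n) \<and> Y \<in> borel_measurable \<Omega> \<and> distr \<Omega> borel Y = (M :: real measure) \<and>
     (\<forall>x\<in>space \<Omega>. (\<lambda>n. Ys n x) \<longlonglongrightarrow> Y x)"

lemma skorohod_rep_exists:
  assumes "\<And>n. real_distribution (\<mu> n)" "real_distribution M" "weak_conv_m \<mu> M"
  shows "\<exists>\<Omega> Ys Y. skorohod_rep \<mu> M \<Omega> Ys Y"
  using Skorohod[OF assms] by (simp add: skorohod_rep_def)

lemma skorohod_repD: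
  assumes "skorohod_rep \<mu> M \<Omega> Ys Y"
  shows "prob_space \<Omega>" "Ys n \<in> borel_measurable \<Omega>" "distr \<Omega> borel (Ys n) = \<mu> n" "Y \<in> borel_measurable \<Omega>"
    "distr \<Omega> borel Y = M" "x \<in> space \<Omega> \<Longrightarrow> (\<lambda>n. Ys n x) \<longlonglongrightarrow> Y x"
  using assms by (simp_all add: skorohod_rep_def)

text \<open>Skorohod representations of the single marginals combine: on the product of their spaces
  all coordinates converge together, and dominated convergence applies. Letting \<open>a\<close>
  move as well yields continuity in the own action and the limit of the outer integral in
  \<open>weak_conv_PiM_outer\<close>.\<close>

lemma weak_conv_PiM:
  fixes \<mu> :: "nat \<Rightarrow> 'i::finite \<Rightarrow> real measure" and H :: "real \<times> ('i \<Rightarrow> real) \<Rightarrow> real"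
  assumes \<mu>: "\<And>n j. real_distribution (\<mu> n j)" and M: "\<And>j. real_distribution (M j)"
    and conv: "\<And>j. weak_conv_m (\<lambda>n. \<mu> n j) (M j)"
    and cont: "continuous_on UNIV H" and bound: "\<And>x. \<bar>H x\<bar> \<le> B"
    and a: "a \<longlonglongrightarrow> a'"
  shows "(\<lambda>n. \<integral>v. H (a n, v) \<partial>PiM UNIV (\<mu> n)) \<longlonglongrightarrow> (\<integral>v. H (a', v) \<partial>PiM UNIV M)"
proof -
  have "\<forall>j. \<exists>\<Omega> Ys Y. skorohod_rep (\<lambda>n. \<mu> n j) (M j) \<Omega> Ys Y"
    by (intro allI skorohod_rep_exists \<mu> M conv)
  then obtain \<Omega> Ys Y where "\<And>j. skorohod_rep (\<lambda>n. \<mu> n j) (M j) (\<Omega> j) (Ys j) (Y j)" by metis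
  note Y = skorohod_repD[OF this]
  note [measurable] = Y(2)
  note [measurable] = Y(4)
  have mun: "PiM UNIV (\<mu> n) = distr (PiM UNIV \<Omega>) (PiM UNIV (\<lambda>_. borel)) (\<lambda>\<omega> j. Ys j n (\<omega> j))" for n
    using PiM_distr_UNIV[of \<Omega> "\<lambda>j. Ys j n" "\<lambda>_. borel", OF Y(1,2)] by (simp add: Y(3))
  have MY: "PiM UNIV M = distr (PiM UNIV \<Omega>) (PiM UNIV (\<lambda>_. borel)) (\<lambda>\<omega> j. Y j (\<omega> j))"
    using PiM_distr_UNIV[of \<Omega> Y "\<lambda>_. borel", OF Y(1,4)] by (simp add: Y(5))
  have contv: "continuous_on UNIV (\<lambda>v. H (b, v))" for b
    by (rule continuous_on_compose2[OF cont]) (auto intro!: continuous_intros)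
  have [measurable]: "(\<lambda>\<omega> j. Ys j n (\<omega> j)) \<in> PiM UNIV \<Omega> \<rightarrow>\<^sub>M PiM UNIV (\<lambda>_. borel)" for n
    by (rule measurable_PiM_single') auto
  have [measurable]: "(\<lambda>\<omega> j. Y j (\<omega> j)) \<in> PiM UNIV \<Omega> \<rightarrow>\<^sub>M PiM UNIV (\<lambda>_. borel)"
    by (rule measurable_PiM_single') auto
  note [measurable] = continuous_imp_PiM_borel_measurable[OF contv]
  have "(\<lambda>n. \<integral>\<omega>. H (a n, \<lambda>j. Ys j n (\<omega> j)) \<partial>PiM UNIV \<Omega>) \<longlonglongrightarrow> (\<integral>\<omega>. H (a', \<lambda>j. Y j (\<omega> j)) \<partial>PiM UNIV \<Omega>)"
  proof (rule dominated_convergence_prob[OF prob_space_PiM[OF Y(1)], where B = B])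
    fix \<omega> assume "\<omega> \<in> space (PiM UNIV \<Omega>)"
    then have "(\<lambda>n j. Ys j n (\<omega> j)) \<longlonglongrightarrow> (\<lambda>j. Y j (\<omega> j))"
      unfolding tendsto_fun_iff by (auto simp: space_PiM intro!: Y(6))
    then have "(\<lambda>n. (a n, \<lambda>j. Ys j n (\<omega> j))) \<longlonglongrightarrow> (a', \<lambda>j. Y j (\<omega> j))"
      by (intro tendsto_Pair a)
    then show "(\<lambda>n. H (a n, \<lambda>j. Ys j n (\<omega> j))) \<longlonglongrightarrow> H (a', \<lambda>j. Y j (\<omega> j))"
      by (rule continuous_on_tendsto_compose[OF cont]) auto
  qed (use bound in auto)
  then show ?thesis
    unfolding mun MY by (subst (1 2) integral_distr) auto
qed

lemma weak_conv_m_const: "weak_conv_m (\<lambda>_. M) M"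
  by (simp add: weak_conv_m_def weak_conv_def)

lemma continuous_integral_PiM:
  fixes M :: "'i::finite \<Rightarrow> real measure" and H :: "real \<times> ('i \<Rightarrow> real) \<Rightarrow> real"
  assumes "\<And>j. real_distribution (M j)" "continuous_on UNIV H" "\<And>x. \<bar>H x\<bar> \<le> B"
  shows "continuous_on UNIV (\<lambda>a. \<integral>v. H (a, v) \<partial>PiM UNIV M)"
  unfolding continuous_on_sequentially o_def
  using weak_conv_PiM[of "\<lambda>_. M" M H B] assms weak_conv_m_const by auto

text \<open>The own action is integrated by a second use of Skorohod, for the marginal of
  \<open>i\<close> alone: the moving point \<open>Ys n \<omega>\<close> takes the place of
  \<open>a n\<close> in \<open>weak_conv_PiM\<close>.\<close>

lemma weak_conv_PiM_outer:
  fixes \<mu> :: "nat \<Rightarrow> 'i::finite \<Rightarrow> real measure" and H :: "real \<times> ('i \<Rightarrow> real) \<Rightarrow> real"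
  assumes \<mu>: "\<And>n j. real_distribution (\<mu> n j)" and M: "\<And>j. real_distribution (M j)"
    and conv: "\<And>j. weak_conv_m (\<lambda>n. \<mu> n j) (M j)"
    and cont: "continuous_on UNIV H" and bound: "\<And>x. \<bar>H x\<bar> \<le> B"
  shows "(\<lambda>n. \<integral>a. (\<integral>v. H (a, v) \<partial>PiM UNIV (\<mu> n)) \<partial>\<mu> n i) \<longlonglongrightarrow> (\<integral>a. (\<integral>v. H (a, v) \<partial>PiM UNIV M) \<partial>M i)"
proof -
  obtain \<Omega> Ys Y where "skorohod_rep (\<lambda>n. \<mu> n i) (M i) \<Omega> Ys Y"
    using skorohod_rep_exists[OF \<mu> M conv] by blast
  note Y = skorohod_repD[OF this]
  note [measurable] = Y(2)
  note [measurable] = Y(4)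
  have [measurable]: "(\<lambda>a. \<integral>v. H (a, v) \<partial>PiM UNIV (\<mu> n)) \<in> borel_measurable borel" for n
    by (rule borel_measurable_continuous_onI, rule continuous_integral_PiM[OF \<mu> cont bound])
  have [measurable]: "(\<lambda>a. \<integral>v. H (a, v) \<partial>PiM UNIV M) \<in> borel_measurable borel"
    by (rule borel_measurable_continuous_onI, rule continuous_integral_PiM[OF M cont bound])
  have "(\<lambda>n. \<integral>\<omega>. (\<integral>v. H (Ys n \<omega>, v) \<partial>PiM UNIV (\<mu> n)) \<partial>\<Omega>) \<longlonglongrightarrow> (\<integral>\<omega>. (\<integral>v. H (Y \<omega>, v) \<partial>PiM UNIV M) \<partial>\<Omega>)"
  proof (rule dominated_convergence_prob[OF Y(1), where B = B])
    have "0 \<le> B" using bound[of undefined] by linarith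
    then show "\<bar>\<integral>v. H (Ys n \<omega>, v) \<partial>PiM UNIV (\<mu> n)\<bar> \<le> B" for n \<omega>
      by (intro abs_integral_le_prob prob_space_PiM_real_distribution \<mu> bound)
  qed (auto intro!: weak_conv_PiM[OF \<mu> M conv cont bound] Y(6))
  then show ?thesis
    unfolding Y(3)[symmetric] Y(5)[symmetric] by (subst (1 2) integral_distr) (auto simp: Y(3) Y(5))
qed

text \<open>In a Skorohod representation almost every sequence stays in \<open>C\<close> for all
  \<open>n\<close> at once, and a closed set keeps the limit.\<close>

lemma weak_conv_AE_closed:
  assumes \<mu>: "\<And>n. real_distribution (\<mu> n)" and M: "real_distribution M" and conv: "weak_conv_m \<mu> M"
    and C: "closed C" "\<And>n. AE x in \<mu> n. x \<in> C"
  shows "AE x in M. x \<in> C"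
proof -
  obtain \<Omega> Ys Y where "skorohod_rep \<mu> M \<Omega> Ys Y" using skorohod_rep_exists[OF \<mu> M conv] by blast
  note Y = skorohod_repD[OF this]
  have Cm: "{x \<in> space borel. x \<in> C} \<in> sets borel" using C(1) by simp
  have "AE \<omega> in \<Omega>. Ys n \<omega> \<in> C" for n
    using C(2)[of n] AE_distr_iff[OF Y(2) Cm, of n] unfolding Y(3) by blast
  then have "AE \<omega> in \<Omega>. \<forall>n. Ys n \<omega> \<in> C" by (simp add: AE_all_countable)
  then have "AE \<omega> in \<Omega>. Y \<omega> \<in> C"
    using AE_space by eventually_elim (blast intro: closed_sequentially[OF C(1) _ Y(6)])
  then show ?thesis
    using AE_distr_iff[OF Y(4) Cm] unfolding Y(5) by blast
qed

lemma weak_conv_m_subseq: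
  assumes "weak_conv_m \<mu> M" "strict_mono (s :: nat \<Rightarrow> nat)"
  shows "weak_conv_m (\<mu> \<circ> s) M"
  using assms LIMSEQ_subseq_LIMSEQ unfolding weak_conv_m_def weak_conv_def by (force simp: o_def)

text \<open>Compact supports make each marginal tight, so Helly's theorem applies to it. The
  marginals are treated one after another; passing to a further subsequence preserves the limits
  already found.\<close>

lemma weak_conv_subseq_family:
  fixes \<mu> :: "nat \<Rightarrow> 'i \<Rightarrow> real measure"
  assumes "finite I" and \<mu>: "\<And>n j. real_distribution (\<mu> n j)"
    and supp: "\<And>n j. AE x in \<mu> n j. x \<in> C j" and C: "\<And>j. compact (C j)"
  shows "\<exists>s M. strict_mono (s :: nat \<Rightarrow> nat) \<and>
    (\<forall>j\<in>I. real_distribution (M j) \<and> weak_conv_m (\<lambda>n. \<mu> (s n) j) (M j))"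
  using assms(1)
proof induction
  case empty
  show ?case by (rule exI[of _ id]) (simp add: strict_mono_id)
next
  case (insert i I)
  then obtain s M where s: "strict_mono (s :: nat \<Rightarrow> nat)"
    "\<forall>j\<in>I. real_distribution (M j) \<and> weak_conv_m (\<lambda>n. \<mu> (s n) j) (M j)" by blast
  have "tight (\<lambda>n. \<mu> n i)"
    unfolding tight_def
  proof (intro conjI allI impI)
    fix \<epsilon> :: real assume "\<epsilon> > 0"
    obtain K where K: "\<And>x. x \<in> C i \<Longrightarrow> \<bar>x\<bar> \<le> K"
      using compact_imp_bounded[OF C[of i]] by (auto simp: bounded_iff)
    \<comment> \<open>The summand 1 makes the interval nonempty and lets the half-open interval
      contain the left end \<open>- \<bar>K\<bar>\<close>.\<close>
    define a where "a = \<bar>K\<bar> + 1"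
    have "measure (\<mu> n i) {-a<..a} = 1" for n
    proof -
      interpret real_distribution "\<mu> n i" by (rule \<mu>)
      have "AE x in \<mu> n i. x \<in> {-a<..a}"
        using supp[of i n] by eventually_elim (use K in \<open>force simp: a_def\<close>)
      then show ?thesis by (subst prob_eq_1) auto
    qed
    then show "\<exists>a b. a < b \<and> (\<forall>n. 1 - \<epsilon> < measure (\<mu> n i) {a<..b})"
      using \<open>\<epsilon> > 0\<close> by (intro exI[of _ "-a"] exI[of _ a]) (auto simp: a_def)
  qed (rule \<mu>)
  from tight_imp_convergent_subsubsequence[OF this s(1)]
  obtain r N where r: "strict_mono (r :: nat \<Rightarrow> nat)" "real_distribution N"
    "weak_conv_m ((\<lambda>n. \<mu> n i) \<circ> s \<circ> r) N" by blast
  show ?case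
  proof (intro exI conjI ballI)
    show "strict_mono (s \<circ> r)" using s(1) r(1) by (rule strict_mono_o)
    fix j assume j: "j \<in> insert i I"
    show "real_distribution ((M(i := N)) j)" using r(2) s(2) j by auto
    show "weak_conv_m (\<lambda>n. \<mu> ((s \<circ> r) n) j) ((M(i := N)) j)"
    proof (cases "j = i")
      case True then show ?thesis using r(3) by (simp add: o_def)
    next
      case False
      then have "weak_conv_m ((\<lambda>n. \<mu> (s n) j) \<circ> r) (M j)"
        using s(2) j r(1) by (intro weak_conv_m_subseq) auto
      then show ?thesis using False by (simp add: o_def)
    qed
  qed
qed

lemma dense_sequence_exists:
  fixes C :: "'a::{metric_space, second_countable_topology} set"
  assumes "C \<noteq> {}"
  shows "\<exists>d :: nat \<Rightarrow> 'a. range d \<subseteq> C \<and> C \<subseteq> closure (range d)"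
proof -
  obtain T where T: "countable T" "T \<subseteq> C" "C \<subseteq> closure T" by (rule separable)
  moreover have "T \<noteq> {}" using T assms by auto
  ultimately show ?thesis
    by (intro exI[of _ "from_nat_into T"]) (simp add: range_from_nat_into)
qed

theorem mixed_equilibrium_real:
  fixes H :: "'i::finite \<Rightarrow> real \<times> ('i \<Rightarrow> real) \<Rightarrow> real" and C :: "'i \<Rightarrow> real set"
  assumes C: "\<And>i. compact (C i)" "\<And>i. C i \<noteq> {}"
    and r: "\<And>i. r (r i) = r i" "\<And>i. C (r i) = C i"
    and cont: "\<And>i. continuous_on UNIV (H i)" and bound: "\<And>i x. \<bar>H i x\<bar> \<le> B"
  shows "\<exists>\<mu>. (\<forall>i. real_distribution (\<mu> i)) \<and> (\<forall>i. AE x in \<mu> i. x \<in> C i) \<and> (\<forall>i. \<mu> (r i) = \<mu> i) \<and>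
    (\<forall>i. r i = i \<longrightarrow> (\<forall>b\<in>C i.
      (\<integral>a. (\<integral>v. H i (a, v) \<partial>PiM UNIV \<mu>) \<partial>\<mu> i) \<le> (\<integral>v. H i (b, v) \<partial>PiM UNIV \<mu>)))"
proof -
  \<comment> \<open>Chosen as a function of the set rather than of the DM: DMs with equal
    \<open>C\<close> then share the dense sequence, which gives
    \<open>d (r i) = d i\<close>.\<close>
  define dd where "dd A = (SOME d :: nat \<Rightarrow> real. range d \<subseteq> A \<and> A \<subseteq> closure (range d))" for A
  define d where "d i = dd (C i)" for i
  have d: "range (d i) \<subseteq> C i" "C i \<subseteq> closure (range (d i))" for i
    using someI_ex[OF dense_sequence_exists[OF C(2)[of i]]] by (auto simp: d_def dd_def)
  have dr: "d (r i) = d i" for i by (simp add: d_def r)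
  define P where "P n \<mu> \<longleftrightarrow> (\<forall>i. real_distribution (\<mu> i)) \<and> (\<forall>i. AE x in \<mu> i. x \<in> d i ` {..<Suc n}) \<and>
    (\<forall>i. \<mu> (r i) = \<mu> i) \<and>
    (\<forall>i. r i = i \<longrightarrow> (\<forall>k<Suc n. (\<integral>a. (\<integral>v. H i (a, v) \<partial>PiM UNIV \<mu>) \<partial>\<mu> i) \<le> (\<integral>v. H i (d i k, v) \<partial>PiM UNIV \<mu>)))"
    for n \<mu>
  have "\<forall>n. \<exists>\<mu>. P n \<mu>"
    unfolding P_def by (intro allI finite_support_equilibrium zero_less_Suc r dr cont)
  then obtain \<mu> where P: "\<And>n. P n (\<mu> n)" using choice[of P] by blast
  have \<mu>: "real_distribution (\<mu> n i)" and supp: "AE x in \<mu> n i. x \<in> d i ` {..<Suc n}"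
    and mur: "\<mu> n (r i) = \<mu> n i" for n i
    using P[of n] unfolding P_def by simp_all
  have opt: "(\<integral>a. (\<integral>v. H i (a, v) \<partial>PiM UNIV (\<mu> n)) \<partial>\<mu> n i) \<le> (\<integral>v. H i (d i k, v) \<partial>PiM UNIV (\<mu> n))"
    if "r i = i" "k < Suc n" for n i k
    using P[of n] that unfolding P_def by simp
  have suppC: "AE x in \<mu> n i. x \<in> C i" for n i
    using supp[of i n] by eventually_elim (use d in blast)
  obtain s M where s: "strict_mono (s :: nat \<Rightarrow> nat)"
    and M: "\<And>j. real_distribution (M j)" "\<And>j. weak_conv_m (\<lambda>n. \<mu> (s n) j) (M j)"
    using weak_conv_subseq_family[of UNIV \<mu> C, OF finite_class.finite_UNIV \<mu> suppC C(1)] by blast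
  \<comment> \<open>Copying the limit of the representative yields symmetry outright. It is a limit
    for \<open>i\<close> too because \<open>\<mu> n (r i) = \<mu> n i\<close>.\<close>
  define M' where "M' i = M (r i)" for i
  have M': "\<And>j. real_distribution (M' j)" "\<And>j. weak_conv_m (\<lambda>n. \<mu> (s n) j) (M' j)"
    using M(1) M(2)[of "r _"] by (simp_all add: M'_def mur)
  show ?thesis
  proof (intro exI[of _ M'] conjI allI impI ballI)
    fix i
    show "real_distribution (M' i)" by (rule M')
    show "AE x in M' i. x \<in> C i"
      by (rule weak_conv_AE_closed[OF \<mu> M' compact_imp_closed[OF C(1)] suppC])
    show "M' (r i) = M' i" by (simp add: M'_def r)
    assume ri: "r i = i"
    fix b assume b: "b \<in> C i"
    let ?lhs = "\<integral>a. (\<integral>v. H i (a, v) \<partial>PiM UNIV M') \<partial>M' i"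
    have lim1: "(\<lambda>n. \<integral>a. (\<integral>v. H i (a, v) \<partial>PiM UNIV (\<mu> (s n))) \<partial>\<mu> (s n) i) \<longlonglongrightarrow> ?lhs"
      by (rule weak_conv_PiM_outer[OF \<mu> M' cont bound])
    have le: "?lhs \<le> (\<integral>v. H i (d i k, v) \<partial>PiM UNIV M')" for k
    proof (rule LIMSEQ_le[OF lim1])
      show "(\<lambda>n. \<integral>v. H i (d i k, v) \<partial>PiM UNIV (\<mu> (s n))) \<longlonglongrightarrow> (\<integral>v. H i (d i k, v) \<partial>PiM UNIV M')"
        by (rule weak_conv_PiM[OF \<mu> M' cont bound tendsto_const])
      \<comment> \<open>The action \<open>d i k\<close> is available from stage \<open>k\<close> on,
        and \<open>n \<le> s n\<close> for the subsequence.\<close>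
      show "\<exists>N. \<forall>n\<ge>N. (\<integral>a. (\<integral>v. H i (a, v) \<partial>PiM UNIV (\<mu> (s n))) \<partial>\<mu> (s n) i) \<le>
        (\<integral>v. H i (d i k, v) \<partial>PiM UNIV (\<mu> (s n)))"
        using opt[OF ri] seq_suble[OF s] by (intro exI[of _ k]) (meson le_trans less_Suc_eq_le)
    qed
    \<comment> \<open>The inequality spreads from the dense sequence to all of \<open>C i\<close>
      because its right side is continuous in the action.\<close>
    let ?A = "{a. ?lhs \<le> (\<integral>v. H i (a, v) \<partial>PiM UNIV M')}"
    have "closed ?A"
      by (intro closed_Collect_le continuous_intros continuous_integral_PiM[OF M'(1) cont bound])
    moreover have "range (d i) \<subseteq> ?A" using le by auto
    ultimately have "closure (range (d i)) \<subseteq> ?A" by (rule closure_minimal[rotated])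
    then show "?lhs \<le> (\<integral>v. H i (b, v) \<partial>PiM UNIV M')" using b d(2)[of i] by auto
  qed
qed

section \<open>Compact metrizable spaces as images of compact sets of reals\<close>

text \<open>In a metrizable domain a closed preimage is recognised by its convergent sequences. This
  converts limits obtained from dominated convergence into continuity.\<close>

lemma seq_continuous_map:
  assumes X: "metrizable_space X" and f: "f \<in> topspace X \<rightarrow> topspace Y"
    and seq: "\<And>xs x. range xs \<subseteq> topspace X \<Longrightarrow> limitin X xs x sequentially \<Longrightarrow> limitin Y (\<lambda>n. f (xs n)) (f x) sequentially"
  shows "continuous_map X Y f"
proof -
  obtain M d where M: "Metric_space M d" "X = Metric_space.mtopology M d"
    using X by (auto simp: metrizable_space_def)
  interpret Metric_space M d by (rule M)
  show ?thesis
    unfolding continuous_map_closedin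
  proof (intro conjI allI impI f)
    fix S assume S: "closedin Y S"
    show "closedin X {x \<in> topspace X. f x \<in> S}"
      unfolding M(2) metric_closedin_iff_sequentially_closed
    proof (intro conjI allI impI)
      fix xs x assume *: "range xs \<subseteq> {x \<in> topspace mtopology. f x \<in> S} \<and> limitin mtopology xs x sequentially"
      then have "limitin Y (\<lambda>n. f (xs n)) (f x) sequentially"
        by (intro seq) (auto simp: M(2))
      then have "f x \<in> S"
        by (rule limitin_closedin[OF _ S]) (use * in \<open>auto simp: image_subset_iff\<close>)
      moreover have "x \<in> M" using * by (auto simp: limit_metric_sequentially)
      ultimately show "x \<in> {x \<in> topspace mtopology. f x \<in> S}" by simp
    qed auto
  qed
qed

lemma (in Metric_space) compact_dense_sequence_metric:
  assumes "compact_space mtopology" "M \<noteq> {}"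
  shows "\<exists>q :: nat \<Rightarrow> 'a. range q \<subseteq> M \<and> (\<forall>x\<in>M. \<forall>e>0. \<exists>k. d (q k) x < e)"
proof -
  have "mtotally_bounded M" using assms(1) compact_space_eq_mcomplete_mtotally_bounded by blast
  then have "\<forall>n. \<exists>K. finite K \<and> K \<subseteq> M \<and> M \<subseteq> (\<Union>x\<in>K. mball x (1 / real (Suc n)))"
    unfolding mtotally_bounded_def by (metis of_nat_0_less_iff zero_less_Suc zero_less_divide_1_iff)
  from choice[OF this] obtain K where K: "\<And>n. finite (K n)" "\<And>n. K n \<subseteq> M"
    "\<And>n. M \<subseteq> (\<Union>x\<in>K n. mball x (1 / real (Suc n)))" by blast
  define D where "D = (\<Union>n. K n)"
  have D: "countable D" "D \<subseteq> M" using K by (auto simp: D_def intro: countable_finite)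
  have "D \<noteq> {}" using K(3)[of 0] assms(2) by (auto simp: D_def)
  with D have q: "range (from_nat_into D) = D" by (simp add: range_from_nat_into)
  show ?thesis
  proof (intro exI[of _ "from_nat_into D"] conjI ballI allI impI)
    show "range (from_nat_into D) \<subseteq> M" using q D by simp
    fix x e assume "x \<in> M" "(e::real) > 0"
    obtain n where n: "1 / real (Suc n) < e" using \<open>e > 0\<close> nat_approx_posE by blast
    obtain y where "y \<in> K n" "d y x < 1 / real (Suc n)" using K(3)[of n] \<open>x \<in> M\<close> by auto
    then have "y \<in> range (from_nat_into D)" "d y x < e" using n q by (auto simp: D_def)
    then show "\<exists>k. d (from_nat_into D k) x < e" by auto
  qed
qed

lemma borel_of_space [simp]: "space (borel_of X) = topspace X"
  by (simp add: borel_of_def space_measure_of_conv)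

lemma openin_in_borel_of: "openin X U \<Longrightarrow> U \<in> sets (borel_of X)"
  unfolding borel_of_def by (subst sets_measure_of) (auto dest: openin_subset)

lemma measurable_borel_ofI:
  assumes "f \<in> space M \<rightarrow> topspace X" "\<And>U. openin X U \<Longrightarrow> f -` U \<inter> space M \<in> sets M"
  shows "f \<in> M \<rightarrow>\<^sub>M borel_of X"
  unfolding borel_of_def by (rule measurable_measure_of) (use assms in \<open>auto dest: openin_subset\<close>)

lemma continuous_map_measurable:
  assumes "continuous_map X euclidean f"
  shows "f \<in> borel_measurable (borel_of X)"
proof (rule borel_measurableI)
  fix S :: "'b set" assume "open S"
  then have "openin X {x \<in> topspace X. f x \<in> S}"
    using assms by (auto simp: continuous_map_def)
  then show "f -` S \<inter> space (borel_of X) \<in> sets (borel_of X)"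
    by (intro openin_in_borel_of) (simp add: vimage_def Int_def conj_commute)
qed

text \<open>Joint measurability of Caratheodory functions is reduced to a countable case distinction
  by these countably valued approximations of the identity.\<close>

lemma countable_discretisation:
  assumes X: "metrizable_space X" "compact_space X" "topspace X \<noteq> {}"
  shows "\<exists>\<rho>. (\<forall>n. \<rho> n \<in> borel_of X \<rightarrow>\<^sub>M count_space UNIV) \<and> (\<forall>n. countable (range (\<rho> n))) \<and>
    (\<forall>n x. \<rho> n x \<in> topspace X) \<and> (\<forall>x\<in>topspace X. limitin X (\<lambda>n::nat. \<rho> n x) x sequentially)"
proof -
  obtain M d where M: "Metric_space M d" "X = Metric_space.mtopology M d"
    using X by (auto simp: metrizable_space_def)
  interpret Metric_space M d by (rule M)
  have "\<exists>q :: nat \<Rightarrow> 'a. range q \<subseteq> M \<and> (\<forall>x\<in>M. \<forall>e>0. \<exists>k. d (q k) x < e)"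
    by (rule compact_dense_sequence_metric) (use X(2,3) in \<open>simp_all add: M(2)\<close>)
  then obtain q :: "nat \<Rightarrow> 'a" where q': "range q \<subseteq> M" "\<forall>x\<in>M. \<forall>e>0. \<exists>k. d (q k) x < e"
    by (elim exE conjE)
  note q = q'(1) q'(2)[rule_format]
  \<comment> \<open>Taking the least admissible index makes the choice of a nearby dense point
    measurable: each condition is membership in a ball, and there are only countably many of
    them.\<close>
  define l where "l n x = (LEAST k. d (q k) x < 1 / real (Suc n))" for n :: nat and x
  have l: "d (q (l n x)) x < 1 / real (Suc n)" if "x \<in> M" for n x
    unfolding l_def by (rule LeastI_ex) (use q(2)[OF that] in auto)
  have ball_sets: "{x \<in> M. d (q k) x < e} \<in> sets (borel_of X)" for k e
  proof -
    have "{x \<in> M. d (q k) x < e} = mball (q k) e" using q(1) by (auto simp: image_subset_iff)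
    then show ?thesis unfolding M(2) using openin_in_borel_of openin_mball by metis
  qed
  have lm: "l n \<in> borel_of X \<rightarrow>\<^sub>M count_space UNIV" for n
    unfolding l_def
  proof (rule measurable_Least)
    fix k
    show "(\<lambda>x. d (q k) x < 1 / real (Suc n)) \<in> borel_of X \<rightarrow>\<^sub>M count_space UNIV"
      using ball_sets[of k "1 / real (Suc n)"] unfolding pred_def by (simp add: M(2))
  qed
  show ?thesis
  proof (intro exI[of _ "\<lambda>n x. q (l n x)"] conjI allI ballI)
    fix n
    show "(\<lambda>x. q (l n x)) \<in> borel_of X \<rightarrow>\<^sub>M count_space UNIV"
      by (rule measurable_compose[OF lm]) simp
    show "countable (range (\<lambda>x. q (l n x)))"
      by (rule countable_subset[of _ "range q"]) auto
    fix x show "q (l n x) \<in> topspace X" using q(1) by (auto simp: M(2))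
  next
    fix x assume "x \<in> topspace X"
    then have x: "x \<in> M" by (simp add: M(2))
    show "limitin X (\<lambda>n. q (l n x)) x sequentially"
      unfolding M(2) limit_metric_sequentially
    proof (intro conjI allI impI x)
      fix e :: real assume "e > 0"
      then obtain N where N: "1 / real (Suc N) < e" using nat_approx_posE by blast
      show "\<exists>N. \<forall>n\<ge>N. q (l n x) \<in> M \<and> d (q (l n x)) x < e"
      proof (intro exI[of _ N] allI impI conjI)
        fix n assume "n \<ge> N"
        then have "1 / real (Suc n) \<le> 1 / real (Suc N)" by (intro divide_left_mono) auto
        then show "d (q (l n x)) x < e" using l[OF x, of n] N by linarith
      qed (use q(1) in auto)
    qed
  qed
qed

section \<open>Digit expansions in bases two and three\<close>

definition digit_seqs :: "(nat \<Rightarrow> real) set" where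
  "digit_seqs = Pi UNIV (\<lambda>_. {0, 1})"

text \<open>Digits 0 and 1 in base \<open>1 / q\<close>. For \<open>q = 1/2\<close> these are binary
  expansions, which cover the unit interval; for \<open>q = 1/3\<close> the values form the Cantor
  set shrunk by half and the digits are unique.\<close>

definition digit_sum :: "real \<Rightarrow> (nat \<Rightarrow> real) \<Rightarrow> real" where
  "digit_sum q x = (\<Sum>n. x n * q ^ Suc n)"

lemma digit_seqs_iff: "x \<in> digit_seqs \<longleftrightarrow> (\<forall>n. x n = 0 \<or> x n = 1)"
  by (auto simp: digit_seqs_def)

lemma compact_digit_seqs: "compact digit_seqs"
  unfolding digit_seqs_def by (rule compact_Pi) (simp add: finite_imp_compact)

lemma digit_bound:
  assumes "x \<in> digit_seqs" "0 < q" shows "norm (x n * q ^ Suc n) \<le> q ^ Suc n"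
  using assms(1)[unfolded digit_seqs_iff, rule_format, of n] assms(2) by auto

lemma summable_Suc_power: "0 < q \<Longrightarrow> q < 1 \<Longrightarrow> summable (\<lambda>n. q ^ Suc n :: real)"
  by (subst summable_Suc_iff) (simp add: summable_geometric)

lemma summable_digits:
  assumes "x \<in> digit_seqs" "0 < q" "q < 1"
  shows "summable (\<lambda>n. x n * q ^ Suc n)"
  by (rule summable_comparison_test'[OF summable_Suc_power[OF assms(2,3)], of 0])
    (use digit_bound[OF assms(1,2)] in auto)

lemma continuous_digit_sum:
  assumes "0 < q" "q < 1"
  shows "continuous_on digit_seqs (digit_sum q)"
proof -
  have "uniform_limit digit_seqs (\<lambda>n x. \<Sum>i<n. x i * q ^ Suc i) (\<lambda>x. \<Sum>i. x i * q ^ Suc i) sequentially"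
    by (rule Weierstrass_m_test[OF digit_bound summable_Suc_power[OF assms]]) (use assms in auto)
  then have "continuous_on digit_seqs (\<lambda>x. \<Sum>i. x i * q ^ Suc i)"
    by (rule uniform_limit_theorem[rotated])
      (auto intro!: always_eventually continuous_intros continuous_on_subset[OF continuous_on_product_coordinates])
  then show ?thesis by (simp add: digit_sum_def[abs_def])
qed

text \<open>At the first differing digit \<open>n\<close> the terms differ by
  \<open>(1/3) ^ Suc n\<close>, while the tails can make up for at most half of that.\<close>

lemma inj_on_digit_sum: "inj_on (digit_sum (1/3)) digit_seqs"
proof (rule inj_onI, rule ccontr)
  fix x y assume xy: "x \<in> digit_seqs" "y \<in> digit_seqs" "digit_sum (1/3) x = digit_sum (1/3) y" "x \<noteq> y"
  define n where "n = (LEAST n. x n \<noteq> y n)"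
  have n: "x n \<noteq> y n" unfolding n_def by (rule LeastI_ex) (use xy(4) in auto)
  have eq: "x k = y k" if "k < n" for k using not_less_Least[of k "\<lambda>n. x n \<noteq> y n"] that n_def by auto
  let ?f = "\<lambda>k. (x k - y k) * (1/3) ^ Suc k"
  have sums: "?f sums 0"
    using sums_diff[OF summable_sums[OF summable_digits[OF xy(1), of "1/3"]] summable_sums[OF summable_digits[OF xy(2), of "1/3"]]] xy(3)
    by (simp add: digit_sum_def left_diff_distrib diff_divide_distrib)
  have "(\<lambda>k. ?f (k + Suc n)) sums (0 - (\<Sum>k<Suc n. ?f k))"
    by (rule sums_split_initial_segment[OF sums])
  also have "(\<Sum>k<Suc n. ?f k) = ?f n" using eq by (simp add: sum.neutral)
  finally have tail: "(\<lambda>k. ?f (k + Suc n)) sums (- ?f n)" by simp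
  have geo: "(\<lambda>k. (1/3::real) ^ Suc (k + Suc n)) sums ((1/3) ^ Suc n / 2)"
    using sums_mult[OF geometric_sums[of "1/3::real"], of "(1/3) ^ Suc (Suc n)"]
    by (simp add: power_add mult_ac)
  have dif: "\<bar>x k - y k\<bar> \<le> 1" for k
    using xy(1,2)[unfolded digit_seqs_iff, rule_format, of k] by auto
  have "norm (?f (k + Suc n)) \<le> (1/3) ^ Suc (k + Suc n)" for k
    using mult_right_mono[OF dif[of "k + Suc n"], of "(1/3) ^ Suc (k + Suc n)"] by (simp add: abs_mult)
  then have "\<bar>- ?f n\<bar> \<le> (1/3) ^ Suc n / 2"
    using norm_suminf_le[of "\<lambda>k. ?f (k + Suc n)" "\<lambda>k. (1/3) ^ Suc (k + Suc n)"] sums_unique[OF tail] sums_unique[OF geo]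
      sums_summable[OF geo] by auto
  moreover have "\<bar>x n - y n\<bar> = 1"
    using n xy(1,2)[unfolded digit_seqs_iff, rule_format, of n] by auto
  then have "\<bar>- ?f n\<bar> = (1/3) ^ Suc n" by (simp add: abs_mult)
  moreover have "(0::real) < (1/3) ^ Suc n" by simp
  ultimately show False by linarith
qed

text \<open>Greedy binary expansion: the remainder is doubled and reduced by the digit just read. It
  stays in the closed unit interval, so \<open>t = 1\<close> is covered too, with all digits equal
  to 1.\<close>

lemma digit_sum_half_surj:
  assumes "0 \<le> t" "t \<le> 1"
  shows "\<exists>x\<in>digit_seqs. digit_sum (1/2) x = t"
proof -
  define rem where "rem = rec_nat t (\<lambda>_ r. 2 * r - (if r \<ge> 1/2 then 1 else 0))"
  define x where "x n = (if rem n \<ge> 1/2 then 1 else 0 :: real)" for n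
  have rem: "rem 0 = t" "rem (Suc n) = 2 * rem n - x n" for n
    by (simp_all add: rem_def x_def)
  have rem01: "0 \<le> rem n \<and> rem n \<le> 1" for n
    by (induction n) (use assms in \<open>auto simp: rem x_def\<close>)
  have part: "(\<Sum>k<n. x k * (1/2) ^ Suc k) = t - rem n * (1/2) ^ n" for n
    by (induction n) (auto simp: rem field_simps)
  have "(\<lambda>n. rem n * (1/2) ^ n) \<longlonglongrightarrow> 0"
  proof (rule Lim_null_comparison)
    show "\<forall>\<^sub>F n in sequentially. norm (rem n * (1/2) ^ n) \<le> (1/2) ^ n"
      using rem01 by (auto simp: abs_mult mult_le_cancel_right1)
    show "(\<lambda>n. (1/2::real) ^ n) \<longlonglongrightarrow> 0" by (rule LIMSEQ_power_zero) simp
  qed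
  then have "(\<lambda>n. \<Sum>k<n. x k * (1/2) ^ Suc k) \<longlonglongrightarrow> t - 0"
    unfolding part by (intro tendsto_diff tendsto_const)
  then have "digit_sum (1/2) x = t"
    using sums_unique[of "\<lambda>k. x k * (1/2) ^ Suc k" t] by (simp add: sums_def digit_sum_def)
  moreover have "x \<in> digit_seqs" by (auto simp: digit_seqs_iff x_def)
  ultimately show ?thesis by blast
qed

text \<open>A version of the Hausdorff-Alexandroff theorem. Truncated distances to a dense sequence
  embed \<open>X\<close> in the Hilbert cube, interleaved binary digits cover that cube, and
  base-three digits code the digit sequences in question injectively as reals. The surjection runs
  through these maps backwards.\<close>

theorem compact_metrizable_image_of_real_compact:
  assumes X: "metrizable_space X" "compact_space X" "topspace X \<noteq> {}"
  shows "\<exists>C \<pi>. compact (C :: real set) \<and> \<pi> ` C = topspace X \<and> continuous_map (top_of_set C) X \<pi>"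
proof -
  obtain M d where M: "Metric_space M d" "X = Metric_space.mtopology M d"
    using X by (auto simp: metrizable_space_def)
  interpret Metric_space M d by (rule M)
  have "\<exists>q :: nat \<Rightarrow> 'a. range q \<subseteq> M \<and> (\<forall>x\<in>M. \<forall>e>0. \<exists>k. d (q k) x < e)"
    by (rule compact_dense_sequence_metric) (use X(2,3) in \<open>simp_all add: M(2)\<close>)
  then obtain q :: "nat \<Rightarrow> 'a" where q': "range q \<subseteq> M" "\<forall>x\<in>M. \<forall>e>0. \<exists>k. d (q k) x < e"
    by (elim exE conjE)
  note q = q'(1) q'(2)[rule_format]
  define \<iota> where "\<iota> x k = min 1 (d (q k) x)" for x k
  have lim_iff: "limitin X xs x sequentially"
    if xs: "range xs \<subseteq> M" "x \<in> M" and lim: "(\<lambda>n. \<iota> (xs n)) \<longlonglongrightarrow> \<iota> x" for xs x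
    unfolding M(2) limit_metric_sequentially
  proof (intro conjI allI impI xs(2))
    fix e :: real assume "e > 0"
    \<comment> \<open>The bound \<open>1/2\<close> keeps the truncation in \<open>\<iota>\<close>
      inactive, so that a small coordinate is a true distance.\<close>
    obtain k where k: "d (q k) x < min (e / 2) (1/2)" using q(2)[OF xs(2), of "min (e / 2) (1/2)"] \<open>e > 0\<close> by auto
    have "(\<lambda>n. \<iota> (xs n) k) \<longlonglongrightarrow> \<iota> x k" using lim by (simp add: tendsto_fun_iff)
    moreover have "\<iota> x k < min (e / 2) (1/2)" using k by (simp add: \<iota>_def)
    ultimately have "\<forall>\<^sub>F n in sequentially. \<iota> (xs n) k < min (e / 2) (1/2)" by (rule order_tendstoD)
    then obtain N where N: "\<And>n. n \<ge> N \<Longrightarrow> \<iota> (xs n) k < min (e / 2) (1/2)"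
      by (auto simp: eventually_sequentially)
    show "\<exists>N. \<forall>n\<ge>N. xs n \<in> M \<and> d (xs n) x < e"
    proof (intro exI[of _ N] allI impI conjI)
      fix n assume "n \<ge> N"
      show xn: "xs n \<in> M" using xs(1) by auto
      have "d (q k) (xs n) < e / 2" using N[OF \<open>n \<ge> N\<close>] by (auto simp: \<iota>_def min_def split: if_splits)
      moreover have "d (xs n) x \<le> d (xs n) (q k) + d (q k) x" using xn xs(2) q(1) by (intro triangle) auto
      ultimately show "d (xs n) x < e" using k commute[of "xs n" "q k"] by auto
    qed
  qed
  have inj: "inj_on \<iota> M"
  proof (rule inj_onI)
    fix x y assume xy: "x \<in> M" "y \<in> M" "\<iota> x = \<iota> y"
    then have y: "limitin X (\<lambda>_. x) y sequentially" by (intro lim_iff) auto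
    have x: "limitin X (\<lambda>_. x) x sequentially" using xy(1) by (simp add: limitin_const_iff M(2))
    show "x = y"
      by (rule limitin_Hausdorff_unique[OF x y]) (simp_all add: M(2) Hausdorff_space_mtopology)
  qed
  have cont_\<iota>: "continuous_map X euclidean \<iota>"
  proof (rule seq_continuous_map[OF X(1)])
    fix xs x assume xs: "range xs \<subseteq> topspace X" "limitin X xs x sequentially"
    have "(\<lambda>n. \<iota> (xs n)) \<longlonglongrightarrow> \<iota> x"
      unfolding tendsto_fun_iff
    proof
      fix k
      have "(\<lambda>n. d (q k) (xs n)) \<longlonglongrightarrow> d (q k) x"
      proof (rule LIMSEQ_I)
        fix e :: real assume "e > 0"
        then obtain N where N: "\<And>n. n \<ge> N \<Longrightarrow> xs n \<in> M \<and> d (xs n) x < e"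
          using xs(2) unfolding M(2) limit_metric_sequentially by blast
        have x: "x \<in> M" using xs(2) unfolding M(2) limit_metric_sequentially by blast
        have qk: "q k \<in> M" using q(1) by auto
        show "\<exists>N. \<forall>n\<ge>N. norm (d (q k) (xs n) - d (q k) x) < e"
        proof (intro exI[of _ N] allI impI)
          fix n assume "n \<ge> N"
          then have "xs n \<in> M" "d (xs n) x < e" using N by auto
          then show "norm (d (q k) (xs n) - d (q k) x) < e"
            using triangle[OF qk _ x, of "xs n"] triangle[OF qk x, of "xs n"] commute[of x "xs n"] by auto
        qed
      qed
      then show "(\<lambda>n. \<iota> (xs n) k) \<longlonglongrightarrow> \<iota> x k" unfolding \<iota>_def by (intro tendsto_intros)
    qed
    then show "limitin euclidean (\<lambda>n. \<iota> (xs n)) (\<iota> x) sequentially" by simp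
  qed simp
  have "compactin euclidean (\<iota> ` topspace X)"
    by (rule image_compactin[OF _ cont_\<iota>]) (use X(2) in \<open>simp add: compact_space_def\<close>)
  then have comp_img: "closed (\<iota> ` M)" by (simp add: M(2) compact_imp_closed)
  \<comment> \<open>Row \<open>m\<close> of the digits, read through the pairing of natural numbers,
    is a binary expansion of coordinate \<open>m\<close> in the Hilbert cube.\<close>
  define c where "c x m = digit_sum (1/2) (\<lambda>n. x (prod_encode (m, n)))" for x m
  have sub_digit: "(\<lambda>n. x (prod_encode (m, n))) \<in> digit_seqs" if "x \<in> digit_seqs" for x m
    using that by (auto simp: digit_seqs_iff)
  have cont_c: "continuous_on digit_seqs c"
  proof (rule continuous_on_coordinatewise_then_product)
    fix m
    show "continuous_on digit_seqs (\<lambda>x. c x m)"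
      unfolding c_def
      by (rule continuous_on_compose2[OF continuous_digit_sum[of "1/2"]])
        (auto intro!: continuous_on_coordinatewise_then_product sub_digit continuous_on_subset[OF continuous_on_product_coordinates])
  qed
  have surj_c: "\<exists>x\<in>digit_seqs. c x = \<iota> y" if "y \<in> M" for y
  proof -
    have "\<forall>m. \<exists>x. x \<in> digit_seqs \<and> digit_sum (1/2) x = \<iota> y m"
      using digit_sum_half_surj[of "\<iota> y _"] by (force simp: \<iota>_def)
    from choice[OF this] obtain z where z: "\<And>m. z m \<in> digit_seqs" "\<And>m. digit_sum (1/2) (z m) = \<iota> y m" by blast
    define x where "x k = (case prod_decode k of (m, n) \<Rightarrow> z m n)" for k
    have "x \<in> digit_seqs" using z(1) by (auto simp: digit_seqs_iff x_def split: prod.split)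
    moreover have "c x = \<iota> y" using z(2) by (auto simp: c_def x_def)
    ultimately show ?thesis by blast
  qed
  \<comment> \<open>Only digit sequences that name a point of the embedded space are kept, so that
    \<open>\<iota>\<close> can be inverted on the values of \<open>c\<close>. \<open>K\<close> is
    compact because the embedded space is closed and \<open>c\<close> is continuous.\<close>
  define K where "K = {x \<in> digit_seqs. c x \<in> \<iota> ` M}"
  have "K = digit_seqs \<inter> c -` (\<iota> ` M)" by (auto simp: K_def)
  then have "compact K"
    using continuous_on_closed_vimage[OF compact_imp_closed[OF compact_digit_seqs], of c] cont_c comp_img
      compact_digit_seqs by (metis Int_absorb1 Int_commute closed_Int compact_Int_closed compact_imp_closed inf_le1)
  have Kd: "K \<subseteq> digit_seqs" by (auto simp: K_def)
  define e where "e = digit_sum (1/3)"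
  have cont_e: "continuous_on K e"
    unfolding e_def by (rule continuous_on_subset[OF continuous_digit_sum Kd]) auto
  have inj_e: "inj_on e K" unfolding e_def by (rule inj_on_subset[OF inj_on_digit_sum Kd])
  define \<pi> where "\<pi> t = inv_into M \<iota> (c (inv_into K e t))" for t
  have cont_inv: "continuous_on (e ` K) (inv_into K e)"
    by (rule continuous_on_inv[OF cont_e \<open>compact K\<close>]) (use inj_e in auto)
  have cont_ci: "continuous_on (e ` K) (\<lambda>t. c (inv_into K e t))"
    by (rule continuous_on_compose2[OF cont_c cont_inv]) (use Kd inv_into_into[of _ e K] in blast)
  have ci: "c (inv_into K e t) \<in> \<iota> ` M" if "t \<in> e ` K" for t
    using inv_into_into[OF that] by (simp add: K_def)
  have \<pi>M: "\<pi> t \<in> M" and \<iota>\<pi>: "\<iota> (\<pi> t) = c (inv_into K e t)" if "t \<in> e ` K" for t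
    using ci[OF that] by (auto simp: \<pi>_def inv_into_into f_inv_into_f)
  show ?thesis
  proof (intro exI[of _ "e ` K"] exI[of _ \<pi>] conjI)
    show "compact (e ` K)" by (rule compact_continuous_image[OF cont_e \<open>compact K\<close>])
    show "\<pi> ` e ` K = topspace X"
    proof
      show "\<pi> ` e ` K \<subseteq> topspace X" using \<pi>M by (auto simp: M(2))
      show "topspace X \<subseteq> \<pi> ` e ` K"
      proof
        fix y assume "y \<in> topspace X"
        then have y: "y \<in> M" by (simp add: M(2))
        then obtain x where x: "x \<in> digit_seqs" "c x = \<iota> y" using surj_c by blast
        then have "x \<in> K" using y by (auto simp: K_def)
        moreover have "\<pi> (e x) = y" using x y \<open>x \<in> K\<close> inj_e inj by (simp add: \<pi>_def inv_into_f_f)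
        ultimately show "y \<in> \<pi> ` e ` K" by force
      qed
    qed
    show "continuous_map (top_of_set (e ` K)) X \<pi>"
    proof (rule seq_continuous_map)
      show "metrizable_space (top_of_set (e ` K))"
        by (intro metrizable_space_subtopology metrizable_space_euclidean)
      show "\<pi> \<in> topspace (top_of_set (e ` K)) \<rightarrow> topspace X" using \<pi>M by (auto simp: M(2))
      fix ts t assume ts: "range ts \<subseteq> topspace (top_of_set (e ` K))" "limitin (top_of_set (e ` K)) ts t sequentially"
      then have t: "t \<in> e ` K" "ts \<longlonglongrightarrow> t" "\<And>n. ts n \<in> e ` K" by (auto simp: limitin_subtopology)
      have "(\<lambda>n. c (inv_into K e (ts n))) \<longlonglongrightarrow> c (inv_into K e t)"
        by (rule continuous_on_tendsto_compose[OF cont_ci t(2,1)]) (use t(3) in simp)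
      then show "limitin X (\<lambda>n. \<pi> (ts n)) (\<pi> t) sequentially"
        using t \<pi>M by (intro lim_iff) (auto simp: \<iota>\<pi>)
    qed
  qed
qed

section \<open>Measurability by discretisation\<close>

lemma borel_of_euclidean: "borel_of euclidean = borel"
  by (simp add: borel_of_def borel_def)

text \<open>An open \<open>U\<close> is exhausted by the closed sets \<open>V k\<close> of points
  whose ball of radius \<open>1 / real (Suc k)\<close> lies in \<open>U\<close>. The limit is in
  \<open>U\<close> iff, for some \<open>k\<close>, the sequence is eventually in \<open>V k\<close>,
  which is a countable condition.\<close>

lemma limit_measurable_borel_of:
  assumes X: "metrizable_space X" and F: "\<And>n. F n \<in> M \<rightarrow>\<^sub>M borel_of X"
    and lim: "\<And>\<omega>. \<omega> \<in> space M \<Longrightarrow> limitin X (\<lambda>n. F n \<omega>) (f \<omega>) sequentially"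
  shows "f \<in> M \<rightarrow>\<^sub>M borel_of X"
proof (rule measurable_borel_ofI)
  show "f \<in> space M \<rightarrow> topspace X" using lim by (auto simp: limitin_def)
  fix U assume U: "openin X U"
  obtain A d where A: "Metric_space A d" "X = Metric_space.mtopology A d"
    using X by (auto simp: metrizable_space_def)
  interpret Metric_space A d by (rule A)
  define V where "V k = {x \<in> A. mball x (1 / real (Suc k)) \<subseteq> U}" for k
  have V_sets: "V k \<in> sets (borel_of X)" for k
  proof -
    have "openin X (\<Union>y\<in>A - U. mball y (1 / real (Suc k)))"
      unfolding A(2) by (intro openin_Union) auto
    moreover have "V k = topspace X - (\<Union>y\<in>A - U. mball y (1 / real (Suc k)))"
      by (auto simp: V_def A(2) commute)
    moreover have "topspace X \<in> sets (borel_of X)" by (rule openin_in_borel_of) simp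
    ultimately show ?thesis using openin_in_borel_of[of X] by auto
  qed
  have eq: "f \<omega> \<in> U \<longleftrightarrow> (\<exists>k. \<exists>N. \<forall>n\<in>{N..}. F n \<omega> \<in> V k)" if \<omega>: "\<omega> \<in> space M" for \<omega>
  proof -
    from lim[OF \<omega>] have fA: "f \<omega> \<in> A" and l: "\<And>e. e > 0 \<Longrightarrow> \<exists>N. \<forall>n\<ge>N. F n \<omega> \<in> A \<and> d (F n \<omega>) (f \<omega>) < e"
      unfolding A(2) limit_metric_sequentially by blast+
    show ?thesis
    proof
      assume "f \<omega> \<in> U"
      then obtain r where r: "r > 0" "mball (f \<omega>) r \<subseteq> U"
        using U unfolding A(2) openin_mtopology by blast
      obtain k where k: "1 / real (Suc k) < r / 2" using r(1) nat_approx_posE[of "r / 2"] by auto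
      obtain N where N: "\<And>n. n \<ge> N \<Longrightarrow> F n \<omega> \<in> A \<and> d (F n \<omega>) (f \<omega>) < r / 2"
        using l[of "r / 2"] r(1) by auto
      have "F n \<omega> \<in> V k" if "n \<ge> N" for n
        unfolding V_def
      proof (intro CollectI conjI subsetI)
        show Fn: "F n \<omega> \<in> A" using N[OF that] by simp
        fix y assume "y \<in> mball (F n \<omega>) (1 / real (Suc k))"
        then have y: "y \<in> A" "d (F n \<omega>) y < r / 2" using k by auto
        have "d (f \<omega>) y \<le> d (f \<omega>) (F n \<omega>) + d (F n \<omega>) y" by (rule triangle[OF fA Fn y(1)])
        then have "d (f \<omega>) y < r" using y(2) N[OF that] by (simp add: commute)
        then show "y \<in> U" using r(2) y(1) fA by auto
      qed
      then show "\<exists>k. \<exists>N. \<forall>n\<in>{N..}. F n \<omega> \<in> V k" by auto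
    next
      assume "\<exists>k. \<exists>N. \<forall>n\<in>{N..}. F n \<omega> \<in> V k"
      then obtain k N where kN: "\<And>n. n \<ge> N \<Longrightarrow> F n \<omega> \<in> V k" by auto
      obtain N' where N': "\<And>n. n \<ge> N' \<Longrightarrow> F n \<omega> \<in> A \<and> d (F n \<omega>) (f \<omega>) < 1 / real (Suc k)"
        using l[of "1 / real (Suc k)"] by auto
      have "F (max N N') \<omega> \<in> V k" "d (F (max N N') \<omega>) (f \<omega>) < 1 / real (Suc k)"
        using kN[of "max N N'"] N'[of "max N N'"] by auto
      then show "f \<omega> \<in> U" using fA by (auto simp: V_def)
    qed
  qed
  have "f -` U \<inter> space M = {\<omega> \<in> space M. \<exists>k. \<exists>N. \<forall>n\<in>{N..}. F n \<omega> \<in> V k}"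
    using eq by auto
  also have "\<dots> \<in> sets M"
  proof -
    have [measurable]: "Measurable.pred M (\<lambda>\<omega>. F n \<omega> \<in> V k)" for n k
      by (rule pred_sets2[OF V_sets F])
    show ?thesis by measurable
  qed
  finally show "f -` U \<inter> space M \<in> sets M" .
qed

text \<open>A form of measurability that survives both pairing and sequentially continuous maps.
  Because the approximants have countably many values, pairing them raises no question about the
  Borel sets of a product.\<close>

definition discrete_limit :: "'a measure \<Rightarrow> 'b topology \<Rightarrow> ('a \<Rightarrow> 'b) \<Rightarrow> bool" where
  "discrete_limit M X f \<longleftrightarrow> (\<exists>I F. countable I \<and> I \<subseteq> topspace X \<and> (\<forall>n::nat. F n \<in> M \<rightarrow>\<^sub>M count_space I) \<and>
     (\<forall>\<omega>\<in>space M. limitin X (\<lambda>n. F n \<omega>) (f \<omega>) sequentially))"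

lemma discrete_limit_measurable:
  assumes "metrizable_space X" "discrete_limit M X f"
  shows "f \<in> M \<rightarrow>\<^sub>M borel_of X"
proof -
  obtain I F where IF: "countable I" "I \<subseteq> topspace X" "\<And>n::nat. F n \<in> M \<rightarrow>\<^sub>M count_space I"
    "\<And>\<omega>. \<omega> \<in> space M \<Longrightarrow> limitin X (\<lambda>n. F n \<omega>) (f \<omega>) sequentially"
    using assms(2) unfolding discrete_limit_def by blast
  have "F n \<in> M \<rightarrow>\<^sub>M borel_of X" for n
    using measurable_compose[OF IF(3)[of n], of "\<lambda>x. x" "borel_of X"] IF(2) by auto
  then show ?thesis by (rule limit_measurable_borel_of[OF assms(1) _ IF(4)])
qed

lemma discrete_limit_compose:
  assumes f: "discrete_limit M X f" and \<phi>: "\<phi> \<in> topspace X \<rightarrow> topspace Y"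
    and seq: "\<And>xs x. range xs \<subseteq> topspace X \<Longrightarrow> limitin X xs x sequentially \<Longrightarrow>
      limitin Y (\<lambda>n. \<phi> (xs n)) (\<phi> x) sequentially"
  shows "discrete_limit M Y (\<lambda>\<omega>. \<phi> (f \<omega>))"
proof -
  obtain I F where IF: "countable I" "I \<subseteq> topspace X" "\<And>n::nat. F n \<in> M \<rightarrow>\<^sub>M count_space I"
    "\<And>\<omega>. \<omega> \<in> space M \<Longrightarrow> limitin X (\<lambda>n. F n \<omega>) (f \<omega>) sequentially"
    using f unfolding discrete_limit_def by blast
  show ?thesis
    unfolding discrete_limit_def
  proof (intro exI[of _ "\<phi> ` I"] exI[of _ "\<lambda>n \<omega>. \<phi> (F n \<omega>)"] conjI allI ballI)
    show "countable (\<phi> ` I)" "\<phi> ` I \<subseteq> topspace Y" using IF(1,2) \<phi> by auto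
    show "(\<lambda>\<omega>. \<phi> (F n \<omega>)) \<in> M \<rightarrow>\<^sub>M count_space (\<phi> ` I)" for n
      by (rule measurable_compose[OF IF(3)]) auto
    fix \<omega> assume \<omega>: "\<omega> \<in> space M"
    have "F n \<omega> \<in> I" for n using measurable_space[OF IF(3) \<omega>] by simp
    then show "limitin Y (\<lambda>n. \<phi> (F n \<omega>)) (\<phi> (f \<omega>)) sequentially"
      using IF(2) by (intro seq IF(4) \<omega>) auto
  qed
qed

lemma discrete_limit_Pair:
  assumes "discrete_limit M X f" "discrete_limit M Y g"
  shows "discrete_limit M (prod_topology X Y) (\<lambda>\<omega>. (f \<omega>, g \<omega>))"
proof -
  obtain I F where IF: "countable I" "I \<subseteq> topspace X" "\<And>n::nat. F n \<in> M \<rightarrow>\<^sub>M count_space I"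
    "\<And>\<omega>. \<omega> \<in> space M \<Longrightarrow> limitin X (\<lambda>n. F n \<omega>) (f \<omega>) sequentially"
    using assms(1) unfolding discrete_limit_def by blast
  obtain J H where JH: "countable J" "J \<subseteq> topspace Y" "\<And>n::nat. H n \<in> M \<rightarrow>\<^sub>M count_space J"
    "\<And>\<omega>. \<omega> \<in> space M \<Longrightarrow> limitin Y (\<lambda>n. H n \<omega>) (g \<omega>) sequentially"
    using assms(2) unfolding discrete_limit_def by blast
  show ?thesis
    unfolding discrete_limit_def
  proof (intro exI[of _ "I \<times> J"] exI[of _ "\<lambda>n \<omega>. (F n \<omega>, H n \<omega>)"] conjI allI ballI)
    show "(\<lambda>\<omega>. (F n \<omega>, H n \<omega>)) \<in> M \<rightarrow>\<^sub>M count_space (I \<times> J)" for n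
      using measurable_Pair[OF IF(3) JH(3)] by (simp add: pair_measure_countable IF(1) JH(1))
  qed (use IF JH in \<open>auto simp: limitin_pairwise o_def\<close>)
qed

text \<open>With finitely many factors the box of the value sets is still countable, and each of its
  points is tested by finitely many coordinates.\<close>

lemma discrete_limit_fun:
  fixes f :: "'i::finite \<Rightarrow> 'a \<Rightarrow> 'b"
  assumes "\<And>i. discrete_limit M (X i) (f i)"
  shows "discrete_limit M (product_topology X UNIV) (\<lambda>\<omega> i. f i \<omega>)"
proof -
  define Q where "Q i I F \<longleftrightarrow> countable I \<and> I \<subseteq> topspace (X i) \<and> (\<forall>n::nat. F n \<in> M \<rightarrow>\<^sub>M count_space I) \<and>
     (\<forall>\<omega>\<in>space M. limitin (X i) (\<lambda>n. F n \<omega>) (f i \<omega>) sequentially)" for i I F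
  have "\<forall>i. \<exists>I F. Q i I F" using assms unfolding discrete_limit_def Q_def by blast
  then obtain I F where Q: "\<And>i. Q i (I i) (F i)" by metis
  have IF: "countable (I i)" "I i \<subseteq> topspace (X i)" "F i n \<in> M \<rightarrow>\<^sub>M count_space (I i)"
    and lim: "\<omega> \<in> space M \<Longrightarrow> limitin (X i) (\<lambda>n. F i n \<omega>) (f i \<omega>) sequentially" for i n \<omega>
    using Q[of i] unfolding Q_def by simp_all
  have inI: "F i n \<omega> \<in> I i" if "\<omega> \<in> space M" for i n \<omega>
    using measurable_space[OF IF(3) that] by simp
  show ?thesis
    unfolding discrete_limit_def
  proof (intro exI[of _ "Pi\<^sub>E UNIV (\<lambda>i. I i)"] exI[of _ "\<lambda>n \<omega> i. F i n \<omega>"] conjI allI ballI)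
    show c: "countable (Pi\<^sub>E UNIV (\<lambda>i. I i))" by (rule countable_PiE) (simp_all add: IF(1))
    show "Pi\<^sub>E UNIV (\<lambda>i. I i) \<subseteq> topspace (product_topology X UNIV)"
      using IF(2) by (auto simp: PiE_iff)
    show "(\<lambda>\<omega> i. F i n \<omega>) \<in> M \<rightarrow>\<^sub>M count_space (Pi\<^sub>E UNIV (\<lambda>i. I i))" for n
      unfolding measurable_count_space_eq_countable[OF c]
    proof (intro conjI ballI)
      show "(\<lambda>\<omega> i. F i n \<omega>) \<in> space M \<rightarrow> Pi\<^sub>E UNIV (\<lambda>i. I i)"
        using inI by (auto simp: PiE_iff)
      fix a assume a: "a \<in> Pi\<^sub>E UNIV (\<lambda>i. I i)"
      have "(\<lambda>\<omega> i. F i n \<omega>) -` {a} \<inter> space M = (\<Inter>i. F i n -` {a i} \<inter> space M)"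
        by (auto simp: fun_eq_iff)
      also have "\<dots> \<in> sets M"
        using a by (intro sets.finite_INT measurable_sets[OF IF(3)]) (auto simp: PiE_iff)
      finally show "(\<lambda>\<omega> i. F i n \<omega>) -` {a} \<inter> space M \<in> sets M" .
    qed
    show "limitin (product_topology X UNIV) (\<lambda>n i. F i n \<omega>) (\<lambda>i. f i \<omega>) sequentially"
      if "\<omega> \<in> space M" for \<omega>
      using subsetD[OF IF(2) inI[OF that]] lim[OF that]
      unfolding limitin_componentwise by (auto simp: PiE_iff intro!: always_eventually)
  qed
qed

lemma discrete_limit_top_of_set_compose:
  fixes \<phi> :: "'b::topological_space \<Rightarrow> 'c::topological_space"
  assumes f: "discrete_limit M (top_of_set A) f" and \<phi>: "\<And>x. x \<in> A \<Longrightarrow> \<phi> x \<in> B"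
    and seq: "\<And>xs x. (\<And>n. xs n \<in> A) \<Longrightarrow> x \<in> A \<Longrightarrow> xs \<longlonglongrightarrow> x \<Longrightarrow> (\<lambda>n. \<phi> (xs n)) \<longlonglongrightarrow> \<phi> x"
  shows "discrete_limit M (top_of_set B) (\<lambda>\<omega>. \<phi> (f \<omega>))"
proof (rule discrete_limit_compose[OF f])
  fix xs x assume "range xs \<subseteq> topspace (top_of_set A)" "limitin (top_of_set A) xs x sequentially"
  then have "\<And>n. xs n \<in> A" "x \<in> A" "xs \<longlonglongrightarrow> x" by (auto simp: limitin_subtopology)
  then show "limitin (top_of_set B) (\<lambda>n. \<phi> (xs n)) (\<phi> x) sequentially"
    using seq \<phi> by (simp add: limitin_subtopology)
qed (use \<phi> in auto)

lemma discrete_limit_Times: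
  assumes "discrete_limit M (top_of_set A) f" "discrete_limit M (top_of_set B) g"
  shows "discrete_limit M (top_of_set (A \<times> B)) (\<lambda>\<omega>. (f \<omega>, g \<omega>))"
  using discrete_limit_Pair[OF assms] by (simp add: prod_topology_subtopology subtopology_subtopology Times_Int_Times)

lemma discrete_limit_Pi:
  fixes f :: "'i::finite \<Rightarrow> 'a \<Rightarrow> 'b::topological_space"
  assumes "\<And>i. discrete_limit M (top_of_set (A i)) (f i)"
  shows "discrete_limit M (top_of_set (Pi UNIV A)) (\<lambda>\<omega> i. f i \<omega>)"
  using discrete_limit_fun[OF assms] subtopology_product_topology[of "\<lambda>_. euclidean :: 'b topology" UNIV A]
  by (simp add: euclidean_product_topology PiE_UNIV_domain)

text \<open>Compactness supplies countably valued approximations of the identity on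
  \<open>A\<close>; they are applied after \<open>f\<close>.\<close>

lemma discrete_limitI:
  fixes f :: "'a \<Rightarrow> 'b::metric_space"
  assumes f: "f \<in> M \<rightarrow>\<^sub>M restrict_space borel A" and A: "compact A" "A \<noteq> {}"
  shows "discrete_limit M (top_of_set A) f"
proof -
  have fA: "f \<in> space M \<rightarrow> A" using measurable_space[OF f] by (auto simp: space_restrict_space)
  have f': "f \<in> M \<rightarrow>\<^sub>M borel_of (top_of_set A)"
  proof (rule measurable_borel_ofI)
    show "f \<in> space M \<rightarrow> topspace (top_of_set A)" using fA by simp
    fix U assume "openin (top_of_set A) U"
    then obtain V where V: "open V" "U = A \<inter> V" by (auto simp: openin_open)
    have "f -` U \<inter> space M = f -` (A \<inter> V) \<inter> space M" using V by simp
    also have "\<dots> \<in> sets M"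
      by (rule measurable_sets[OF f]) (use V in \<open>auto simp: sets_restrict_space\<close>)
    finally show "f -` U \<inter> space M \<in> sets M" .
  qed
  have "metrizable_space (top_of_set A)" by (intro metrizable_space_subtopology metrizable_space_euclidean)
  from countable_discretisation[OF this] A obtain \<rho> where \<rho>':
    "\<forall>n::nat. \<rho> n \<in> borel_of (top_of_set A) \<rightarrow>\<^sub>M count_space UNIV" "\<forall>n. countable (range (\<rho> n))"
    "\<forall>n x. \<rho> n x \<in> A" "\<forall>x\<in>A. limitin (top_of_set A) (\<lambda>n. \<rho> n x) x sequentially"
    by (auto simp: compact_space_subtopology)
  note \<rho> = \<rho>'[rule_format]
  show ?thesis
    unfolding discrete_limit_def
  proof (intro exI[of _ "\<Union>n. range (\<rho> n)"] exI[of _ "\<lambda>n \<omega>. \<rho> n (f \<omega>)"] conjI allI ballI)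
    show c: "countable (\<Union>n. range (\<rho> n))" using \<rho>(2) by auto
    show "(\<lambda>\<omega>. \<rho> n (f \<omega>)) \<in> M \<rightarrow>\<^sub>M count_space (\<Union>n. range (\<rho> n))" for n
      unfolding measurable_count_space_eq_countable[OF c]
      using measurable_sets[OF measurable_compose[OF f' \<rho>(1)[of n]]] by auto
  qed (use \<rho>(3,4) fA in auto)
qed

text \<open>The first variable is replaced by the countably valued \<open>R n\<close>. For each of
  its values the map is measurable in the second variable, and the limit in \<open>n\<close>
  restores the first.\<close>

lemma caratheodory_measurable:
  assumes Z: "metrizable_space Z"
    and R: "\<And>n. R n \<in> N \<rightarrow>\<^sub>M count_space UNIV" "\<And>n. countable (R n ` space N)"
    and meas: "\<And>n x. x \<in> space N \<Longrightarrow> f (R n x) \<in> P \<rightarrow>\<^sub>M borel_of Z"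
    and lim: "\<And>x y. x \<in> space N \<Longrightarrow> y \<in> space P \<Longrightarrow> limitin Z (\<lambda>n. f (R n x) y) (f x y) sequentially"
  shows "(\<lambda>(x, y). f x y) \<in> N \<Otimes>\<^sub>M P \<rightarrow>\<^sub>M borel_of Z"
proof (rule limit_measurable_borel_of[OF Z, where F = "\<lambda>n (x, y). f (R n x) y"])
  fix n
  have "(\<lambda>w. f (R n (fst w)) (snd w)) \<in> N \<Otimes>\<^sub>M P \<rightarrow>\<^sub>M borel_of Z"
  proof (rule measurable_compose_countable'[where f = "\<lambda>x w. f x (snd w)" and g = "\<lambda>w. R n (fst w)"])
    show "(\<lambda>w. f x (snd w)) \<in> N \<Otimes>\<^sub>M P \<rightarrow>\<^sub>M borel_of Z" if "x \<in> R n ` space N" for x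
      using that by (auto intro!: measurable_compose[OF measurable_snd] meas)
    have "R n \<in> N \<rightarrow>\<^sub>M count_space (R n ` space N)"
      unfolding measurable_count_space_eq_countable[OF R(2)] using measurable_sets[OF R(1)] by auto
    then show "(\<lambda>w. R n (fst w)) \<in> N \<Otimes>\<^sub>M P \<rightarrow>\<^sub>M count_space (R n ` space N)"
      by (rule measurable_compose[OF measurable_fst])
  qed (rule R(2))
  then show "(\<lambda>(x, y). f (R n x) y) \<in> N \<Otimes>\<^sub>M P \<rightarrow>\<^sub>M borel_of Z" by (simp add: case_prod_unfold)
qed (auto simp: space_pair_measure intro: lim)

section \<open>Topology of the strategy spaces\<close>

lemma subtopology_mtopology_of_cong:
  assumes S: "S \<subseteq> mspace m" "S \<subseteq> mspace m'" and eq: "\<And>x y. x \<in> S \<Longrightarrow> y \<in> S \<Longrightarrow> mdist m x y = mdist m' x y"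
  shows "subtopology (mtopology_of m) S = subtopology (mtopology_of m') S"
proof -
  have M1: "Metric_space S (mdist m)" and M2: "Metric_space S (mdist m')"
    using S by (meson Metric_space.subspace Metric_space_mspace_mdist)+
  have ball: "Metric_space.mball S (mdist m) x r = Metric_space.mball S (mdist m') x r" for x r
    unfolding Metric_space.mball_def[OF M1] Metric_space.mball_def[OF M2] using eq by auto
  have "Metric_space.mtopology S (mdist m) = Metric_space.mtopology S (mdist m')"
    by (simp add: topology_eq Metric_space.openin_mtopology[OF M1] Metric_space.openin_mtopology[OF M2] ball)
  moreover have "S \<inter> mspace m = S" "S \<inter> mspace m' = S" using S by auto
  ultimately show ?thesis
    by (simp only: mtopology_of_submetric[symmetric]) (simp add: mtopology_of_def)
qed

lemma product_topology_cong:
  assumes "\<And>i. i \<in> I \<Longrightarrow> X i = Y i"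
  shows "product_topology X I = product_topology Y I"
proof -
  have "(\<lambda>F. \<exists>i U. F = {f. f i \<in> U} \<and> i \<in> I \<and> openin (X i) U) =
    (\<lambda>F. \<exists>i U. F = {f. f i \<in> U} \<and> i \<in> I \<and> openin (Y i) U)"
    using assms by (intro ext) (simp cong: conj_cong)
  moreover have "(\<Pi>\<^sub>E i\<in>I. topspace (X i)) = (\<Pi>\<^sub>E i\<in>I. topspace (Y i))"
    using assms by (intro PiE_cong) simp
  ultimately show ?thesis unfolding product_topology[of X] product_topology[of Y] by simp
qed

lemma product_topology_metrizable:
  fixes X :: "'a::countable \<Rightarrow> 'b topology"
  assumes "\<And>i. i \<in> I \<Longrightarrow> metrizable_space (X i)"
  shows "metrizable_space (product_topology X I)"
  using assms by (auto simp: metrizable_space_product_topology)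

lemma tendsto_fun_upd:
  fixes x :: "'a \<Rightarrow> 'b::topological_space"
  assumes "(X \<longlongrightarrow> x) F" "(a \<longlongrightarrow> b) F"
  shows "((\<lambda>n. (X n)(k := a n)) \<longlongrightarrow> x(k := b)) F"
  using assms by (auto simp: tendsto_fun_iff)

lemma tendsto_funD: "(X \<longlongrightarrow> x) F \<Longrightarrow> ((\<lambda>n. X n i) \<longlongrightarrow> x i) F" for x :: "'a \<Rightarrow> 'b::topological_space"
  by (simp add: tendsto_fun_iff)

lemma PiE_fun_upd_Suc:
  "X \<in> Pi\<^sub>E {..<t} (\<lambda>_. A) \<Longrightarrow> a \<in> A \<Longrightarrow> X(t := a) \<in> Pi\<^sub>E {..<Suc t} (\<lambda>_. A)"
  "X \<in> Pi\<^sub>E {..t} (\<lambda>_. A) \<Longrightarrow> a \<in> A \<Longrightarrow> X(Suc t := a) \<in> Pi\<^sub>E {..Suc t} (\<lambda>_. A)"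
  by (auto simp: PiE_iff extensional_def)

locale compact_dynamic_game =
  fixes G :: "('i::finite, 'x0::metric_space, 'x::metric_space, 'u::metric_space, 'y::metric_space,
    'w0::metric_space, 'w::metric_space, 'n::metric_space, 'om) dynamic_game"
  assumes game: "dynamic_game G"
    and compact_env: "compact (env_states G)" "env_states G \<noteq> {}"
      "compact (env_vars G)" "env_vars G \<noteq> {}"
      "compact (env_noises G)" "env_noises G \<noteq> {}"
      "compact (obs_noises G)" "obs_noises G \<noteq> {}"
    and compact_DM: "\<And>i. compact (states G i)" "\<And>i. states G i \<noteq> {}"
      "\<And>i. compact (controls G i)" "\<And>i. controls G i \<noteq> {}"
      "\<And>i. compact (noises G i)" "\<And>i. noises G i \<noteq> {}"
    and cont_cost: "\<And>i t. t \<in> periods G \<Longrightarrow>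
        continuous_on (states G i \<times> controls G i \<times> env_vars G) (stage_cost G i t)"
      "\<And>i. horizon G \<noteq> \<infinity> \<Longrightarrow> continuous_on (states G i) (terminal_cost G i)"
    and cont_dynamics: "\<And>i t. t \<in> periods G \<Longrightarrow>
        continuous_on (states G i \<times> controls G i \<times> env_vars G \<times> noises G i) (state_map G i t)"
      "\<And>t. t \<in> periods G \<Longrightarrow>
        continuous_on (env_states G \<times> Pi UNIV (states G) \<times> Pi UNIV (controls G) \<times> env_noises G)
          (env_state_map G t)"
      "\<And>t. t \<in> periods G \<Longrightarrow>
        continuous_on (env_states G \<times> Pi UNIV (states G) \<times> Pi UNIV (controls G) \<times> obs_noises G)
          (env_var_map G t)"
    and strategies: "\<And>i t. t \<in> periods G \<Longrightarrow> strategies_at G i t \<noteq> {}"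
      "\<And>i t. t \<in> periods G \<Longrightarrow> compactin (mtopology_of (cont_rules G i t)) (strategies_at G i t)"
    and bounded_cost: "\<exists>cbar::real.
        (\<forall>i. \<forall>t\<in>periods G. \<forall>v \<in> states G i \<times> controls G i \<times> env_vars G.
           \<bar>stage_cost G i t v\<bar> < cbar) \<and>
        (horizon G \<noteq> \<infinity> \<longrightarrow> (\<forall>i. \<forall>x\<in>states G i. \<bar>terminal_cost G i x\<bar> < cbar))"
begin

abbreviation pures where "pures i \<equiv> topspace (strategy_top G i)"

abbreviation paths where "paths \<equiv> topspace (env_path_top G)"

abbreviation pure_borel where "pure_borel i \<equiv> borel_of (strategy_top G i)"

abbreviation path_borel where "path_borel \<equiv> borel_of (env_path_top G)"


lemma periods_downward: "t \<in> periods G \<Longrightarrow> k \<le> t \<Longrightarrow> k \<in> periods G"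
  unfolding periods_def by (metis enat_ord_simps(1) le_less_trans mem_Collect_eq)

lemma prob_space_prim: "prob_space (prim G)"
  using game by (simp add: dynamic_game_def)

lemma maps_to:
  assumes "t \<in> periods G"
  shows "x \<in> states G i \<Longrightarrow> u \<in> controls G i \<Longrightarrow> y \<in> env_vars G \<Longrightarrow> w \<in> noises G i \<Longrightarrow>
      state_map G i t (x, u, y, w) \<in> states G i"
    "e \<in> env_states G \<Longrightarrow> (\<And>i. xs i \<in> states G i) \<Longrightarrow> (\<And>i. us i \<in> controls G i) \<Longrightarrow> n \<in> obs_noises G \<Longrightarrow>
      env_var_map G t (e, xs, us, n) \<in> env_vars G"
    "e \<in> env_states G \<Longrightarrow> (\<And>i. xs i \<in> states G i) \<Longrightarrow> (\<And>i. us i \<in> controls G i) \<Longrightarrow> w0 \<in> env_noises G \<Longrightarrow>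
      env_state_map G t (e, xs, us, w0) \<in> env_states G"
proof -
  have G: "state_map G i t \<in> states G i \<times> controls G i \<times> env_vars G \<times> noises G i \<rightarrow> states G i"
    "env_var_map G t \<in> env_states G \<times> Pi UNIV (states G) \<times> Pi UNIV (controls G) \<times> obs_noises G \<rightarrow> env_vars G"
    "env_state_map G t \<in> env_states G \<times> Pi UNIV (states G) \<times> Pi UNIV (controls G) \<times> env_noises G \<rightarrow> env_states G"
    using game assms by (simp_all add: dynamic_game_def)
  show "x \<in> states G i \<Longrightarrow> u \<in> controls G i \<Longrightarrow> y \<in> env_vars G \<Longrightarrow> w \<in> noises G i \<Longrightarrow>
      state_map G i t (x, u, y, w) \<in> states G i" using G(1) by blast
  show "e \<in> env_states G \<Longrightarrow> (\<And>i. xs i \<in> states G i) \<Longrightarrow> (\<And>i. us i \<in> controls G i) \<Longrightarrow> n \<in> obs_noises G \<Longrightarrow>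
      env_var_map G t (e, xs, us, n) \<in> env_vars G" by (rule funcset_mem[OF G(2)]) auto
  show "e \<in> env_states G \<Longrightarrow> (\<And>i. xs i \<in> states G i) \<Longrightarrow> (\<And>i. us i \<in> controls G i) \<Longrightarrow> w0 \<in> env_noises G \<Longrightarrow>
      env_state_map G t (e, xs, us, w0) \<in> env_states G" by (rule funcset_mem[OF G(3)]) auto
qed

lemma strategies_at_mspace:
  assumes "t \<in> periods G" shows "strategies_at G i t \<subseteq> mspace (cont_rules G i t)"
  using compactin_subset_topspace[OF strategies(2)[OF assms]] by simp

lemma strategies_at_props:
  assumes "t \<in> periods G" "f \<in> strategies_at G i t"
  shows "continuous_on (histories G i t) f" "h \<in> histories G i t \<Longrightarrow> f h \<in> controls G i"
    "f \<in> extensional (histories G i t)"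
proof -
  have f: "f \<in> mspace (cont_rules G i t)" using strategies_at_mspace[OF assms(1)] assms(2) by blast
  then show "h \<in> histories G i t \<Longrightarrow> f h \<in> controls G i" "f \<in> extensional (histories G i t)"
    by (auto simp: cont_rules_def)
  have "continuous_map (top_of_set (histories G i t)) (subtopology euclidean (controls G i)) f"
    using f by (simp add: cont_rules_def mtopology_of_submetric)
  then show "continuous_on (histories G i t) f" by (simp add: continuous_map_in_subtopology)
qed

lemma topspace_strategy_top: "pures i = Pi\<^sub>E (periods G) (strategies_at G i)"
  unfolding strategy_top_def topspace_product_topology
  by (rule PiE_cong) (use strategies_at_mspace in auto)

lemma strategy_component:
  "s \<in> pures i \<Longrightarrow> t \<in> periods G \<Longrightarrow> s t \<in> strategies_at G i t"
  by (auto simp: topspace_strategy_top)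

lemma strategy_top_metrizable: "metrizable_space (strategy_top G i)"
  unfolding strategy_top_def
  by (intro product_topology_metrizable metrizable_space_subtopology)
    (simp add: mtopology_of_def Metric_space.metrizable_space_mtopology)

lemma strategy_top_compact: "compact_space (strategy_top G i)"
  unfolding strategy_top_def compact_space_product_topology
  using strategies(2) by (auto intro: compact_space_subtopology)

lemma strategy_top_nonempty: "pures i \<noteq> {}"
  using strategies(1) by (auto simp: topspace_strategy_top PiE_eq_empty_iff)

lemma env_path_top_topspace: "paths = Pi\<^sub>E (periods G) (\<lambda>_. env_vars G)"
  by (simp add: env_path_top_def)

lemma env_path_top_metrizable: "metrizable_space (env_path_top G)"
  unfolding env_path_top_def
  by (intro product_topology_metrizable metrizable_space_subtopology metrizable_space_euclidean)

lemma env_path_top_nonempty: "paths \<noteq> {}"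
  using compact_env by (auto simp: env_path_top_topspace PiE_eq_empty_iff)

lemma limitin_env_path_top:
  "limitin (env_path_top G) zs z sequentially \<longleftrightarrow> z \<in> paths \<and>
    (\<forall>\<^sub>F n in sequentially. zs n \<in> paths) \<and> (\<forall>t\<in>periods G. (\<lambda>n. zs n t) \<longlonglongrightarrow> z t)"
proof -
  have "(\<forall>t\<in>periods G. \<forall>\<^sub>F n in sequentially. zs n t \<in> env_vars G)"
    if "\<forall>\<^sub>F n in sequentially. zs n \<in> paths"
    using that by (auto simp: env_path_top_topspace elim: eventually_mono)
  then show ?thesis
    unfolding env_path_top_def limitin_componentwise
    by (auto simp: limitin_subtopology PiE_iff env_path_top_def)
qed

lemma limitin_strategy_component:
  assumes "limitin (strategy_top G i) ss s sequentially" "t \<in> periods G"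
  shows "limitin (mtopology_of (cont_rules G i t)) (\<lambda>n. ss n t) (s t) sequentially"
  using assms unfolding strategy_top_def limitin_componentwise by (auto simp: limitin_subtopology)

text \<open>Evaluation is jointly continuous: the supremum metric makes \<open>ss n t\<close> close
  to \<open>s t\<close> even at the moving history \<open>hs n\<close>, and the limit rule
  \<open>s t\<close> is itself continuous.\<close>

lemma strategy_eval_tendsto:
  assumes lim: "limitin (strategy_top G i) ss s sequentially" "t \<in> periods G"
    and hs: "\<And>n. hs n \<in> histories G i t" "h \<in> histories G i t" "hs \<longlonglongrightarrow> h"
  shows "(\<lambda>n. ss n t (hs n)) \<longlonglongrightarrow> s t h"
proof -
  let ?m = "cont_rules G i t"
  have s: "s t \<in> strategies_at G i t" using lim by (intro strategy_component) (auto simp: limitin_def)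
  have "(\<lambda>n. s t (hs n)) \<longlonglongrightarrow> s t h"
    by (rule continuous_on_tendsto_compose[OF strategies_at_props(1)[OF lim(2) s] hs(3,2)]) (use hs in auto)
  moreover have "(\<lambda>n. dist (ss n t (hs n)) (s t (hs n))) \<longlonglongrightarrow> 0"
  proof (rule LIMSEQ_I)
    fix e :: real assume "e > 0"
    then obtain N where N: "\<And>n. n \<ge> N \<Longrightarrow> ss n t \<in> mspace ?m \<and> mdist ?m (ss n t) (s t) < e / 2"
      using limitin_strategy_component[OF lim] half_gt_zero[of e]
      unfolding mtopology_of_def Metric_space.limit_metric_sequentially[OF Metric_space_mspace_mdist] by blast
    show "\<exists>N. \<forall>n\<ge>N. norm (dist (ss n t (hs n)) (s t (hs n)) - 0) < e"
    proof (intro exI[of _ N] allI impI)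
      fix n assume "n \<ge> N"
      have "s t \<in> mspace ?m" using s strategies_at_mspace[OF lim(2)] by blast
      then have "mdist (submetric euclidean_metric (controls G i)) (ss n t (hs n)) (s t (hs n)) \<le> e / 2"
        using N[OF \<open>n \<ge> N\<close>] hs(1)[of n] unfolding cont_rules_def
        by (intro mdist_cfunspace_imp_mdist_le[of "ss n t" "top_of_set (histories G i t)"]) auto
      then show "norm (dist (ss n t (hs n)) (s t (hs n)) - 0) < e" using \<open>e > 0\<close> by simp
    qed
  qed
  ultimately have "(\<lambda>n. dist (ss n t (hs n)) (s t (hs n)) + dist (s t (hs n)) (s t h)) \<longlonglongrightarrow> 0 + 0"
    by (intro tendsto_add) (simp_all add: tendsto_dist_iff[symmetric])
  then have sum0: "(\<lambda>n. dist (ss n t (hs n)) (s t (hs n)) + dist (s t (hs n)) (s t h)) \<longlonglongrightarrow> 0" by simp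
  show ?thesis
    unfolding tendsto_dist_iff[of "\<lambda>n. ss n t (hs n)"]
    by (rule Lim_null_comparison[OF _ sum0]) (simp add: dist_triangle)
qed

text \<open>The two DMs may have different histories and controls, and hence different supremum
  metrics. But a common rule is \<open>undefined\<close> at a history that belongs to only one of
  them, so such points contribute nothing to the distance of two common rules.\<close>

lemma strategy_top_eqI:
  assumes "pures i = pures j"
  shows "strategy_top G i = strategy_top G j"
proof -
  have S: "strategies_at G i t = strategies_at G j t" if "t \<in> periods G" for t
    using assms strategy_top_nonempty[of i] that
    by (auto simp: topspace_strategy_top PiE_eq_iff PiE_eq_empty_iff)
  have le: "mdist (cont_rules G i t) f g \<le> mdist (cont_rules G j t) f g"
    if t: "t \<in> periods G" and fg: "f \<in> strategies_at G j t" "g \<in> strategies_at G j t" for t f g i j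
    unfolding cont_rules_def[of G i]
  proof (rule mdist_cfunspace_le)
    fix x assume "x \<in> topspace (top_of_set (histories G i t))"
    have fgm: "f \<in> mspace (cont_rules G j t)" "g \<in> mspace (cont_rules G j t)"
      using strategies_at_mspace[OF t] fg by blast+
    show "mdist (submetric euclidean_metric (controls G i)) (f x) (g x) \<le> mdist (cont_rules G j t) f g"
    proof (cases "x \<in> histories G j t")
      case True
      then show ?thesis
        using mdist_cfunspace_imp_mdist_le[OF fgm[unfolded cont_rules_def] order.refl, of x]
        by (simp add: cont_rules_def)
    next
      case False
      then have "f x = g x"
        using extensional_arb[OF strategies_at_props(3)[OF t fg(1)]] extensional_arb[OF strategies_at_props(3)[OF t fg(2)]] by metis
      then show ?thesis by simp
    qed
  qed simp
  show ?thesis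
    unfolding strategy_top_def
  proof (rule product_topology_cong)
    fix t assume t: "t \<in> periods G"
    have "subtopology (mtopology_of (cont_rules G i t)) (strategies_at G j t) =
      subtopology (mtopology_of (cont_rules G j t)) (strategies_at G j t)"
      using strategies_at_mspace[OF t] S[OF t] le[OF t]
      by (intro subtopology_mtopology_of_cong antisym) auto
    then show "subtopology (mtopology_of (cont_rules G i t)) (strategies_at G i t) =
      subtopology (mtopology_of (cont_rules G j t)) (strategies_at G j t)" using S[OF t] by simp
  qed
qed

end

section \<open>Continuity and measurability of the dynamics\<close>

text \<open>One period with the noise as an argument. The play becomes the iteration of a map
  continuous in profile, state and noise together.\<close>

definition play_step where
  "play_step G s t p n = (case p of (e, X, U, Y) \<Rightarrow> case n of (w0, w, \<xi>) \<Rightarrow>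
     let x = (\<lambda>i. X i t); u = (\<lambda>i. s i t (X i, U i, Y)); y = env_var_map G t (e, x, u, \<xi>)
     in (env_state_map G t (e, x, u, w0), \<lambda>i. (X i)(Suc t := state_map G i t (x i, u i, y, w i)),
         \<lambda>i. (U i)(t := u i), Y(t := y)))"

lemma play_Suc: "play G s \<omega> (Suc t) =
    play_step G s t (play G s \<omega> t) (env_noise G t \<omega>, \<lambda>i. noise G i t \<omega>, obs_noise G t \<omega>)"
  by (simp add: play_step_def Let_def split: prod.splits)

definition own_step where
  "own_step G i s z t p w = (case p of (X, U) \<Rightarrow> let u = s t (X, U, restrict z {..<t})
     in (X(Suc t := state_map G i t (X t, u, z t, w)), U(t := u)))"

lemma own_play_Suc: "own_play G i s z \<omega> (Suc t) = own_step G i s z t (own_play G i s z \<omega> t) (noise G i t \<omega>)"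
  by (simp add: own_step_def Let_def split: prod.splits)

text \<open>Entries outside the index range are \<open>undefined\<close>, so on this set convergence
  in the full function type is convergence of the actual entries.\<close>

definition play_states where
  "play_states G t = {(e, X, U, Y). e \<in> env_states G \<and> (\<forall>i. (X i, U i, Y) \<in> histories G i t)}"

definition own_states where
  "own_states G i t = Pi\<^sub>E {..t::nat} (\<lambda>_. states G i) \<times> Pi\<^sub>E {..<t} (\<lambda>_. controls G i)"

definition profiles where
  "profiles G = Pi UNIV (\<lambda>i. topspace (strategy_top G i))"

context compact_dynamic_game
begin

section \<open>True play: invariance, convergence and measurability\<close>

lemma play_step_in:
  assumes t: "t \<in> periods G" and s: "s \<in> profiles G" and p: "p \<in> play_states G t"
    and n: "w0 \<in> env_noises G" "\<And>i. w i \<in> noises G i" "\<xi> \<in> obs_noises G"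
  shows "play_step G s t p (w0, w, \<xi>) \<in> play_states G (Suc t)"
proof -
  obtain e X U Y where [simp]: "p = (e, X, U, Y)" by (cases p)
  have e: "e \<in> env_states G" and h: "\<And>i. (X i, U i, Y) \<in> histories G i t"
    using p by (auto simp: play_states_def)
  have x: "X i t \<in> states G i" for i using h[of i] by (auto simp: histories_def)
  have u: "s i t (X i, U i, Y) \<in> controls G i" for i
    using s t by (intro strategies_at_props(2)[OF t strategy_component h]) (auto simp: profiles_def)
  have y: "env_var_map G t (e, \<lambda>i. X i t, \<lambda>i. s i t (X i, U i, Y), \<xi>) \<in> env_vars G"
    by (rule maps_to(2)[OF t e x u n(3)])
  show ?thesis
    using h maps_to(3)[OF t e x u n(1)] maps_to(1)[OF t x u y n(2)] u y
    by (auto simp: play_step_def play_states_def Let_def histories_def intro!: PiE_fun_upd_Suc)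
qed

text \<open>Everything moves together because the lemma serves twice: with constant noise for
  convergence in the profile, with a constant profile for measurability in the randomness.\<close>

lemma play_step_tendsto:
  assumes t: "t \<in> periods G"
    and s: "\<And>n. ss n \<in> profiles G" "\<And>i. limitin (strategy_top G i) (\<lambda>n. ss n i) (s i) sequentially"
    and p: "\<And>n. ps n \<in> play_states G t" "p \<in> play_states G t" "ps \<longlonglongrightarrow> p"
    and w0: "\<And>n. w0s n \<in> env_noises G" "w0 \<in> env_noises G" "w0s \<longlonglongrightarrow> w0"
    and w: "\<And>n i. ws n i \<in> noises G i" "\<And>i. w i \<in> noises G i" "\<And>i. (\<lambda>n. ws n i) \<longlonglongrightarrow> w i"
    and \<xi>: "\<And>n. \<xi>s n \<in> obs_noises G" "\<xi> \<in> obs_noises G" "\<xi>s \<longlonglongrightarrow> \<xi>"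
  shows "(\<lambda>n. play_step G (ss n) t (ps n) (w0s n, ws n, \<xi>s n)) \<longlonglongrightarrow> play_step G s t p (w0, w, \<xi>)"
proof -
  define e X U Y where d: "e = fst p" "X = fst (snd p)" "U = fst (snd (snd p))" "Y = snd (snd (snd p))"
  define es Xs Us Ys where ds: "es = (\<lambda>n. fst (ps n))" "Xs = (\<lambda>n. fst (snd (ps n)))"
    "Us = (\<lambda>n. fst (snd (snd (ps n))))" "Ys = (\<lambda>n. snd (snd (snd (ps n))))"
  have p_eq: "p = (e, X, U, Y)" "ps n = (es n, Xs n, Us n, Ys n)" for n by (simp_all add: d ds)
  have e: "es n \<in> env_states G" "e \<in> env_states G"
    and h: "\<And>i. (Xs n i, Us n i, Ys n) \<in> histories G i t" "\<And>i. (X i, U i, Y) \<in> histories G i t" for n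
    using p(1)[of n] p(2) unfolding p_eq by (auto simp: play_states_def)
  have lim: "es \<longlonglongrightarrow> e" "Xs \<longlonglongrightarrow> X" "Us \<longlonglongrightarrow> U" "Ys \<longlonglongrightarrow> Y"
    unfolding d ds by (intro tendsto_intros p(3))+
  have s_in: "s \<in> profiles G" using s(2) by (auto simp: profiles_def limitin_def)
  have x: "Xs n i t \<in> states G i" "X i t \<in> states G i" for i n
  proof -
    have "(Xs n i, Us n i, Ys n) \<in> histories G i t" "(X i, U i, Y) \<in> histories G i t" by (rule h)+
    then show "Xs n i t \<in> states G i" "X i t \<in> states G i" by (auto simp: histories_def)
  qed
  define us where "us n i = ss n i t (Xs n i, Us n i, Ys n)" for n i
  define u where "u i = s i t (X i, U i, Y)" for i
  have u: "us n i \<in> controls G i" "u i \<in> controls G i" for n i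
  proof -
    have "ss n i \<in> pures i" "s i \<in> pures i"
      using s(1) s_in by (auto simp: profiles_def)
    then show "us n i \<in> controls G i" "u i \<in> controls G i"
      unfolding us_def u_def
      using strategies_at_props(2)[OF t strategy_component[OF _ t] h(1)]
        strategies_at_props(2)[OF t strategy_component[OF _ t] h(2)] by blast+
  qed
  have lim_x: "(\<lambda>n. Xs n i t) \<longlonglongrightarrow> X i t" for i by (rule tendsto_funD[OF tendsto_funD[OF lim(2)]])
  have lim_u: "(\<lambda>n. us n i) \<longlonglongrightarrow> u i" for i
    unfolding us_def u_def
    by (rule strategy_eval_tendsto[OF s(2) t h]) (intro tendsto_Pair tendsto_funD[OF lim(2)] tendsto_funD[OF lim(3)] lim(4))
  have lim_xs: "(\<lambda>n i. Xs n i t) \<longlonglongrightarrow> (\<lambda>i. X i t)" "us \<longlonglongrightarrow> u"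
    using lim_x lim_u by (simp_all add: tendsto_fun_iff)
  define ys where "ys n = env_var_map G t (es n, \<lambda>i. Xs n i t, us n, \<xi>s n)" for n
  define y where "y = env_var_map G t (e, \<lambda>i. X i t, u, \<xi>)"
  have lim_y: "ys \<longlonglongrightarrow> y"
    unfolding ys_def y_def
    by (rule continuous_on_tendsto_compose[OF cont_dynamics(3)[OF t]])
      (use lim lim_xs \<xi> e x u in \<open>auto intro!: tendsto_Pair\<close>)
  have y: "ys n \<in> env_vars G" "y \<in> env_vars G" for n
    unfolding ys_def y_def using e x u \<xi> by (auto intro!: maps_to(2)[OF t])
  have lim_e: "(\<lambda>n. env_state_map G t (es n, \<lambda>i. Xs n i t, us n, w0s n)) \<longlonglongrightarrow> env_state_map G t (e, \<lambda>i. X i t, u, w0)"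
    by (rule continuous_on_tendsto_compose[OF cont_dynamics(2)[OF t]])
      (use lim lim_xs w0 e x u in \<open>auto intro!: tendsto_Pair\<close>)
  have lim_st: "(\<lambda>n. state_map G i t (Xs n i t, us n i, ys n, ws n i)) \<longlonglongrightarrow> state_map G i t (X i t, u i, y, w i)" for i
    by (rule continuous_on_tendsto_compose[OF cont_dynamics(1)[OF t]])
      (use lim_x lim_u lim_y w x u y in \<open>auto intro!: tendsto_Pair\<close>)
  have "(\<lambda>n i. (Xs n i)(Suc t := state_map G i t (Xs n i t, us n i, ys n, ws n i))) \<longlonglongrightarrow>
      (\<lambda>i. (X i)(Suc t := state_map G i t (X i t, u i, y, w i)))"
    unfolding tendsto_fun_iff[of _ "\<lambda>i. (X i)(Suc t := state_map G i t (X i t, u i, y, w i))"]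
    by (intro allI tendsto_fun_upd lim_st tendsto_funD[OF lim(2)])
  moreover have "(\<lambda>n i. (Us n i)(t := us n i)) \<longlonglongrightarrow> (\<lambda>i. (U i)(t := u i))"
    unfolding tendsto_fun_iff[of _ "\<lambda>i. (U i)(t := u i)"]
    by (intro allI tendsto_fun_upd lim_u tendsto_funD[OF lim(3)])
  moreover have "(\<lambda>n. (Ys n)(t := ys n)) \<longlonglongrightarrow> Y(t := y)" by (intro tendsto_fun_upd lim_y lim)
  ultimately show ?thesis
    unfolding play_step_def p_eq using lim_e
    by (simp add: Let_def us_def[symmetric] u_def[symmetric] ys_def[symmetric] y_def[symmetric] tendsto_Pair)
qed

lemma noise_in:
  assumes "\<omega> \<in> space (prim G)" "t \<in> periods G"
  shows "env_noise G t \<omega> \<in> env_noises G" "noise G i t \<omega> \<in> noises G i" "obs_noise G t \<omega> \<in> obs_noises G"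
proof -
  have "env_noise G t \<in> prim G \<rightarrow>\<^sub>M restrict_space borel (env_noises G)"
    "noise G i t \<in> prim G \<rightarrow>\<^sub>M restrict_space borel (noises G i)"
    "obs_noise G t \<in> prim G \<rightarrow>\<^sub>M restrict_space borel (obs_noises G)"
    using game assms(2) by (simp_all add: dynamic_game_def)
  from this[THEN measurable_space, OF assms(1)]
  show "env_noise G t \<omega> \<in> env_noises G" "noise G i t \<omega> \<in> noises G i" "obs_noise G t \<omega> \<in> obs_noises G"
    by (simp_all add: space_restrict_space)
qed

lemma init_in:
  assumes "\<omega> \<in> space (prim G)"
  shows "env_init G \<omega> \<in> env_states G" "init G i \<omega> \<in> states G i"
proof -
  have "env_init G \<in> prim G \<rightarrow>\<^sub>M restrict_space borel (env_states G)"
    "init G i \<in> prim G \<rightarrow>\<^sub>M restrict_space borel (states G i)"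
    using game by (simp_all add: dynamic_game_def)
  from this[THEN measurable_space, OF assms]
  show "env_init G \<omega> \<in> env_states G" "init G i \<omega> \<in> states G i"
    by (simp_all add: space_restrict_space)
qed

lemma play_0_in:
  "e \<in> env_states G \<Longrightarrow> (\<And>i. x i \<in> states G i) \<Longrightarrow>
    (e, \<lambda>i. (\<lambda>_. undefined)(0 := x i), \<lambda>i _. undefined, \<lambda>_. undefined) \<in> play_states G 0"
  by (auto simp: play_states_def histories_def PiE_iff extensional_def)

lemma play_in:
  assumes s: "s \<in> profiles G" and \<omega>: "\<omega> \<in> space (prim G)" and t: "\<And>k. k < t \<Longrightarrow> k \<in> periods G"
  shows "play G s \<omega> t \<in> play_states G t"
  using t
proof (induction t)
  case 0
  show ?case using play_0_in[OF init_in[OF \<omega>]] by simp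
next
  case (Suc t)
  then show ?case
    unfolding play_Suc by (intro play_step_in s noise_in[OF \<omega>]) auto
qed

lemma play_tendsto:
  assumes s: "\<And>n. ss n \<in> profiles G" "\<And>i. limitin (strategy_top G i) (\<lambda>n. ss n i) (s i) sequentially"
    and \<omega>: "\<omega> \<in> space (prim G)" and t: "\<And>k. k < t \<Longrightarrow> k \<in> periods G"
  shows "(\<lambda>n. play G (ss n) \<omega> t) \<longlonglongrightarrow> play G s \<omega> t"
  using t
proof (induction t)
  case (Suc t)
  have s_in: "s \<in> profiles G" using s(2) by (auto simp: profiles_def limitin_def)
  show ?case
    unfolding play_Suc
    by (intro play_step_tendsto s play_in \<omega> s_in Suc noise_in[OF \<omega>] tendsto_const) (use Suc in auto)
qed simp

lemma discrete_limit_noise: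
  assumes "t \<in> periods G"
  shows "discrete_limit (prim G) (top_of_set (env_noises G)) (env_noise G t)"
    "discrete_limit (prim G) (top_of_set (noises G i)) (noise G i t)"
    "discrete_limit (prim G) (top_of_set (obs_noises G)) (obs_noise G t)"
  using game assms compact_env compact_DM by (auto simp: dynamic_game_def intro!: discrete_limitI)

lemma discrete_limit_init:
  "discrete_limit (prim G) (top_of_set (env_states G)) (env_init G)"
  "discrete_limit (prim G) (top_of_set (states G i)) (init G i)"
  using game compact_env compact_DM by (auto simp: dynamic_game_def intro!: discrete_limitI)

lemma strategy_const_limit:
  "s \<in> profiles G \<Longrightarrow> limitin (strategy_top G i) (\<lambda>n. s i) (s i) sequentially"
  by (auto simp: profiles_def limitin_const_iff)

text \<open>Initial data and noises are limits of countably valued maps, and each period applies a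
  continuous map to the present state paired with the noise of that period.\<close>

lemma discrete_limit_play:
  assumes s: "s \<in> profiles G" and t: "\<And>k. k < t \<Longrightarrow> k \<in> periods G"
  shows "discrete_limit (prim G) (top_of_set (play_states G t)) (\<lambda>\<omega>. play G s \<omega> t)"
  using t
proof (induction t)
  case 0
  let ?\<phi> = "\<lambda>(e, x). (e, \<lambda>i. (\<lambda>_. undefined)(0 := x i), \<lambda>i _. undefined, \<lambda>_. undefined)"
  have "discrete_limit (prim G) (top_of_set (play_states G 0)) (\<lambda>\<omega>. ?\<phi> (env_init G \<omega>, \<lambda>i. init G i \<omega>))"
  proof (rule discrete_limit_top_of_set_compose[OF discrete_limit_Times[OF discrete_limit_init(1) discrete_limit_Pi]])
    show "discrete_limit (prim G) (top_of_set (states G i)) (init G i)" for i by (rule discrete_limit_init)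
    show "?\<phi> q \<in> play_states G 0" if "q \<in> env_states G \<times> Pi UNIV (states G)" for q
      using play_0_in[of "fst q" "snd q"] that by (simp add: case_prod_unfold mem_Times_iff Pi_iff)
    fix ps and p :: "'x0 \<times> ('i \<Rightarrow> 'x)" assume "ps \<longlonglongrightarrow> p"
    then have "(\<lambda>n. fst (ps n)) \<longlonglongrightarrow> fst p" "(\<lambda>n. snd (ps n)) \<longlonglongrightarrow> snd p"
      by (auto intro: tendsto_fst tendsto_snd)
    then show "(\<lambda>n. ?\<phi> (ps n)) \<longlonglongrightarrow> ?\<phi> p"
      unfolding case_prod_unfold by (intro tendsto_Pair tendsto_const) (auto simp: tendsto_fun_iff)
  qed
  then show ?case by simp
next
  case (Suc t)
  have tT: "t \<in> periods G" using Suc.prems by simp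
  let ?\<phi> = "\<lambda>(p, w0, w, \<xi>). play_step G s t p (w0, w, \<xi>)"
  have "discrete_limit (prim G) (top_of_set (play_states G (Suc t)))
    (\<lambda>\<omega>. ?\<phi> (play G s \<omega> t, env_noise G t \<omega>, \<lambda>i. noise G i t \<omega>, obs_noise G t \<omega>))"
  proof (rule discrete_limit_top_of_set_compose[where \<phi> = "?\<phi>"])
    show "discrete_limit (prim G) (top_of_set (play_states G t \<times> env_noises G \<times> Pi UNIV (noises G) \<times> obs_noises G))
        (\<lambda>\<omega>. (play G s \<omega> t, env_noise G t \<omega>, \<lambda>i. noise G i t \<omega>, obs_noise G t \<omega>))"
      using Suc by (intro discrete_limit_Times discrete_limit_Pi discrete_limit_noise tT) auto
    show "?\<phi> q \<in> play_states G (Suc t)"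
      if "q \<in> play_states G t \<times> env_noises G \<times> Pi UNIV (noises G) \<times> obs_noises G" for q
      using that by (auto intro!: play_step_in tT s)
    fix ps p assume ps: "\<And>n. ps n \<in> play_states G t \<times> env_noises G \<times> Pi UNIV (noises G) \<times> obs_noises G"
      "p \<in> play_states G t \<times> env_noises G \<times> Pi UNIV (noises G) \<times> obs_noises G" and lim: "ps \<longlonglongrightarrow> p"
    have mem: "fst q \<in> play_states G t" "fst (snd q) \<in> env_noises G" "fst (snd (snd q)) i \<in> noises G i"
      "snd (snd (snd q)) \<in> obs_noises G"
      if "q \<in> play_states G t \<times> env_noises G \<times> Pi UNIV (noises G) \<times> obs_noises G" for q i
      using that by auto
    have "(\<lambda>n. play_step G s t (fst (ps n)) (fst (snd (ps n)), fst (snd (snd (ps n))), snd (snd (snd (ps n))))) \<longlonglongrightarrow>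
      play_step G s t (fst p) (fst (snd p), fst (snd (snd p)), snd (snd (snd p)))"
      by (rule play_step_tendsto[OF tT s strategy_const_limit[OF s] mem(1)[OF ps(1)] mem(1)[OF ps(2)] tendsto_fst[OF lim]
          mem(2)[OF ps(1)] mem(2)[OF ps(2)] tendsto_fst[OF tendsto_snd[OF lim]]
          mem(3)[OF ps(1)] mem(3)[OF ps(2)] tendsto_funD[OF tendsto_fst[OF tendsto_snd[OF tendsto_snd[OF lim]]]]
          mem(4)[OF ps(1)] mem(4)[OF ps(2)] tendsto_snd[OF tendsto_snd[OF tendsto_snd[OF lim]]]])
    then show "(\<lambda>n. ?\<phi> (ps n)) \<longlonglongrightarrow> ?\<phi> p" by (simp add: case_prod_unfold)
  qed
  then show ?case by (simp add: play_Suc del: play.simps)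
qed

lemma env_path_eq:
  "t \<in> periods G \<Longrightarrow> env_path G s \<omega> t = snd (snd (snd (play G s \<omega> (Suc t)))) t"
  by (simp add: env_path_def case_prod_unfold del: play.simps)

lemma periods_Suc: "t \<in> periods G \<Longrightarrow> k < Suc t \<Longrightarrow> k \<in> periods G"
  using periods_downward by simp

lemma play_states_env: "p \<in> play_states G (Suc t) \<Longrightarrow> snd (snd (snd p)) t \<in> env_vars G"
  by (auto simp: play_states_def histories_def PiE_iff)

lemma env_path_in:
  assumes "s \<in> profiles G" "\<omega> \<in> space (prim G)"
  shows "env_path G s \<omega> \<in> paths"
  unfolding env_path_top_topspace
proof (rule PiE_I)
  fix t assume "t \<in> periods G"
  then show "env_path G s \<omega> t \<in> env_vars G"
    using play_states_env[OF play_in[OF assms periods_Suc]] by (simp add: env_path_eq del: play.simps)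
qed (simp add: env_path_def)

lemma env_path_tendsto:
  assumes s: "\<And>n. ss n \<in> profiles G" "\<And>i. limitin (strategy_top G i) (\<lambda>n. ss n i) (s i) sequentially"
    and \<omega>: "\<omega> \<in> space (prim G)"
  shows "limitin (env_path_top G) (\<lambda>n. env_path G (ss n) \<omega>) (env_path G s \<omega>) sequentially"
  unfolding limitin_env_path_top
proof (intro conjI ballI always_eventually allI env_path_in \<omega> s)
  show "s \<in> profiles G" using s(2) by (auto simp: profiles_def limitin_def)
  fix t assume t: "t \<in> periods G"
  have "(\<lambda>n. play G (ss n) \<omega> (Suc t)) \<longlonglongrightarrow> play G s \<omega> (Suc t)"
    by (intro play_tendsto s \<omega> periods_Suc[OF t])
  then show "(\<lambda>n. env_path G (ss n) \<omega> t) \<longlonglongrightarrow> env_path G s \<omega> t"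
    unfolding env_path_eq[OF t] by (rule tendsto_funD[OF tendsto_snd[OF tendsto_snd[OF tendsto_snd]]])
qed

lemma discrete_limit_env_path:
  assumes s: "s \<in> profiles G" and t: "t \<in> periods G"
  shows "discrete_limit (prim G) (top_of_set (env_vars G)) (\<lambda>\<omega>. env_path G s \<omega> t)"
  unfolding env_path_eq[OF t]
  by (rule discrete_limit_top_of_set_compose[OF discrete_limit_play[OF s periods_Suc[OF t]]])
    (auto intro: play_states_env tendsto_funD[OF tendsto_snd[OF tendsto_snd[OF tendsto_snd]]])

text \<open>A path may have infinitely many coordinates. It is approached by \<open>F n\<close>,
  correct before \<open>n\<close> and equal to a fixed \<open>z0\<close> afterwards; each
  \<open>F (Suc n)\<close> differs from \<open>F n\<close> in at most one coordinate, which allows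
  an induction by pairing.\<close>

lemma env_path_measurable:
  assumes s: "s \<in> profiles G"
  shows "env_path G s \<in> prim G \<rightarrow>\<^sub>M path_borel"
proof -
  obtain z0 where z0: "z0 \<in> paths" using env_path_top_nonempty by blast
  define F where "F n \<omega> t = (if t < n \<and> t \<in> periods G then env_path G s \<omega> t else z0 t)" for n :: nat and \<omega> t
  have F_in: "F n \<omega> \<in> paths" if "\<omega> \<in> space (prim G)" for n \<omega>
    using env_path_in[OF s that] z0 by (auto simp: F_def env_path_top_topspace PiE_iff extensional_def)
  have dl: "discrete_limit (prim G) (env_path_top G) (F n)" for n
  proof (induction n)
    case 0
    have "F 0 = (\<lambda>_. z0)" by (simp add: F_def fun_eq_iff)
    then show ?case
      unfolding discrete_limit_def
      by (intro exI[of _ "{z0}"] exI[of _ "\<lambda>_ _. z0"]) (use z0 in \<open>auto simp: limitin_const_iff\<close>)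
  next
    case (Suc n)
    show ?case
    proof (cases "n \<in> periods G")
      case False
      have "F (Suc n) = F n" using False by (auto simp: F_def fun_eq_iff less_Suc_eq)
      then show ?thesis using Suc by simp
    next
      case True
      let ?\<phi> = "\<lambda>(z, y). z(n := y)"
      have 1: "?\<phi> q \<in> paths"
        if "q \<in> topspace (prod_topology (env_path_top G) (top_of_set (env_vars G)))" for q
        using that True by (auto simp: env_path_top_topspace PiE_iff extensional_def)
      have "discrete_limit (prim G) (env_path_top G) (\<lambda>\<omega>. ?\<phi> (F n \<omega>, env_path G s \<omega> n))"
      proof (rule discrete_limit_compose[OF discrete_limit_Pair[OF Suc discrete_limit_env_path[OF s True]]])
        fix qs q assume q: "range qs \<subseteq> topspace (prod_topology (env_path_top G) (top_of_set (env_vars G)))"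
          "limitin (prod_topology (env_path_top G) (top_of_set (env_vars G))) qs q sequentially"
        show "limitin (env_path_top G) (\<lambda>n. ?\<phi> (qs n)) (?\<phi> q) sequentially"
          unfolding limitin_env_path_top
        proof (intro conjI always_eventually allI 1 ballI)
          show "q \<in> topspace (prod_topology (env_path_top G) (top_of_set (env_vars G)))" using q(2) by (auto simp: limitin_def)
          show "qs k \<in> topspace (prod_topology (env_path_top G) (top_of_set (env_vars G)))" for k using q(1) by auto
          fix t assume "t \<in> periods G"
          then show "(\<lambda>k. ?\<phi> (qs k) t) \<longlonglongrightarrow> ?\<phi> q t"
            using q(2) by (auto simp: limitin_pairwise limitin_env_path_top limitin_subtopology case_prod_unfold o_def)
        qed
      qed (rule Pi_I, rule 1)
      moreover have "(\<lambda>\<omega>. ?\<phi> (F n \<omega>, env_path G s \<omega> n)) = F (Suc n)"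
        using True by (auto simp: F_def fun_eq_iff less_Suc_eq)
      ultimately show ?thesis by simp
    qed
  qed
  show ?thesis
  proof (rule limit_measurable_borel_of[OF env_path_top_metrizable])
    show "F n \<in> prim G \<rightarrow>\<^sub>M path_borel" for n
      by (rule discrete_limit_measurable[OF env_path_top_metrizable dl])
    fix \<omega> assume \<omega>: "\<omega> \<in> space (prim G)"
    show "limitin (env_path_top G) (\<lambda>n. F n \<omega>) (env_path G s \<omega>) sequentially"
      unfolding limitin_env_path_top
    proof (intro conjI always_eventually allI ballI env_path_in[OF s \<omega>] F_in[OF \<omega>])
      fix t assume "t \<in> periods G"
      then show "(\<lambda>n. F n \<omega> t) \<longlonglongrightarrow> env_path G s \<omega> t"
        by (intro tendsto_eventually) (auto simp: F_def eventually_sequentially intro!: exI[of _ "Suc t"])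
    qed
  qed
qed

section \<open>Play of one DM against a given environment path\<close>

lemma own_history_in:
  assumes "(X, U) \<in> own_states G i t" "z \<in> paths" "\<And>k. k < t \<Longrightarrow> k \<in> periods G"
  shows "(X, U, restrict z {..<t}) \<in> histories G i t"
  using assms by (auto simp: own_states_def histories_def env_path_top_topspace)

lemma own_step_in:
  assumes t: "t \<in> periods G" and s: "s \<in> pures i" and z: "z \<in> paths"
    and p: "p \<in> own_states G i t" and w: "w \<in> noises G i"
  shows "own_step G i s z t p w \<in> own_states G i (Suc t)"
    "s t (fst p, snd p, restrict z {..<t}) \<in> controls G i"
proof -
  obtain X U where p_eq[simp]: "p = (X, U)" by (cases p)
  have h: "(X, U, restrict z {..<t}) \<in> histories G i t"
    using own_history_in p z periods_downward[OF t] by simp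
  have u: "s t (X, U, restrict z {..<t}) \<in> controls G i"
    by (rule strategies_at_props(2)[OF t strategy_component[OF s t] h])
  then show "s t (fst p, snd p, restrict z {..<t}) \<in> controls G i" by simp
  have x: "X t \<in> states G i" using p by (auto simp: own_states_def)
  have zt: "z t \<in> env_vars G" using z t by (auto simp: env_path_top_topspace)
  show "own_step G i s z t p w \<in> own_states G i (Suc t)"
    using maps_to(1)[OF t x u zt w] u p by (auto simp: own_step_def Let_def own_states_def intro!: PiE_fun_upd_Suc)
qed

lemma own_control_tendsto:
  assumes t: "t \<in> periods G"
    and s: "\<And>n. ss n \<in> pures i" "limitin (strategy_top G i) ss s sequentially"
    and z: "\<And>n. zs n \<in> paths" "limitin (env_path_top G) zs z sequentially"
    and p: "\<And>n. ps n \<in> own_states G i t" "p \<in> own_states G i t" "ps \<longlonglongrightarrow> p"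
  shows "(\<lambda>n. ss n t (fst (ps n), snd (ps n), restrict (zs n) {..<t})) \<longlonglongrightarrow> s t (fst p, snd p, restrict z {..<t})"
proof (rule strategy_eval_tendsto[OF s(2) t])
  have z_in: "z \<in> paths" using z(2) by (auto simp: limitin_def)
  show "(fst (ps n), snd (ps n), restrict (zs n) {..<t}) \<in> histories G i t"
    "(fst p, snd p, restrict z {..<t}) \<in> histories G i t" for n
    using p z(1) z_in by (auto intro!: own_history_in intro: periods_downward[OF t])
  have "(\<lambda>n. restrict (zs n) {..<t}) \<longlonglongrightarrow> restrict z {..<t}"
    using z(2) periods_downward[OF t] by (auto simp: tendsto_fun_iff limitin_env_path_top restrict_def)
  then show "(\<lambda>n. (fst (ps n), snd (ps n), restrict (zs n) {..<t})) \<longlonglongrightarrow> (fst p, snd p, restrict z {..<t})"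
    by (intro tendsto_Pair tendsto_fst tendsto_snd p(3))
qed

text \<open>The environment path is a variable here as well, since the cost is needed as a function
  continuous in strategy and path jointly.\<close>

lemma own_step_tendsto:
  assumes t: "t \<in> periods G"
    and s: "\<And>n. ss n \<in> pures i" "limitin (strategy_top G i) ss s sequentially"
    and z: "\<And>n. zs n \<in> paths" "limitin (env_path_top G) zs z sequentially"
    and p: "\<And>n. ps n \<in> own_states G i t" "p \<in> own_states G i t" "ps \<longlonglongrightarrow> p"
    and w: "\<And>n. ws n \<in> noises G i" "w \<in> noises G i" "ws \<longlonglongrightarrow> w"
  shows "(\<lambda>n. own_step G i (ss n) (zs n) t (ps n) (ws n)) \<longlonglongrightarrow> own_step G i s z t p w"
proof -
  define us where "us n = ss n t (fst (ps n), snd (ps n), restrict (zs n) {..<t})" for n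
  define u where "u = s t (fst p, snd p, restrict z {..<t})"
  have s_in: "s \<in> pures i" and z_in: "z \<in> paths"
    using s(2) z(2) by (auto simp: limitin_def)
  have lim_u: "us \<longlonglongrightarrow> u" unfolding us_def u_def by (rule own_control_tendsto[OF t s z p])
  have u: "us n \<in> controls G i" "u \<in> controls G i" for n
    unfolding us_def u_def
    using own_step_in(2)[OF t s(1) z(1) p(1) w(1)] own_step_in(2)[OF t s_in z_in p(2) w(2)] by blast+
  have x: "fst (ps n) t \<in> states G i" "fst p t \<in> states G i" for n
    using p(1)[of n] p(2) by (auto simp: own_states_def mem_Times_iff PiE_iff)
  have zt: "zs n t \<in> env_vars G" "z t \<in> env_vars G" for n
    using z(1)[of n] z_in t by (auto simp: env_path_top_topspace)
  have lim_z: "(\<lambda>n. zs n t) \<longlonglongrightarrow> z t" using z(2) t by (simp add: limitin_env_path_top)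
  have lim_x: "(\<lambda>n. fst (ps n) t) \<longlonglongrightarrow> fst p t" by (rule tendsto_funD[OF tendsto_fst[OF p(3)]])
  have lim_st: "(\<lambda>n. state_map G i t (fst (ps n) t, us n, zs n t, ws n)) \<longlonglongrightarrow> state_map G i t (fst p t, u, z t, w)"
    by (rule continuous_on_tendsto_compose[OF cont_dynamics(1)[OF t]])
      (use lim_x lim_u lim_z w x u zt in \<open>auto intro!: tendsto_Pair\<close>)
  show ?thesis
    unfolding own_step_def case_prod_unfold Let_def us_def[symmetric] u_def[symmetric]
    by (intro tendsto_Pair tendsto_fun_upd lim_st lim_u tendsto_fst tendsto_snd p(3))
qed

lemma own_play_in:
  assumes s: "s \<in> pures i" and z: "z \<in> paths"
    and \<omega>: "\<omega> \<in> space (prim G)" and t: "\<And>k. k < t \<Longrightarrow> k \<in> periods G"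
  shows "own_play G i s z \<omega> t \<in> own_states G i t"
  using t
proof (induction t)
  case 0
  show ?case using init_in(2)[OF \<omega>] by (auto simp: own_states_def PiE_iff extensional_def)
next
  case (Suc t)
  then show ?case
    unfolding own_play_Suc by (intro own_step_in(1) s z noise_in[OF \<omega>]) auto
qed

lemma own_play_tendsto:
  assumes s: "\<And>n. ss n \<in> pures i" "limitin (strategy_top G i) ss s sequentially"
    and z: "\<And>n. zs n \<in> paths" "limitin (env_path_top G) zs z sequentially"
    and \<omega>: "\<omega> \<in> space (prim G)" and t: "\<And>k. k < t \<Longrightarrow> k \<in> periods G"
  shows "(\<lambda>n. own_play G i (ss n) (zs n) \<omega> t) \<longlonglongrightarrow> own_play G i s z \<omega> t"
  using t
proof (induction t)
  case (Suc t)
  have s_in: "s \<in> pures i" and z_in: "z \<in> paths"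
    using s(2) z(2) by (auto simp: limitin_def)
  show ?case
    unfolding own_play_Suc
    by (intro own_step_tendsto s z own_play_in s_in z_in \<omega> Suc noise_in[OF \<omega>] tendsto_const) (use Suc in auto)
qed simp

lemma discrete_limit_own_play:
  assumes s: "s \<in> pures i" and z: "z \<in> paths"
    and t: "\<And>k. k < t \<Longrightarrow> k \<in> periods G"
  shows "discrete_limit (prim G) (top_of_set (own_states G i t)) (\<lambda>\<omega>. own_play G i s z \<omega> t)"
  using t
proof (induction t)
  case 0
  have "discrete_limit (prim G) (top_of_set (own_states G i 0)) (\<lambda>\<omega>. ((\<lambda>_. undefined)(0 := init G i \<omega>), \<lambda>_. undefined))"
    by (rule discrete_limit_top_of_set_compose[OF discrete_limit_init(2)[of i]])
      (auto simp: own_states_def PiE_iff extensional_def tendsto_fun_iff intro!: tendsto_Pair)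
  then show ?case by simp
next
  case (Suc t)
  have tT: "t \<in> periods G" using Suc.prems by simp
  let ?\<phi> = "\<lambda>(p, w). own_step G i s z t p w"
  have "discrete_limit (prim G) (top_of_set (own_states G i (Suc t))) (\<lambda>\<omega>. ?\<phi> (own_play G i s z \<omega> t, noise G i t \<omega>))"
  proof (rule discrete_limit_top_of_set_compose[where \<phi> = "?\<phi>"])
    show "discrete_limit (prim G) (top_of_set (own_states G i t \<times> noises G i)) (\<lambda>\<omega>. (own_play G i s z \<omega> t, noise G i t \<omega>))"
      using Suc by (intro discrete_limit_Times discrete_limit_noise tT) auto
    show "?\<phi> q \<in> own_states G i (Suc t)" if "q \<in> own_states G i t \<times> noises G i" for q
      using that by (auto intro!: own_step_in(1) tT s z)
    fix ps p assume ps: "\<And>n. ps n \<in> own_states G i t \<times> noises G i" "p \<in> own_states G i t \<times> noises G i"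
      and lim: "ps \<longlonglongrightarrow> p"
    have "(\<lambda>n. own_step G i s z t (fst (ps n)) (snd (ps n))) \<longlonglongrightarrow> own_step G i s z t (fst p) (snd p)"
      by (rule own_step_tendsto[OF tT, of "\<lambda>_. s" _ _ "\<lambda>_. z"])
        (use ps s z in \<open>auto simp: limitin_const_iff mem_Times_iff intro: tendsto_fst[OF lim] tendsto_snd[OF lim]\<close>)
    then show "(\<lambda>n. ?\<phi> (ps n)) \<longlonglongrightarrow> ?\<phi> p" by (simp add: case_prod_unfold)
  qed
  then show ?case by (simp add: own_play_Suc del: own_play.simps)
qed

end

section \<open>Continuity of the costs\<close>

text \<open>Vanishing beyond the horizon, it turns the sum over \<open>periods G\<close> into a
  series over all natural numbers, for finite and infinite horizon alike.\<close>

definition discount_weight where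
  "discount_weight G i t = (if t \<in> periods G then discount G i ^ t else 0)"

definition final_cost where
  "final_cost G i s z \<omega> = (case horizon G of
     enat n \<Rightarrow> discount G i ^ n * terminal_cost G i (own_state G i s z \<omega> n) | \<infinity> \<Rightarrow> 0)"

definition path_cost where
  "path_cost G i s z \<omega> = (\<Sum>t. discount_weight G i t *
     stage_cost G i t (own_state G i s z \<omega> t, own_control G i s z \<omega> t, z t)) + final_cost G i s z \<omega>"

context compact_dynamic_game
begin

lemma discount_bounds: "0 < discount G i" "discount G i \<le> 1" "horizon G = \<infinity> \<Longrightarrow> discount G i < 1"
  using game by (simp_all add: dynamic_game_def)

lemma cost_bound: "\<exists>c\<ge>0. (\<forall>i. \<forall>t\<in>periods G. \<forall>v \<in> states G i \<times> controls G i \<times> env_vars G. \<bar>stage_cost G i t v\<bar> \<le> c) \<and>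
   (horizon G \<noteq> \<infinity> \<longrightarrow> (\<forall>i. \<forall>x\<in>states G i. \<bar>terminal_cost G i x\<bar> \<le> c))"
proof -
  obtain c where c: "\<forall>i. \<forall>t\<in>periods G. \<forall>v \<in> states G i \<times> controls G i \<times> env_vars G. \<bar>stage_cost G i t v\<bar> < c"
    "horizon G \<noteq> \<infinity> \<longrightarrow> (\<forall>i. \<forall>x\<in>states G i. \<bar>terminal_cost G i x\<bar> < c)"
    using bounded_cost by blast
  show ?thesis
  proof (intro exI[of _ "\<bar>c\<bar>"] conjI allI ballI impI)
    fix i t v assume "t \<in> periods G" "v \<in> states G i \<times> controls G i \<times> env_vars G"
    then have "\<bar>stage_cost G i t v\<bar> < c" using c(1) by blast
    then show "\<bar>stage_cost G i t v\<bar> \<le> \<bar>c\<bar>" by linarith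
  next
    fix i x assume "horizon G \<noteq> \<infinity>" "x \<in> states G i"
    then have "\<bar>terminal_cost G i x\<bar> < c" using c(2) by blast
    then show "\<bar>terminal_cost G i x\<bar> \<le> \<bar>c\<bar>" by linarith
  qed simp
qed

lemma summable_discount_weight: "summable (discount_weight G i)"
proof (cases "horizon G")
  case (enat n)
  then show ?thesis
    by (intro summable_finite[of "{..<n}"]) (auto simp: discount_weight_def periods_def)
next
  case infinity
  then have "discount_weight G i = (\<lambda>t. discount G i ^ t)" by (simp add: discount_weight_def periods_def fun_eq_iff)
  moreover have "summable (\<lambda>t. discount G i ^ t)"
    using discount_bounds(1,3)[of i] infinity by (intro summable_geometric) simp
  ultimately show ?thesis by simp
qed

lemma discount_weight_nonneg: "0 \<le> discount_weight G i t"
  using discount_bounds(1)[of i] by (simp add: discount_weight_def)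

text \<open>The step to \<open>Suc t\<close> leaves earlier entries alone, so state and control of
  period \<open>t\<close> can both be read off the play of length \<open>Suc t\<close>, as
  continuous images of one object.\<close>

lemma own_state_eq: "own_state G i s z \<omega> t = fst (own_play G i s z \<omega> (Suc t)) t"
  by (simp add: own_state_def own_play_Suc own_step_def case_prod_unfold Let_def del: own_play.simps)

lemma own_states_Suc:
  assumes "q \<in> own_states G i (Suc t)"
  shows "fst q t \<in> states G i" "snd q t \<in> controls G i"
  using assms by (auto simp: own_states_def mem_Times_iff PiE_iff)

lemma terminal_period: "horizon G = enat n \<Longrightarrow> k < n \<Longrightarrow> k \<in> periods G"
  by (simp add: periods_def)

lemma stage_cost_tendsto:
  assumes t: "t \<in> periods G"
    and q: "\<And>n. qs n \<in> own_states G i (Suc t)" "q \<in> own_states G i (Suc t)" "qs \<longlonglongrightarrow> q"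
    and z: "\<And>n. zs n \<in> paths" "limitin (env_path_top G) zs z sequentially"
  shows "(\<lambda>n. stage_cost G i t (fst (qs n) t, snd (qs n) t, zs n t)) \<longlonglongrightarrow> stage_cost G i t (fst q t, snd q t, z t)"
proof (rule continuous_on_tendsto_compose[OF cont_cost(1)[OF t]])
  have zt: "zs n t \<in> env_vars G" "z t \<in> env_vars G" for n
    using z(1)[of n] z(2) t by (auto simp: env_path_top_topspace limitin_def)
  show "(fst q t, snd q t, z t) \<in> states G i \<times> controls G i \<times> env_vars G"
    using own_states_Suc[OF q(2)] zt by simp
  show "\<forall>\<^sub>F n in sequentially. (fst (qs n) t, snd (qs n) t, zs n t) \<in> states G i \<times> controls G i \<times> env_vars G"
    using own_states_Suc[OF q(1)] zt by simp
  have "(\<lambda>n. zs n t) \<longlonglongrightarrow> z t" using z(2) t by (simp add: limitin_env_path_top)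
  then show "(\<lambda>n. (fst (qs n) t, snd (qs n) t, zs n t)) \<longlonglongrightarrow> (fst q t, snd q t, z t)"
    by (intro tendsto_Pair tendsto_funD[OF tendsto_fst[OF q(3)]] tendsto_funD[OF tendsto_snd[OF q(3)]])
qed

lemma stage_cost_le:
  assumes c: "0 \<le> c" "\<And>i t v. t \<in> periods G \<Longrightarrow> v \<in> states G i \<times> controls G i \<times> env_vars G \<Longrightarrow> \<bar>stage_cost G i t v\<bar> \<le> c"
    and in_space: "s \<in> pures i" "z \<in> paths" "\<omega> \<in> space (prim G)"
  shows "norm (discount_weight G i t * stage_cost G i t (own_state G i s z \<omega> t, own_control G i s z \<omega> t, z t)) \<le>
    discount_weight G i t * c"
proof (cases "t \<in> periods G")
  case True
  have q: "own_play G i s z \<omega> (Suc t) \<in> own_states G i (Suc t)"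
    by (intro own_play_in in_space periods_Suc[OF True])
  have "z t \<in> env_vars G" using in_space(2) True by (auto simp: env_path_top_topspace)
  then have "\<bar>stage_cost G i t (own_state G i s z \<omega> t, own_control G i s z \<omega> t, z t)\<bar> \<le> c"
    using own_states_Suc[OF q] by (intro c(2)[OF True]) (simp add: own_state_eq own_control_def del: own_play.simps)
  then show ?thesis
    using discount_weight_nonneg[of i t] by (simp add: abs_mult mult_left_mono)
qed (simp add: discount_weight_def)

text \<open>One constant serves all DMs, strategies, paths and outcomes. It becomes the dominating
  function of the integrals over the primitive randomness.\<close>

lemma path_cost_bounded:
  obtains B where "0 \<le> B" "\<And>i s z \<omega>. s \<in> pures i \<Longrightarrow> z \<in> paths \<Longrightarrow>
    \<omega> \<in> space (prim G) \<Longrightarrow> \<bar>path_cost G i s z \<omega>\<bar> \<le> B"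
proof -
  obtain c where c: "0 \<le> c"
    "\<And>i t v. t \<in> periods G \<Longrightarrow> v \<in> states G i \<times> controls G i \<times> env_vars G \<Longrightarrow> \<bar>stage_cost G i t v\<bar> \<le> c"
    "\<And>i x. horizon G \<noteq> \<infinity> \<Longrightarrow> x \<in> states G i \<Longrightarrow> \<bar>terminal_cost G i x\<bar> \<le> c"
    using cost_bound by blast
  \<comment> \<open>The maximum over the finitely many DMs makes the bound uniform in
    \<open>i\<close>.\<close>
  define W where "W = Max (range (\<lambda>i. \<Sum>t. discount_weight G i t))"
  have W: "(\<Sum>t. discount_weight G i t) \<le> W" for i unfolding W_def by (rule Max_ge) auto
  have W0: "0 \<le> W" using W[of undefined] suminf_nonneg[OF summable_discount_weight discount_weight_nonneg, of undefined] by linarith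
  \<comment> \<open>\<open>W * c\<close> accounts for the discounted stage costs, the additional
    \<open>c\<close> for the terminal cost.\<close>
  show thesis
  proof (rule that[of "W * c + c"])
    show "0 \<le> W * c + c" using W0 c(1) by simp
    fix i s z \<omega>
    assume *: "s \<in> pures i" "z \<in> paths" "\<omega> \<in> space (prim G)"
    have "norm (\<Sum>t. discount_weight G i t * stage_cost G i t (own_state G i s z \<omega> t, own_control G i s z \<omega> t, z t)) \<le>
        (\<Sum>t. discount_weight G i t * c)"
      by (rule norm_suminf_le[OF stage_cost_le[OF c(1,2) *] summable_mult2[OF summable_discount_weight]])
    also have "\<dots> = (\<Sum>t. discount_weight G i t) * c"
      using suminf_mult2[OF summable_discount_weight, of i c] by simp
    also have "\<dots> \<le> W * c" using W[of i] c(1) by (rule mult_right_mono)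
    finally have sum_le: "norm (\<Sum>t. discount_weight G i t * stage_cost G i t (own_state G i s z \<omega> t, own_control G i s z \<omega> t, z t)) \<le> W * c" .
    have "\<bar>final_cost G i s z \<omega>\<bar> \<le> c"
    proof (cases "horizon G")
      case (enat n)
      have "own_play G i s z \<omega> n \<in> own_states G i n"
        by (intro own_play_in * terminal_period[OF enat])
      then have "own_state G i s z \<omega> n \<in> states G i"
        by (auto simp: own_states_def own_state_def mem_Times_iff PiE_iff)
      then have "\<bar>terminal_cost G i (own_state G i s z \<omega> n)\<bar> \<le> c" by (intro c(3)) (simp_all add: enat)
      moreover have "\<bar>discount G i ^ n\<bar> \<le> 1"
        using discount_bounds[of i] by (simp add: power_abs power_le_one)
      ultimately have "\<bar>discount G i ^ n\<bar> * \<bar>terminal_cost G i (own_state G i s z \<omega> n)\<bar> \<le> 1 * c"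
        by (intro mult_mono) auto
      then show ?thesis by (simp add: final_cost_def enat abs_mult)
    qed (simp add: final_cost_def c(1))
    then show "\<bar>path_cost G i s z \<omega>\<bar> \<le> W * c + c"
      using sum_le unfolding path_cost_def by (simp add: abs_le_iff)
  qed
qed

text \<open>Tannery's theorem exchanges limit and series: the terms converge by continuity of the
  play and are dominated by \<open>discount_weight G i k * c\<close>. The terminal cost is treated
  apart, since it reads the state after the last period.\<close>

lemma path_cost_tendsto:
  assumes s: "\<And>n. ss n \<in> pures i" "limitin (strategy_top G i) ss s sequentially"
    and z: "\<And>n. zs n \<in> paths" "limitin (env_path_top G) zs z sequentially"
    and \<omega>: "\<omega> \<in> space (prim G)"
  shows "(\<lambda>n. path_cost G i (ss n) (zs n) \<omega>) \<longlonglongrightarrow> path_cost G i s z \<omega>"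
proof -
  obtain c where c: "0 \<le> c"
    "\<And>i t v. t \<in> periods G \<Longrightarrow> v \<in> states G i \<times> controls G i \<times> env_vars G \<Longrightarrow> \<bar>stage_cost G i t v\<bar> \<le> c"
    using cost_bound by blast
  have s_in: "s \<in> pures i" and z_in: "z \<in> paths"
    using s(2) z(2) by (auto simp: limitin_def)
  define a where "a s z t = discount_weight G i t * stage_cost G i t (own_state G i s z \<omega> t, own_control G i s z \<omega> t, z t)"
    for s z t
  have lim_a: "(\<lambda>n. a (ss n) (zs n) t) \<longlonglongrightarrow> a s z t" for t
  proof (cases "t \<in> periods G")
    case True
    have "(\<lambda>n. own_play G i (ss n) (zs n) \<omega> (Suc t)) \<longlonglongrightarrow> own_play G i s z \<omega> (Suc t)"
      by (intro own_play_tendsto periods_Suc[OF True] s z \<omega>)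
    then have "(\<lambda>n. stage_cost G i t (fst (own_play G i (ss n) (zs n) \<omega> (Suc t)) t, snd (own_play G i (ss n) (zs n) \<omega> (Suc t)) t, zs n t))
        \<longlonglongrightarrow> stage_cost G i t (fst (own_play G i s z \<omega> (Suc t)) t, snd (own_play G i s z \<omega> (Suc t)) t, z t)"
      by (intro stage_cost_tendsto True own_play_in periods_Suc[OF True] s z s_in z_in \<omega>)
    then show ?thesis
      unfolding a_def own_state_eq own_control_def by (intro tendsto_mult tendsto_const)
  qed (simp add: a_def discount_weight_def)
  have "\<forall>\<^sub>F (k, n) in at_top \<times>\<^sub>F sequentially. norm (a (ss n) (zs n) k) \<le> discount_weight G i k * c"
    unfolding a_def using stage_cost_le[OF c s(1) z(1) \<omega>] by (intro always_eventually) auto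
  from tannerys_theorem[OF lim_a this summable_mult2[OF summable_discount_weight]]
  have "(\<lambda>n. \<Sum>t. a (ss n) (zs n) t) \<longlonglongrightarrow> (\<Sum>t. a s z t)" by simp
  moreover have "(\<lambda>n. final_cost G i (ss n) (zs n) \<omega>) \<longlonglongrightarrow> final_cost G i s z \<omega>"
  proof (cases "horizon G")
    case (enat m)
    note per = terminal_period[OF enat]
    have "(\<lambda>n. own_play G i (ss n) (zs n) \<omega> m) \<longlonglongrightarrow> own_play G i s z \<omega> m"
      by (intro own_play_tendsto per s z \<omega>)
    then have "(\<lambda>n. fst (own_play G i (ss n) (zs n) \<omega> m) m) \<longlonglongrightarrow> fst (own_play G i s z \<omega> m) m"
      by (rule tendsto_funD[OF tendsto_fst])
    moreover have "own_play G i (ss n) (zs n) \<omega> m \<in> own_states G i m" "own_play G i s z \<omega> m \<in> own_states G i m" for n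
      by (intro own_play_in per s z s_in z_in \<omega>; assumption)+
    then have "fst (own_play G i (ss n) (zs n) \<omega> m) m \<in> states G i" "fst (own_play G i s z \<omega> m) m \<in> states G i" for n
      by (auto simp: own_states_def mem_Times_iff PiE_iff)
    ultimately have "(\<lambda>n. terminal_cost G i (own_state G i (ss n) (zs n) \<omega> m)) \<longlonglongrightarrow> terminal_cost G i (own_state G i s z \<omega> m)"
      unfolding own_state_def
      by (intro continuous_on_tendsto_compose[OF cont_cost(2)]) (auto simp: enat)
    then show ?thesis unfolding final_cost_def enat by (auto intro!: tendsto_intros)
  qed (simp add: final_cost_def)
  ultimately show ?thesis
    unfolding path_cost_def a_def by (intro tendsto_add)
qed

lemma path_cost_measurable:
  assumes s: "s \<in> pures i" and z: "z \<in> paths"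
  shows "path_cost G i s z \<in> borel_measurable (prim G)"
proof -
  have st: "(\<lambda>\<omega>. stage_cost G i t (own_state G i s z \<omega> t, own_control G i s z \<omega> t, z t)) \<in> borel_measurable (prim G)"
    if t: "t \<in> periods G" for t
  proof -
    have "discrete_limit (prim G) (top_of_set UNIV) (\<lambda>\<omega>. stage_cost G i t (fst (own_play G i s z \<omega> (Suc t)) t,
      snd (own_play G i s z \<omega> (Suc t)) t, z t))"
      by (rule discrete_limit_top_of_set_compose[OF discrete_limit_own_play[OF s z periods_Suc[OF t]]])
        (use z in \<open>auto intro!: stage_cost_tendsto[OF t] simp: limitin_const_iff\<close>)
    then have "discrete_limit (prim G) euclidean (\<lambda>\<omega>. stage_cost G i t (fst (own_play G i s z \<omega> (Suc t)) t,
      snd (own_play G i s z \<omega> (Suc t)) t, z t))" by simp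
    then show ?thesis
      unfolding own_state_eq own_control_def borel_of_euclidean[symmetric]
      by (rule discrete_limit_measurable[OF metrizable_space_euclidean])
  qed
  have "(\<lambda>\<omega>. discount_weight G i t * stage_cost G i t (own_state G i s z \<omega> t, own_control G i s z \<omega> t, z t)) \<in> borel_measurable (prim G)" for t
    using st[of t] by (cases "t \<in> periods G") (auto simp: discount_weight_def)
  moreover have "final_cost G i s z \<in> borel_measurable (prim G)"
  proof (cases "horizon G")
    case (enat m)
    have in_st: "p \<in> own_states G i m \<Longrightarrow> fst p m \<in> states G i" for p
      by (auto simp: own_states_def mem_Times_iff PiE_iff)
    have "discrete_limit (prim G) (top_of_set UNIV) (\<lambda>\<omega>. terminal_cost G i (fst (own_play G i s z \<omega> m) m))"
      by (rule discrete_limit_top_of_set_compose[OF discrete_limit_own_play[OF s z terminal_period[OF enat]]])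
        (auto simp: enat intro!: continuous_on_tendsto_compose[OF cont_cost(2) tendsto_funD[OF tendsto_fst]]
          always_eventually in_st)
    then have "discrete_limit (prim G) euclidean (\<lambda>\<omega>. terminal_cost G i (fst (own_play G i s z \<omega> m) m))" by simp
    then have "(\<lambda>\<omega>. terminal_cost G i (fst (own_play G i s z \<omega> m) m)) \<in> borel_measurable (prim G)"
      unfolding borel_of_euclidean[symmetric] by (rule discrete_limit_measurable[OF metrizable_space_euclidean])
    then show ?thesis unfolding final_cost_def[abs_def] own_state_def enat by simp
  qed (simp add: final_cost_def[abs_def])
  ultimately show ?thesis
    unfolding path_cost_def[abs_def] by (intro borel_measurable_add borel_measurable_suminf)
qed

text \<open>Absolute summability identifies the unordered sum in \<open>cost\<close> with an
  ordinary series.\<close>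

lemma cost_eq_path_cost:
  assumes s: "s \<in> pures i" and z: "z \<in> paths"
  shows "cost G i s z = (\<integral>\<omega>. path_cost G i s z \<omega> \<partial>prim G)"
  unfolding cost_def
proof (rule Bochner_Integration.integral_cong[OF refl])
  fix \<omega> assume \<omega>: "\<omega> \<in> space (prim G)"
  obtain c where c: "0 \<le> c"
    "\<And>i t v. t \<in> periods G \<Longrightarrow> v \<in> states G i \<times> controls G i \<times> env_vars G \<Longrightarrow> \<bar>stage_cost G i t v\<bar> \<le> c"
    using cost_bound by blast
  let ?f = "\<lambda>t. stage_cost G i t (own_state G i s z \<omega> t, own_control G i s z \<omega> t, z t)"
  have le: "norm (discount_weight G i t * ?f t) \<le> discount_weight G i t * c" for t
    by (rule stage_cost_le[OF c s z \<omega>])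
  have sn: "summable (\<lambda>t. norm (discount_weight G i t * ?f t))"
    by (rule summable_comparison_test'[OF summable_mult2[OF summable_discount_weight, of i c], of 0])
      (use le in simp)
  have "(\<Sum>\<^sub>\<infinity>t\<in>periods G. discount G i ^ t * ?f t) = (\<Sum>\<^sub>\<infinity>t\<in>UNIV. discount_weight G i t * ?f t)"
    by (rule infsum_cong_neutral) (auto simp: discount_weight_def)
  also have "\<dots> = (\<Sum>t. discount_weight G i t * ?f t)"
    by (intro infsumI norm_summable_imp_has_sum[OF sn] summable_sums summable_norm_cancel[OF sn])
  finally show "(\<Sum>\<^sub>\<infinity>t\<in>periods G. discount G i ^ t * ?f t) +
      (case horizon G of enat n \<Rightarrow> discount G i ^ n * terminal_cost G i (own_state G i s z \<omega> n) | \<infinity> \<Rightarrow> 0) =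
      path_cost G i s z \<omega>"
    by (simp add: path_cost_def final_cost_def)
qed

lemma cost_bounded:
  obtains B where "0 \<le> B"
    "\<And>i s z. s \<in> pures i \<Longrightarrow> z \<in> paths \<Longrightarrow> \<bar>cost G i s z\<bar> \<le> B"
proof (rule path_cost_bounded)
  fix B assume B: "0 \<le> B" "\<And>i s z \<omega>. s \<in> pures i \<Longrightarrow> z \<in> paths \<Longrightarrow>
    \<omega> \<in> space (prim G) \<Longrightarrow> \<bar>path_cost G i s z \<omega>\<bar> \<le> B"
  show thesis
    by (rule that[of B]) (auto simp: cost_eq_path_cost intro!: abs_integral_le_prob prob_space_prim B)
qed

text \<open>Dominated convergence over the primitive randomness. The continuity of costs under
  beliefs and of the pulled-back costs rests on this.\<close>

lemma cost_tendsto: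
  assumes s: "\<And>n. ss n \<in> pures i" "limitin (strategy_top G i) ss s sequentially"
    and z: "\<And>n. zs n \<in> paths" "limitin (env_path_top G) zs z sequentially"
  shows "(\<lambda>n. cost G i (ss n) (zs n)) \<longlonglongrightarrow> cost G i s z"
proof (rule path_cost_bounded)
  fix B assume B: "0 \<le> B" "\<And>i s z \<omega>. s \<in> pures i \<Longrightarrow> z \<in> paths \<Longrightarrow>
    \<omega> \<in> space (prim G) \<Longrightarrow> \<bar>path_cost G i s z \<omega>\<bar> \<le> B"
  have in_space: "s \<in> pures i" "z \<in> paths"
    using s(2) z(2) by (auto simp: limitin_def)
  show ?thesis
    unfolding cost_eq_path_cost[OF in_space] cost_eq_path_cost[OF s(1) z(1)]
    by (rule dominated_convergence_prob[OF prob_space_prim, where B = B])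
      (intro path_cost_measurable path_cost_tendsto B in_space s z; assumption)+
qed

end

section \<open>Beliefs and best replies\<close>

lemma borel_probsD:
  assumes "\<mu> \<in> borel_probs X"
  shows "prob_space \<mu>" "sets \<mu> = sets (borel_of X)" "space \<mu> = topspace X"
  using assms sets_eq_imp_space_eq[of \<mu> "borel_of X"] by (auto simp: borel_probs_def)

lemma borel_probs_return: "x \<in> topspace X \<Longrightarrow> return (borel_of X) x \<in> borel_probs X"
  by (simp add: borel_probs_def prob_space_return)

definition belief_cost where
  "belief_cost G i \<zeta> s = (\<integral>z. cost G i s z \<partial>\<zeta>)"

context compact_dynamic_game
begin

lemma cost_measurable:
  assumes s: "s \<in> pures i"
  shows "cost G i s \<in> borel_measurable (path_borel)"
proof (rule continuous_map_measurable, rule seq_continuous_map[OF env_path_top_metrizable])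
  fix zs z assume z: "range zs \<subseteq> paths" "limitin (env_path_top G) zs z sequentially"
  have "(\<lambda>n. cost G i s (zs n)) \<longlonglongrightarrow> cost G i s z"
    by (rule cost_tendsto[of "\<lambda>_. s"]) (use z s in \<open>auto simp: limitin_const_iff\<close>)
  then show "limitin euclidean (\<lambda>n. cost G i s (zs n)) (cost G i s z) sequentially" by simp
qed simp

lemma strategy_discretisation:
  "\<exists>\<rho>. (\<forall>n. \<rho> n \<in> pure_borel i \<rightarrow>\<^sub>M count_space UNIV) \<and> (\<forall>n. countable (range (\<rho> n))) \<and>
    (\<forall>n x. \<rho> n x \<in> pures i) \<and>
    (\<forall>x\<in>pures i. limitin (strategy_top G i) (\<lambda>n::nat. \<rho> n x) x sequentially)"
  by (intro countable_discretisation strategy_top_metrizable strategy_top_compact strategy_top_nonempty)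

text \<open>Fubini's theorem asks for measurability with respect to the product sigma-algebra. The
  cost is a Caratheodory function: continuous in the strategy, Borel in the path.\<close>

lemma cost_measurable_pair:
  "(\<lambda>(s, z). cost G i s z) \<in> borel_measurable (pure_borel i \<Otimes>\<^sub>M path_borel)"
proof -
  obtain \<rho> where \<rho>: "\<forall>n. \<rho> n \<in> pure_borel i \<rightarrow>\<^sub>M count_space UNIV" "\<forall>n. countable (range (\<rho> n))"
    "\<forall>n x. \<rho> n x \<in> pures i"
    "\<forall>x\<in>pures i. limitin (strategy_top G i) (\<lambda>n::nat. \<rho> n x) x sequentially"
    using strategy_discretisation[of i] by (elim exE conjE)
  show ?thesis
    unfolding borel_of_euclidean[symmetric]
  proof (rule caratheodory_measurable[OF metrizable_space_euclidean, where R = \<rho>])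
    fix n
    show "\<rho> n \<in> pure_borel i \<rightarrow>\<^sub>M count_space UNIV" using \<rho>(1) by blast
    show "countable (\<rho> n ` space (pure_borel i))"
      by (rule countable_subset[OF _ \<rho>(2)[rule_format, of n]]) auto
    fix x
    show "cost G i (\<rho> n x) \<in> path_borel \<rightarrow>\<^sub>M borel_of euclidean"
      unfolding borel_of_euclidean by (rule cost_measurable) (use \<rho>(3) in blast)
  next
    fix x y assume "x \<in> space (pure_borel i)" "y \<in> space (path_borel)"
    then have "(\<lambda>n. cost G i (\<rho> n x) y) \<longlonglongrightarrow> cost G i x y"
      using \<rho>(3,4) by (intro cost_tendsto) (auto simp: limitin_const_iff)
    then show "limitin euclidean (\<lambda>n. cost G i (\<rho> n x) y) (cost G i x y) sequentially" by simp
  qed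
qed

section \<open>Random profiles and the law of the environment path\<close>

lemma space_profiles: "space (PiM UNIV (\<lambda>i. pure_borel i)) = profiles G"
  by (auto simp: space_PiM profiles_def PiE_iff)

text \<open>The same argument with the profile as first variable, discretised DM by DM; finitely
  many DMs keep the range countable.\<close>

lemma env_path_measurable_pair:
  "(\<lambda>(s, \<omega>). env_path G s \<omega>) \<in>
    PiM UNIV (\<lambda>i. pure_borel i) \<Otimes>\<^sub>M prim G \<rightarrow>\<^sub>M path_borel"
proof -
  define Q where "Q i \<rho> \<longleftrightarrow> (\<forall>n. \<rho> n \<in> pure_borel i \<rightarrow>\<^sub>M count_space UNIV) \<and> (\<forall>n. countable (range (\<rho> n))) \<and>
    (\<forall>n x. \<rho> n x \<in> pures i) \<and>
    (\<forall>x\<in>pures i. limitin (strategy_top G i) (\<lambda>n::nat. \<rho> n x) x sequentially)" for i \<rho>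
  have "\<forall>i. \<exists>\<rho>. Q i \<rho>" unfolding Q_def using strategy_discretisation by blast
  then obtain \<rho> where Q: "\<And>i. Q i (\<rho> i)" using choice[of Q] by blast
  have \<rho>: "\<rho> i n \<in> pure_borel i \<rightarrow>\<^sub>M count_space UNIV" "countable (range (\<rho> i n))"
    "\<rho> i n x \<in> pures i"
    and lim: "x \<in> pures i \<Longrightarrow> limitin (strategy_top G i) (\<lambda>n. \<rho> i n x) x sequentially" for i n x
    using Q[of i] unfolding Q_def by simp_all
  let ?N = "PiM UNIV (\<lambda>i. pure_borel i)"
  have in_prof: "(\<lambda>i. \<rho> i n (s i)) \<in> profiles G" for n s using \<rho>(3) by (auto simp: profiles_def)
  show ?thesis
  proof (rule caratheodory_measurable[OF env_path_top_metrizable, where R = "\<lambda>n s i. \<rho> i n (s i)"])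
    fix n
    let ?J = "Pi\<^sub>E UNIV (\<lambda>i. range (\<rho> i n))"
    have J: "countable ?J" by (rule countable_PiE) (simp_all add: \<rho>(2))
    show "countable ((\<lambda>s i. \<rho> i n (s i)) ` space ?N)"
      by (rule countable_subset[OF _ J]) auto
    have "(\<lambda>s i. \<rho> i n (s i)) \<in> ?N \<rightarrow>\<^sub>M count_space ?J"
      unfolding measurable_count_space_eq_countable[OF J]
    proof (intro conjI ballI)
      have comp: "(\<lambda>s. \<rho> i n (s i)) \<in> ?N \<rightarrow>\<^sub>M count_space UNIV" for i
        by (rule measurable_compose[OF _ \<rho>(1)]) (rule measurable_component_singleton, simp)
      fix a assume "a \<in> ?J"
      have "(\<lambda>s i. \<rho> i n (s i)) -` {a} \<inter> space ?N = (\<Inter>i. (\<lambda>s. \<rho> i n (s i)) -` {a i} \<inter> space ?N)"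
        by (auto simp: fun_eq_iff)
      also have "\<dots> \<in> sets ?N"
        by (intro sets.finite_INT measurable_sets[OF comp]) auto
      finally show "(\<lambda>s i. \<rho> i n (s i)) -` {a} \<inter> space ?N \<in> sets ?N" .
    qed auto
    from measurable_compose[OF this, of "\<lambda>x. x" "count_space UNIV"]
    show "(\<lambda>s i. \<rho> i n (s i)) \<in> ?N \<rightarrow>\<^sub>M count_space UNIV" by simp
    fix s
    show "env_path G (\<lambda>i. \<rho> i n (s i)) \<in> prim G \<rightarrow>\<^sub>M path_borel"
      by (rule env_path_measurable[OF in_prof])
  next
    fix s \<omega> assume "s \<in> space ?N" and \<omega>: "\<omega> \<in> space (prim G)"
    then have "s i \<in> pures i" for i by (auto simp: space_profiles profiles_def)
    then show "limitin (env_path_top G) (\<lambda>n. env_path G (\<lambda>i. \<rho> i n (s i)) \<omega>) (env_path G s \<omega>) sequentially"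
      by (intro env_path_tendsto in_prof lim \<omega>)
  qed
qed

lemma mixedD:
  assumes "\<nu> \<in> mixed_strategies G i"
  shows "prob_space \<nu>" "sets \<nu> = sets (pure_borel i)" "space \<nu> = pures i"
  using borel_probsD assms unfolding mixed_strategies_def by blast+

lemma mixed_profile_prob: "(\<And>i. \<gamma> i \<in> mixed_strategies G i) \<Longrightarrow> prob_space (PiM UNIV \<gamma>)"
  by (intro prob_space_PiM mixedD(1))

lemma mixed_profile_sets:
  assumes "\<And>i. \<gamma> i \<in> mixed_strategies G i"
  shows "sets (PiM UNIV \<gamma>) = sets (PiM UNIV (\<lambda>i. pure_borel i))"
    "space (PiM UNIV \<gamma>) = profiles G"
proof -
  show 1: "sets (PiM UNIV \<gamma>) = sets (PiM UNIV (\<lambda>i. pure_borel i))"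
    by (intro sets_PiM_cong refl mixedD(2) assms)
  show "space (PiM UNIV \<gamma>) = profiles G" using sets_eq_imp_space_eq[OF 1] by (simp add: space_profiles)
qed

lemma env_path_measurable_mixed:
  assumes "\<And>i. \<gamma> i \<in> mixed_strategies G i"
  shows "(\<lambda>(s, \<omega>). env_path G s \<omega>) \<in> PiM UNIV \<gamma> \<Otimes>\<^sub>M prim G \<rightarrow>\<^sub>M path_borel"
  using env_path_measurable_pair
  by (simp add: measurable_cong_sets[OF sets_pair_measure_cong[OF mixed_profile_sets(1)[OF assms] refl] refl])

text \<open>\<open>env_law\<close> is built with \<open>measure_of\<close>, which has the intended
  values only if the given set function is a measure. Slicing the joint law of profile and
  randomness identifies that function with a push-forward, which settles this and gives total mass
  1.\<close>

lemma env_law_eq_distr: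
  assumes \<gamma>: "\<And>i. \<gamma> i \<in> mixed_strategies G i"
  shows "env_law G \<gamma> = distr (PiM UNIV \<gamma> \<Otimes>\<^sub>M prim G) (path_borel) (\<lambda>(s, \<omega>). env_path G s \<omega>)"
    (is "_ = ?D")
proof -
  interpret P: prob_space "prim G" by (rule prob_space_prim)
  let ?B = "path_borel"
  have eq: "(\<integral>\<^sup>+ s. emeasure (env_law_pure G s) A \<partial>PiM UNIV \<gamma>) = emeasure ?D A" if A: "A \<in> sets ?B" for A
  proof -
    note m = env_path_measurable_mixed[OF \<gamma>]
    have "emeasure ?D A = emeasure (PiM UNIV \<gamma> \<Otimes>\<^sub>M prim G)
        ((\<lambda>(s, \<omega>). env_path G s \<omega>) -` A \<inter> space (PiM UNIV \<gamma> \<Otimes>\<^sub>M prim G))"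
      by (rule emeasure_distr[OF m A])
    also have "\<dots> = (\<integral>\<^sup>+ s. emeasure (prim G) (Pair s -` ((\<lambda>(s, \<omega>). env_path G s \<omega>) -` A \<inter> space (PiM UNIV \<gamma> \<Otimes>\<^sub>M prim G))) \<partial>PiM UNIV \<gamma>)"
      by (rule P.emeasure_pair_measure_alt) (rule measurable_sets[OF m A])
    also have "\<dots> = (\<integral>\<^sup>+ s. emeasure (env_law_pure G s) A \<partial>PiM UNIV \<gamma>)"
    proof (rule nn_integral_cong)
      fix s assume s: "s \<in> space (PiM UNIV \<gamma>)"
      then have "Pair s -` ((\<lambda>(s, \<omega>). env_path G s \<omega>) -` A \<inter> space (PiM UNIV \<gamma> \<Otimes>\<^sub>M prim G)) =
          env_path G s -` A \<inter> space (prim G)"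
        by (auto simp: space_pair_measure)
      moreover have "s \<in> profiles G" using s by (simp add: mixed_profile_sets(2)[OF \<gamma>])
      then have "emeasure (env_law_pure G s) A = emeasure (prim G) (env_path G s -` A \<inter> space (prim G))"
        unfolding env_law_pure_def by (rule emeasure_distr[OF env_path_measurable A])
      ultimately show "emeasure (prim G) (Pair s -` ((\<lambda>(s, \<omega>). env_path G s \<omega>) -` A \<inter> space (PiM UNIV \<gamma> \<Otimes>\<^sub>M prim G))) =
          emeasure (env_law_pure G s) A" by simp
    qed
    finally show ?thesis ..
  qed
  have "env_law G \<gamma> = measure_of (space ?B) (sets ?B) (emeasure ?D)"
    unfolding env_law_def
    by (rule measure_of_eq[OF sets.space_closed], rule eq) (simp only: sets.sigma_sets_eq)
  also have "\<dots> = measure_of (space ?D) (sets ?D) (emeasure ?D)" by simp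
  finally show ?thesis unfolding measure_of_of_measure .
qed

lemma env_law_borel_probs:
  assumes \<gamma>: "\<And>i. \<gamma> i \<in> mixed_strategies G i"
  shows "env_law G \<gamma> \<in> borel_probs (env_path_top G)"
proof -
  interpret P: prob_space "prim G" by (rule prob_space_prim)
  interpret N: prob_space "PiM UNIV \<gamma>" by (rule mixed_profile_prob[OF \<gamma>])
  interpret NP: pair_prob_space "PiM UNIV \<gamma>" "prim G" ..
  show ?thesis
    unfolding env_law_eq_distr[OF \<gamma>] borel_probs_def
    using NP.prob_space_distr[OF env_path_measurable_mixed[OF \<gamma>]] by simp
qed

text \<open>When \<open>g\<close> is the cost of a fixed own strategy, the right side is the average
  over profiles of the costs F_i from the overview.\<close>

lemma integral_env_law:
  fixes g :: "(nat \<Rightarrow> 'y) \<Rightarrow> real"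
  assumes \<gamma>: "\<And>i. \<gamma> i \<in> mixed_strategies G i"
    and g: "g \<in> borel_measurable (path_borel)" "\<And>z. z \<in> paths \<Longrightarrow> \<bar>g z\<bar> \<le> B"
  shows "(\<integral>z. g z \<partial>env_law G \<gamma>) = (\<integral>s. (\<integral>\<omega>. g (env_path G s \<omega>) \<partial>prim G) \<partial>PiM UNIV \<gamma>)"
proof -
  interpret P: prob_space "prim G" by (rule prob_space_prim)
  interpret N: prob_space "PiM UNIV \<gamma>" by (rule mixed_profile_prob[OF \<gamma>])
  interpret NP: pair_prob_space "PiM UNIV \<gamma>" "prim G" ..
  note m = env_path_measurable_mixed[OF \<gamma>]
  have "integrable (PiM UNIV \<gamma> \<Otimes>\<^sub>M prim G) (\<lambda>p. g (case p of (s, \<omega>) \<Rightarrow> env_path G s \<omega>))"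
  proof (rule integrable_bounded_prob)
    show "prob_space (PiM UNIV \<gamma> \<Otimes>\<^sub>M prim G)" by (rule NP.prob_space_axioms)
    show "(\<lambda>p. g (case p of (s, \<omega>) \<Rightarrow> env_path G s \<omega>)) \<in> borel_measurable (PiM UNIV \<gamma> \<Otimes>\<^sub>M prim G)"
      by (rule measurable_compose[OF m g(1)])
    fix p assume "p \<in> space (PiM UNIV \<gamma> \<Otimes>\<^sub>M prim G)"
    then show "\<bar>g (case p of (s, \<omega>) \<Rightarrow> env_path G s \<omega>)\<bar> \<le> B"
      using measurable_space[OF m, of p] g(2) by simp
  qed
  from NP.integral_fst'[OF this] show ?thesis
    unfolding env_law_eq_distr[OF \<gamma>] by (simp add: integral_distr[OF m g(1)])
qed

lemma belief_cost_props:
  assumes \<zeta>: "\<zeta> \<in> borel_probs (env_path_top G)"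
  shows "range ss \<subseteq> pures i \<Longrightarrow> limitin (strategy_top G i) ss s sequentially \<Longrightarrow>
      (\<lambda>n. belief_cost G i \<zeta> (ss n)) \<longlonglongrightarrow> belief_cost G i \<zeta> s"
    "belief_cost G i \<zeta> \<in> borel_measurable (pure_borel i)"
    "\<exists>B. \<forall>s\<in>pures i. \<bar>belief_cost G i \<zeta> s\<bar> \<le> B"
proof -
  note z = borel_probsD[OF \<zeta>]
  obtain B where B: "0 \<le> B" "\<And>i s z. s \<in> pures i \<Longrightarrow> z \<in> paths \<Longrightarrow> \<bar>cost G i s z\<bar> \<le> B"
    using cost_bounded by blast
  have m: "cost G i s \<in> borel_measurable \<zeta>" if "s \<in> pures i" for s
    using cost_measurable[OF that] by (simp add: measurable_cong_sets[OF z(2) refl])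
  show lim: "(\<lambda>n. belief_cost G i \<zeta> (ss n)) \<longlonglongrightarrow> belief_cost G i \<zeta> s"
    if ss: "range ss \<subseteq> pures i" "limitin (strategy_top G i) ss s sequentially" for ss s
    unfolding belief_cost_def
  proof (rule dominated_convergence_prob[OF z(1), where B = B])
    show "cost G i s \<in> borel_measurable \<zeta>" using ss(2) by (intro m) (auto simp: limitin_def)
    show "cost G i (ss n) \<in> borel_measurable \<zeta>" for n using ss(1) by (intro m) auto
    show "\<bar>cost G i (ss n) x\<bar> \<le> B" if "x \<in> space \<zeta>" for n x using ss(1) that z(3) by (intro B) auto
    show "(\<lambda>n. cost G i (ss n) x) \<longlonglongrightarrow> cost G i s x" if "x \<in> space \<zeta>" for x
      using ss that z(3) by (intro cost_tendsto[where zs = "\<lambda>_. x"]) (auto simp: limitin_const_iff)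
  qed
  show "belief_cost G i \<zeta> \<in> borel_measurable (pure_borel i)"
    by (rule continuous_map_measurable, rule seq_continuous_map[OF strategy_top_metrizable]) (use lim in auto)
  show "\<exists>B. \<forall>s\<in>pures i. \<bar>belief_cost G i \<zeta> s\<bar> \<le> B"
    unfolding belief_cost_def using B z(3) by (intro exI[of _ B] ballI abs_integral_le_prob z(1)) auto
qed

text \<open>By Fubini's theorem the cost of a mixed strategy is an average of costs of pure ones, so
  optimality only has to be tested against pure strategies.\<close>

lemma expected_cost_eq:
  assumes \<nu>: "\<nu> \<in> mixed_strategies G i" and \<zeta>: "\<zeta> \<in> borel_probs (env_path_top G)"
  shows "expected_cost G i \<nu> \<zeta> = (\<integral>s. belief_cost G i \<zeta> s \<partial>\<nu>)"
proof -
  note z = borel_probsD[OF \<zeta>] note n = mixedD[OF \<nu>]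
  interpret Z: prob_space \<zeta> by (rule z)
  interpret N: prob_space \<nu> by (rule n)
  interpret NZ: pair_prob_space \<nu> \<zeta> ..
  obtain B where B: "0 \<le> B" "\<And>i s z. s \<in> pures i \<Longrightarrow> z \<in> paths \<Longrightarrow> \<bar>cost G i s z\<bar> \<le> B"
    using cost_bounded by blast
  have "integrable (\<nu> \<Otimes>\<^sub>M \<zeta>) (\<lambda>(s, z). cost G i s z)"
  proof (rule integrable_bounded_prob)
    show "prob_space (\<nu> \<Otimes>\<^sub>M \<zeta>)" by (rule NZ.prob_space_axioms)
    show "(\<lambda>(s, z). cost G i s z) \<in> borel_measurable (\<nu> \<Otimes>\<^sub>M \<zeta>)"
      using cost_measurable_pair by (simp add: measurable_cong_sets[OF sets_pair_measure_cong[OF n(2) z(2)] refl])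
    show "\<bar>case p of (s, z) \<Rightarrow> cost G i s z\<bar> \<le> B" if "p \<in> space (\<nu> \<Otimes>\<^sub>M \<zeta>)" for p
      using that B(2) by (auto simp: space_pair_measure n(3) z(3))
  qed
  from NZ.Fubini_integral[OF this] show ?thesis
    unfolding expected_cost_def belief_cost_def .
qed

lemma belief_cost_integrable:
  assumes \<nu>: "\<nu> \<in> mixed_strategies G i" and \<zeta>: "\<zeta> \<in> borel_probs (env_path_top G)"
  shows "integrable \<nu> (belief_cost G i \<zeta>)"
proof -
  note n = mixedD[OF \<nu>]
  obtain B where B: "\<forall>s\<in>pures i. \<bar>belief_cost G i \<zeta> s\<bar> \<le> B"
    using belief_cost_props(3)[OF \<zeta>] by blast
  show ?thesis
  proof (rule integrable_bounded_prob[OF n(1), where B = B])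
    show "belief_cost G i \<zeta> \<in> borel_measurable \<nu>"
      using belief_cost_props(2)[OF \<zeta>] by (simp add: measurable_cong_sets[OF n(2) refl])
  qed (use B n(3) in auto)
qed

lemma expected_cost_ge:
  assumes \<nu>: "\<nu> \<in> mixed_strategies G i" and \<zeta>: "\<zeta> \<in> borel_probs (env_path_top G)"
    and le: "\<And>s. s \<in> pures i \<Longrightarrow> c \<le> belief_cost G i \<zeta> s"
  shows "c \<le> expected_cost G i \<nu> \<zeta>"
proof -
  note n = mixedD[OF \<nu>]
  interpret N: prob_space \<nu> by (rule n)
  have "(\<integral>s. c \<partial>\<nu>) \<le> (\<integral>s. belief_cost G i \<zeta> s \<partial>\<nu>)"
    using le n(3) by (intro integral_mono belief_cost_integrable[OF \<nu> \<zeta>]) auto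
  then show ?thesis by (simp add: N.prob_space expected_cost_eq[OF \<nu> \<zeta>])
qed

text \<open>A point mass at a minimiser of \<open>belief_cost\<close>, found on the compact set of
  reals that parametrizes the strategies. Nonemptiness is what makes equality of best replies
  informative about identical DMs.\<close>

lemma best_replies_nonempty:
  assumes \<zeta>: "\<zeta> \<in> borel_probs (env_path_top G)"
  shows "best_replies G i \<zeta> \<noteq> {}"
proof -
  have "\<exists>C \<pi>. compact (C :: real set) \<and> \<pi> ` C = pures i \<and> continuous_map (top_of_set C) (strategy_top G i) \<pi>"
    by (intro compact_metrizable_image_of_real_compact strategy_top_metrizable strategy_top_compact strategy_top_nonempty)
  then obtain C \<pi> where C: "compact (C :: real set)" "\<pi> ` C = pures i"
    "continuous_map (top_of_set C) (strategy_top G i) \<pi>" by blast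
  have "C \<noteq> {}" using C(2) strategy_top_nonempty[of i] by (metis image_empty)
  have "continuous_on C (\<lambda>t. belief_cost G i \<zeta> (\<pi> t))"
    unfolding continuous_on_sequentially
  proof (intro allI ballI impI, elim conjE)
    fix ts t assume t: "t \<in> C" "\<forall>n. ts n \<in> C" "ts \<longlonglongrightarrow> t"
    have "limitin (strategy_top G i) (\<pi> \<circ> ts) (\<pi> t) sequentially"
      by (rule continuous_map_limit[OF C(3)]) (use t in \<open>auto simp: limitin_subtopology\<close>)
    then show "((\<lambda>t. belief_cost G i \<zeta> (\<pi> t)) \<circ> ts) \<longlonglongrightarrow> belief_cost G i \<zeta> (\<pi> t)"
      using belief_cost_props(1)[OF \<zeta>, of "\<pi> \<circ> ts" i "\<pi> t"] C(2) t(2) by (auto simp: o_def image_subset_iff)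
  qed
  from continuous_attains_inf[OF C(1) \<open>C \<noteq> {}\<close> this]
  obtain t0 where t0: "t0 \<in> C" "\<And>t. t \<in> C \<Longrightarrow> belief_cost G i \<zeta> (\<pi> t0) \<le> belief_cost G i \<zeta> (\<pi> t)" by blast
  define s0 where "s0 = \<pi> t0"
  have s0: "s0 \<in> pures i" using C(2) t0(1) by (auto simp: s0_def)
  have min: "belief_cost G i \<zeta> s0 \<le> belief_cost G i \<zeta> s" if s: "s \<in> pures i" for s
  proof -
    obtain t where "t \<in> C" "s = \<pi> t" using s unfolding C(2)[symmetric] by blast
    then show ?thesis using t0(2) by (simp add: s0_def)
  qed
  have \<delta>: "return (pure_borel i) s0 \<in> mixed_strategies G i"
    unfolding mixed_strategies_def by (rule borel_probs_return[OF s0])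
  have "expected_cost G i (return (pure_borel i) s0) \<zeta> = belief_cost G i \<zeta> s0"
    unfolding expected_cost_eq[OF \<delta> \<zeta>]
    by (rule integral_return) (use s0 belief_cost_props(2)[OF \<zeta>] in auto)
  then have "return (pure_borel i) s0 \<in> best_replies G i \<zeta>"
    using \<delta> expected_cost_ge[OF _ \<zeta> min] by (auto simp: best_replies_def)
  then show ?thesis by blast
qed

text \<open>Any belief will do, here a point mass. A common best reply is a measure on both strategy
  spaces; hence their carriers coincide, and then so do their topologies.\<close>

lemma identical_strategy_top:
  assumes "identical G i j"
  shows "strategy_top G i = strategy_top G j"
proof -
  obtain z0 where "z0 \<in> paths" using env_path_top_nonempty by blast
  then have \<zeta>: "return (path_borel) z0 \<in> borel_probs (env_path_top G)" by (rule borel_probs_return)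
  obtain \<mu> where \<mu>: "\<mu> \<in> best_replies G i (return (path_borel) z0)"
    using best_replies_nonempty[OF \<zeta>] by blast
  then have "\<mu> \<in> best_replies G j (return (path_borel) z0)"
    using assms \<zeta> unfolding identical_def by blast
  with \<mu> have "\<mu> \<in> mixed_strategies G i" "\<mu> \<in> mixed_strategies G j" by (simp_all add: best_replies_def)
  then have "pures i = pures j" using mixedD(3) by metis
  then show ?thesis by (rule strategy_top_eqI)
qed

end

section \<open>Existence of equilibria\<close>

context compact_dynamic_game
begin

lemma symmetric_SEBEU_exists:
  "\<exists>\<gamma>. SEBEU G \<gamma> \<and> (\<forall>i j. identical G i j \<longrightarrow> \<gamma> i = \<gamma> j)"
proof -
  \<comment> \<open>For identical DMs the predicates \<open>identical G i\<close> and
    \<open>identical G j\<close> are equal, so the choice depends on the class alone.\<close>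
  define r where "r i = (SOME j. identical G i j)" for i
  have id_r: "identical G i (r i)" for i
    unfolding r_def by (rule someI[of _ i]) (simp add: identical_def)
  have r_eq: "r i = r j" if "identical G i j" for i j
  proof -
    have "identical G i = identical G j" using that by (simp add: identical_def fun_eq_iff)
    then show ?thesis by (simp add: r_def)
  qed
  have rr: "r (r i) = r i" for i using r_eq[OF id_r[of i]] by simp
  have top_r: "strategy_top G (r i) = strategy_top G i" for i
    using identical_strategy_top[OF id_r[of i]] by simp

  \<comment> \<open>The parametrization is chosen for a topology, not for a DM; identical DMs thus
    share \<open>C\<close> and \<open>\<pi>\<close>.\<close>
  define code where "code X = (SOME q. compact (fst q :: real set) \<and> snd q ` fst q = topspace X \<and>
    continuous_map (top_of_set (fst q)) X (snd q))" for X :: "('x, 'u, 'y) pure_strategy topology"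
  define C where "C i = fst (code (strategy_top G i))" for i
  define \<pi> where "\<pi> i = snd (code (strategy_top G i))" for i
  have code: "compact (C i) \<and> \<pi> i ` C i = pures i \<and>
    continuous_map (top_of_set (C i)) (strategy_top G i) (\<pi> i)" for i
    unfolding C_def \<pi>_def code_def
  proof (rule someI_ex)
    obtain D \<phi> where "compact (D :: real set)" "\<phi> ` D = pures i"
      "continuous_map (top_of_set D) (strategy_top G i) \<phi>"
      using compact_metrizable_image_of_real_compact[OF strategy_top_metrizable strategy_top_compact strategy_top_nonempty]
      by blast
    then show "\<exists>q. compact (fst q :: real set) \<and> snd q ` fst q = pures i \<and>
      continuous_map (top_of_set (fst q)) (strategy_top G i) (snd q)"
      by (intro exI[of _ "(D, \<phi>)"]) simp
  qed
  then have C: "compact (C i)" and im: "\<pi> i ` C i = pures i"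
    and cm: "continuous_map (top_of_set (C i)) (strategy_top G i) (\<pi> i)" for i by blast+
  have C_ne: "C i \<noteq> {}" for i using im[of i] strategy_top_nonempty[of i] by (metis image_empty)
  have C_r: "C (r i) = C i" "\<pi> (r i) = \<pi> i" for i by (simp_all add: C_def \<pi>_def top_r)
  have \<pi>_in: "\<pi> i t \<in> pures i" if "t \<in> C i" for i t using im that by blast
  have \<pi>_lim: "limitin (strategy_top G i) (\<lambda>n. \<pi> i (ts n)) (\<pi> i t) sequentially"
    if "\<And>n. ts n \<in> C i" "t \<in> C i" "ts \<longlonglongrightarrow> t" for i ts t
    using continuous_map_limit[OF cm, where f = ts and l = t and F = sequentially] that by (simp add: limitin_subtopology o_def)
  have prof: "(\<lambda>j. \<pi> j (v j)) \<in> profiles G" if "\<And>j. v j \<in> C j" for v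
    using \<pi>_in that by (auto simp: profiles_def)

  obtain B where B: "0 \<le> B"
    "\<And>i s z. s \<in> pures i \<Longrightarrow> z \<in> paths \<Longrightarrow> \<bar>cost G i s z\<bar> \<le> B"
    using cost_bounded by blast
  \<comment> \<open>\<open>v\<close> keeps its own entry for \<open>i\<close> beside
    \<open>a\<close>: changing \<open>a\<close> leaves the path untouched, as the exogenous belief
    demands.\<close>
  define F where "F i = (\<lambda>(a, v). \<integral>\<omega>. cost G i (\<pi> i a) (env_path G (\<lambda>j. \<pi> j (v j)) \<omega>) \<partial>prim G)" for i
  let ?D = "\<lambda>i. C i \<times> Pi UNIV C"
  have F_meas: "(\<lambda>\<omega>. cost G i (\<pi> i a) (env_path G (\<lambda>j. \<pi> j (v j)) \<omega>)) \<in> borel_measurable (prim G)"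
    if "a \<in> C i" "\<And>j. v j \<in> C j" for i a v
    by (rule measurable_compose[OF env_path_measurable[OF prof] cost_measurable[OF \<pi>_in]]) (use that in auto)
  have F_bound: "norm (F i p) \<le> B" if "p \<in> ?D i" for i p
    unfolding F_def case_prod_unfold real_norm_def
    using that by (intro abs_integral_le_prob prob_space_prim B \<pi>_in env_path_in prof) auto
  have F_cont: "continuous_on (?D i) (F i)" for i
    unfolding continuous_on_sequentially
  proof (intro allI ballI impI, elim conjE)
    fix ps p assume p: "p \<in> ?D i" "\<forall>n. ps n \<in> ?D i" "ps \<longlonglongrightarrow> p"
    have ps: "fst (ps n) \<in> C i" "snd (ps n) j \<in> C j" "fst p \<in> C i" "snd p j \<in> C j" for n j
      using p(1) p(2)[rule_format, of n] by auto
    have "(\<lambda>n. F i (ps n)) \<longlonglongrightarrow> F i p"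
      unfolding F_def case_prod_unfold
    proof (rule dominated_convergence_prob[OF prob_space_prim, where B = B])
      fix n
      show "(\<lambda>\<omega>. cost G i (\<pi> i (fst p)) (env_path G (\<lambda>j. \<pi> j (snd p j)) \<omega>)) \<in> borel_measurable (prim G)"
        "(\<lambda>\<omega>. cost G i (\<pi> i (fst (ps n))) (env_path G (\<lambda>j. \<pi> j (snd (ps n) j)) \<omega>)) \<in> borel_measurable (prim G)"
        by (intro F_meas ps)+
      fix \<omega> assume \<omega>: "\<omega> \<in> space (prim G)"
      show "\<bar>cost G i (\<pi> i (fst (ps n))) (env_path G (\<lambda>j. \<pi> j (snd (ps n) j)) \<omega>)\<bar> \<le> B"
        by (intro B \<pi>_in ps env_path_in prof \<omega>)
    next
      fix \<omega> assume \<omega>: "\<omega> \<in> space (prim G)"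
      show "(\<lambda>n. cost G i (\<pi> i (fst (ps n))) (env_path G (\<lambda>j. \<pi> j (snd (ps n) j)) \<omega>)) \<longlonglongrightarrow>
          cost G i (\<pi> i (fst p)) (env_path G (\<lambda>j. \<pi> j (snd p j)) \<omega>)"
      proof (intro cost_tendsto \<pi>_in ps env_path_in prof \<omega> \<pi>_lim env_path_tendsto)
        show "(\<lambda>n. fst (ps n)) \<longlonglongrightarrow> fst p" by (rule tendsto_fst[OF p(3)])
        show "(\<lambda>n. snd (ps n) j) \<longlonglongrightarrow> snd p j" for j by (rule tendsto_funD[OF tendsto_snd[OF p(3)]])
      qed
    qed
    then show "(F i \<circ> ps) \<longlonglongrightarrow> F i p" by (simp add: o_def)
  qed
  \<comment> \<open>\<open>mixed_equilibrium_real\<close> takes costs on the whole space, so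
    \<open>F i\<close> is extended from its compact domain by Tietze's theorem with the same bound
    \<open>B\<close>.\<close>
  have "\<forall>i. \<exists>h. continuous_on UNIV h \<and> (\<forall>x\<in>?D i. h x = F i x) \<and> (\<forall>x. \<bar>h x\<bar> \<le> B)"
  proof
    fix i
    have "closedin (top_of_set UNIV) (?D i)"
      using compact_Times[OF C[of i] compact_Pi[of C, OF C]] by (simp add: compact_imp_closed)
    from Tietze[OF F_cont this B(1) F_bound]
    obtain h where "continuous_on UNIV h" "\<And>x. x \<in> ?D i \<Longrightarrow> h x = F i x" "\<And>x. norm (h x) \<le> B"
      by (metis UNIV_I)
    then show "\<exists>h. continuous_on UNIV h \<and> (\<forall>x\<in>?D i. h x = F i x) \<and> (\<forall>x. \<bar>h x\<bar> \<le> B)" by auto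
  qed
  from choice[OF this] obtain H where H: "\<And>i. continuous_on UNIV (H i)" "\<And>i x. x \<in> ?D i \<Longrightarrow> H i x = F i x"
    "\<And>i x. \<bar>H i x\<bar> \<le> B" by blast
  have "\<exists>\<mu>. (\<forall>i. real_distribution (\<mu> i)) \<and> (\<forall>i. AE x in \<mu> i. x \<in> C i) \<and> (\<forall>i. \<mu> (r i) = \<mu> i) \<and>
    (\<forall>i. r i = i \<longrightarrow> (\<forall>b\<in>C i.
      (\<integral>a. (\<integral>v. H i (a, v) \<partial>PiM UNIV \<mu>) \<partial>\<mu> i) \<le> (\<integral>v. H i (b, v) \<partial>PiM UNIV \<mu>)))"
    by (rule mixed_equilibrium_real[of C r H B, OF C C_ne rr C_r(1) H(1,3)])
  then obtain \<mu> where \<mu>: "\<forall>i. real_distribution (\<mu> i)" "\<forall>i. AE x in \<mu> i. x \<in> C i" "\<forall>i. \<mu> (r i) = \<mu> i"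
    "\<forall>i. r i = i \<longrightarrow> (\<forall>b\<in>C i.
      (\<integral>a. (\<integral>v. H i (a, v) \<partial>PiM UNIV \<mu>) \<partial>\<mu> i) \<le> (\<integral>v. H i (b, v) \<partial>PiM UNIV \<mu>))"
    by (elim exE conjE)
  have \<mu>_prob: "prob_space (\<mu> i)" and \<mu>_sets: "sets (\<mu> i) = sets borel" for i
    using \<mu>(1)[rule_format, of i] by (simp_all add: real_distribution_def real_distribution.events_eq_borel)

  define s0 where "s0 X = (SOME s. s \<in> topspace X)" for X :: "('x, 'u, 'y) pure_strategy topology"
  have s0: "s0 (strategy_top G i) \<in> pures i" for i
    unfolding s0_def by (rule some_in_eq[THEN iffD2, OF strategy_top_nonempty])
  \<comment> \<open>\<open>\<pi> i\<close> is controlled only on \<open>C i\<close>. The default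
    elsewhere is attained on a null set only, and as a function of the topology it preserves
    \<open>\<sigma> (r i) = \<sigma> i\<close>.\<close>
  define \<sigma> where "\<sigma> i t = (if t \<in> C i then \<pi> i t else s0 (strategy_top G i))" for i t
  have \<sigma>_meas: "\<sigma> i \<in> \<mu> i \<rightarrow>\<^sub>M pure_borel i" for i
  proof (rule measurable_borel_ofI)
    show "\<sigma> i \<in> space (\<mu> i) \<rightarrow> pures i" using \<pi>_in s0 by (auto simp: \<sigma>_def)
    fix U assume U: "openin (strategy_top G i) U"
    have "openin (top_of_set (C i)) {t \<in> C i. \<pi> i t \<in> U}"
      using cm[of i] U by (auto simp: continuous_map_def)
    then obtain V where V: "open V" "{t \<in> C i. \<pi> i t \<in> U} = C i \<inter> V" by (auto simp: openin_open)
    have sp: "space (\<mu> i) = UNIV" using sets_eq_imp_space_eq[OF \<mu>_sets[of i]] by simp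
    \<comment> \<open>Inside \<open>C i\<close> the preimage is relatively open; outside, it is
      everything or nothing.\<close>
    have "\<sigma> i -` U \<inter> space (\<mu> i) = (C i \<inter> V) \<union> (if s0 (strategy_top G i) \<in> U then - C i else {})"
      unfolding V(2)[symmetric] by (auto simp: \<sigma>_def sp split: if_splits)
    also have "\<dots> \<in> sets (\<mu> i)"
      using V(1) compact_imp_closed[OF C[of i]] by (auto simp: \<mu>_sets)
    finally show "\<sigma> i -` U \<inter> space (\<mu> i) \<in> sets (\<mu> i)" .
  qed
  define \<gamma> where "\<gamma> i = distr (\<mu> i) (pure_borel i) (\<sigma> i)" for i
  have mixed: "\<gamma> i \<in> mixed_strategies G i" for i
    unfolding mixed_strategies_def borel_probs_def \<gamma>_def
    using prob_space.prob_space_distr[OF \<mu>_prob \<sigma>_meas] by simp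
  have \<gamma>_r: "\<gamma> (r i) = \<gamma> i" for i
  proof -
    have "\<sigma> (r i) = \<sigma> i" by (simp add: \<sigma>_def fun_eq_iff C_r top_r)
    then show ?thesis using \<mu>(3) by (simp add: \<gamma>_def top_r)
  qed
  let ?S = "PiM UNIV (\<lambda>i. pure_borel i)"
  have \<gamma>_distr: "PiM UNIV \<gamma> = distr (PiM UNIV \<mu>) ?S (\<lambda>v j. \<sigma> j (v j))"
    unfolding \<gamma>_def by (rule PiM_distr_UNIV[OF \<mu>_prob \<sigma>_meas])
  have \<sigma>s_meas: "(\<lambda>v j. \<sigma> j (v j)) \<in> PiM UNIV \<mu> \<rightarrow>\<^sub>M ?S"
  proof (rule measurable_PiM_single')
    show "(\<lambda>v. \<sigma> j (v j)) \<in> PiM UNIV \<mu> \<rightarrow>\<^sub>M pure_borel j" for j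
      by (rule measurable_compose[OF _ \<sigma>_meas]) (rule measurable_component_singleton, simp)
    show "(\<lambda>v j. \<sigma> j (v j)) \<in> space (PiM UNIV \<mu>) \<rightarrow> (\<Pi>\<^sub>E i\<in>UNIV. space (pure_borel i))"
      using \<pi>_in s0 by (auto simp: \<sigma>_def)
  qed
  define \<zeta> where "\<zeta> = env_law G \<gamma>"
  have \<zeta>: "\<zeta> \<in> borel_probs (env_path_top G)" unfolding \<zeta>_def by (rule env_law_borel_probs[OF mixed])
  have AE_C: "AE v in PiM UNIV \<mu>. \<forall>j. v j \<in> C j"
    unfolding AE_all_countable
  proof
    fix j show "AE v in PiM UNIV \<mu>. v j \<in> C j"
      by (rule AE_PiM_component[of UNIV \<mu>]) (use \<mu>(2) \<mu>_prob in auto)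
  qed

  \<comment> \<open>Almost every profile \<open>v\<close> lies in \<open>C\<close> coordinatewise,
    where \<open>\<sigma>\<close> is \<open>\<pi>\<close> and \<open>H\<close> is \<open>F\<close>.
    Beliefs about the dynamic game thus become costs of the game on reals.\<close>
  have belief: "belief_cost G i \<zeta> (\<pi> i a) = (\<integral>v. H i (a, v) \<partial>PiM UNIV \<mu>)" if a: "a \<in> C i" for i a
  proof -
    let ?g = "\<lambda>s. \<integral>\<omega>. cost G i (\<pi> i a) (env_path G s \<omega>) \<partial>prim G"
    interpret P: prob_space "prim G" by (rule prob_space_prim)
    have m: "(\<lambda>(s, \<omega>). cost G i (\<pi> i a) (env_path G s \<omega>)) \<in> borel_measurable (?S \<Otimes>\<^sub>M prim G)"
      using measurable_compose[OF env_path_measurable_pair cost_measurable[OF \<pi>_in[OF a]]]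
      by (simp add: case_prod_unfold)
    have g_meas: "?g \<in> borel_measurable ?S"
      by (rule P.borel_measurable_lebesgue_integral[OF m])
    have "belief_cost G i \<zeta> (\<pi> i a) = (\<integral>s. ?g s \<partial>PiM UNIV \<gamma>)"
      unfolding belief_cost_def \<zeta>_def
      by (rule integral_env_law[OF mixed cost_measurable[OF \<pi>_in[OF a]] B(2)[OF \<pi>_in[OF a]]])
    also have "\<dots> = (\<integral>v. ?g (\<lambda>j. \<sigma> j (v j)) \<partial>PiM UNIV \<mu>)"
      unfolding \<gamma>_distr by (rule integral_distr[OF \<sigma>s_meas g_meas])
    also have "\<dots> = (\<integral>v. H i (a, v) \<partial>PiM UNIV \<mu>)"
    proof (rule integral_cong_AE)
      show "(\<lambda>v. ?g (\<lambda>j. \<sigma> j (v j))) \<in> borel_measurable (PiM UNIV \<mu>)"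
        by (rule measurable_compose[OF \<sigma>s_meas g_meas])
      have "continuous_on UNIV (\<lambda>v. H i (a, v))"
        by (rule continuous_on_compose2[OF H(1)]) (auto intro!: continuous_intros)
      then have "(\<lambda>v. H i (a, v)) \<in> borel_measurable borel" by (rule borel_measurable_continuous_onI)
      then show "(\<lambda>v. H i (a, v)) \<in> borel_measurable (PiM UNIV \<mu>)"
        by (simp add: measurable_cong_sets[OF sets_PiM_real_distribution[OF \<mu>(1)[rule_format]] refl])
      show "AE v in PiM UNIV \<mu>. ?g (\<lambda>j. \<sigma> j (v j)) = H i (a, v)"
        using AE_C
      proof eventually_elim
        case (elim v)
        then have "H i (a, v) = F i (a, v)" using a by (intro H(2)) auto
        moreover have "(\<lambda>j. \<sigma> j (v j)) = (\<lambda>j. \<pi> j (v j))" using elim by (simp add: \<sigma>_def)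
        ultimately show ?case by (simp add: F_def)
      qed
    qed
    finally show ?thesis .
  qed
  \<comment> \<open>\<open>?K\<close> is at once the expected cost of \<open>\<gamma> i\<close> and,
    by the equilibrium inequality on reals, a lower bound for the cost of every pure
    strategy.\<close>
  have optimal: "\<gamma> i \<in> best_replies G i \<zeta>" if ri: "r i = i" for i
  proof -
    let ?K = "\<integral>a. (\<integral>v. H i (a, v) \<partial>PiM UNIV \<mu>) \<partial>\<mu> i"
    have le: "?K \<le> belief_cost G i \<zeta> s" if s: "s \<in> pures i" for s
    proof -
      obtain b where "b \<in> C i" "s = \<pi> i b" using s unfolding im[of i, symmetric] by blast
      then show ?thesis using \<mu>(4) ri by (simp add: belief)
    qed
    have "expected_cost G i (\<gamma> i) \<zeta> = (\<integral>a. belief_cost G i \<zeta> (\<sigma> i a) \<partial>\<mu> i)"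
      unfolding expected_cost_eq[OF mixed \<zeta>] unfolding \<gamma>_def
      by (rule integral_distr[OF \<sigma>_meas belief_cost_props(2)[OF \<zeta>]])
    also have "\<dots> = ?K"
    proof (rule integral_cong_AE)
      show "(\<lambda>a. belief_cost G i \<zeta> (\<sigma> i a)) \<in> borel_measurable (\<mu> i)"
        by (rule measurable_compose[OF \<sigma>_meas belief_cost_props(2)[OF \<zeta>]])
      have "(\<lambda>a. \<integral>v. H i (a, v) \<partial>PiM UNIV \<mu>) \<in> borel_measurable borel"
        using \<mu>(1) by (intro borel_measurable_continuous_onI continuous_integral_PiM[OF _ H(1) H(3)]) auto
      then show "(\<lambda>a. \<integral>v. H i (a, v) \<partial>PiM UNIV \<mu>) \<in> borel_measurable (\<mu> i)"
        by (simp add: measurable_cong_sets[OF \<mu>_sets refl])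
      show "AE a in \<mu> i. belief_cost G i \<zeta> (\<sigma> i a) = (\<integral>v. H i (a, v) \<partial>PiM UNIV \<mu>)"
        using \<mu>(2)[rule_format, of i] by eventually_elim (simp add: \<sigma>_def belief)
    qed
    finally show ?thesis
      using mixed expected_cost_ge[OF _ \<zeta> le] by (auto simp: best_replies_def)
  qed
  \<comment> \<open>A DM that copies its representative is optimal as well: the two have the same
    best replies at every Borel probability measure, in particular at
    \<open>\<zeta>\<close>.\<close>
  have "\<gamma> i \<in> best_replies G i \<zeta>" for i
  proof -
    have "\<gamma> i \<in> best_replies G (r i) \<zeta>" using optimal[OF rr[of i]] by (simp add: \<gamma>_r)
    then show ?thesis using id_r[of i] \<zeta> by (auto simp: identical_def)
  qed
  then have "SEBEU G \<gamma>" using mixed by (simp add: SEBEU_def \<zeta>_def)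
  moreover have "\<gamma> i = \<gamma> j" if "identical G i j" for i j
    using r_eq[OF that] \<gamma>_r[of i] \<gamma>_r[of j] by simp
  ultimately show ?thesis by blast
qed

end

theorem theorem3p1:
  fixes G :: "('i::finite, 'x0::metric_space, 'x::metric_space, 'u::metric_space, 'y::metric_space,
    'w0::metric_space, 'w::metric_space, 'n::metric_space, 'om) dynamic_game"
  assumes game: "dynamic_game G"
    and compact_env: "compact (env_states G)" "env_states G \<noteq> {}"
      "compact (env_vars G)" "env_vars G \<noteq> {}"
      "compact (env_noises G)" "env_noises G \<noteq> {}"
      "compact (obs_noises G)" "obs_noises G \<noteq> {}"
    and compact_DM: "\<And>i. compact (states G i)" "\<And>i. states G i \<noteq> {}"
      "\<And>i. compact (controls G i)" "\<And>i. controls G i \<noteq> {}"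
      "\<And>i. compact (noises G i)" "\<And>i. noises G i \<noteq> {}"
    and cont_cost: "\<And>i t. t \<in> periods G \<Longrightarrow>
        continuous_on (states G i \<times> controls G i \<times> env_vars G) (stage_cost G i t)"
      "\<And>i. horizon G \<noteq> \<infinity> \<Longrightarrow> continuous_on (states G i) (terminal_cost G i)"
    and cont_dynamics: "\<And>i t. t \<in> periods G \<Longrightarrow>
        continuous_on (states G i \<times> controls G i \<times> env_vars G \<times> noises G i) (state_map G i t)"
      "\<And>t. t \<in> periods G \<Longrightarrow>
        continuous_on (env_states G \<times> Pi UNIV (states G) \<times> Pi UNIV (controls G) \<times> env_noises G)
          (env_state_map G t)"
      "\<And>t. t \<in> periods G \<Longrightarrow>
        continuous_on (env_states G \<times> Pi UNIV (states G) \<times> Pi UNIV (controls G) \<times> obs_noises G)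
          (env_var_map G t)"
    and strategies: "\<And>i t. t \<in> periods G \<Longrightarrow> strategies_at G i t \<noteq> {}"
      "\<And>i t. t \<in> periods G \<Longrightarrow> compactin (mtopology_of (cont_rules G i t)) (strategies_at G i t)"
    and bounded_cost: "\<exists>cbar::real.
        (\<forall>i. \<forall>t\<in>periods G. \<forall>v \<in> states G i \<times> controls G i \<times> env_vars G.
           \<bar>stage_cost G i t v\<bar> < cbar) \<and>
        (horizon G \<noteq> \<infinity> \<longrightarrow> (\<forall>i. \<forall>x\<in>states G i. \<bar>terminal_cost G i x\<bar> < cbar))"
    and bounded_discount: "\<exists>bbar<1. \<forall>i. discount G i < bbar"
  shows "(\<exists>\<gamma>. SEBEU G \<gamma>) \<and>
         (\<exists>\<gamma>. SEBEU G \<gamma> \<and> (\<forall>i j. identical G i j \<longrightarrow> \<gamma> i = \<gamma> j))"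
proof -
  interpret compact_dynamic_game G
    by (rule compact_dynamic_game.intro) fact+
  show ?thesis
    using symmetric_SEBEU_exists by blast
qed

end
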